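(* Under the assumptions listed in the context, the solution in viscosity sense of the quasi-variational inequality $$\min\Big\{\overline v(t,x)-e^{t}h(t,x),\ \max\Big[-\frac{\partial\overline v}{\partial t}(t,x)+\overline v(t,x)-\mathcal L\overline v(t,x)-e^{t}H^*\big(t,x,\nabla(e^{-t}\overline v(t,x))\sigma(t,x)\big),\ \overline v(t,x)-e^{t}h'(t,x)\Big]\Big\}=0$$ on $[0,T)\times\mathbb R^d$, with terminal condition $\overline v(T,x)=e^{T}g(x)$ for $x\in\mathbb R^d$, is unique in the space of continuous functions on $[0,T]\times\mathbb R^d$ which satisfy a polynomial growth condition, i.e. in the space of continuous $\varphi:[0,T]\times\mathbb R^d\to\mathbb R$ such that $|\varphi(t,x)|\le C(1+|x|^\gamma)$ for all $(t,x)$, for some constants $C$ and $\gamma$.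
   Context: Fix $T>0$, $d\ge1$. Let $A,B$ be compact metric spaces. $\sigma:[0,T]\times\mathbb R^d\to\mathbb R^{d\times d}$ is bounded, continuous, Lipschitz in $x$ uniformly in $t$, invertible, with $\sigma^{-1}(t,x)$ bounded and continuous. - $h,h':[0,T]\times\mathbb R^d\to\mathbb R$ and $g:\mathbb R^d\to\mathbb R$ are continuous with $|g(x)|+|h(t,x)|+|h'(t,x)|\le C(1+|x|^p)$ for some positive $C,p$; $h(t,x)<h'(t,x)$ and $h(T,x)\le g(x)\le h'(T,x)$ for all $(t,x)$. - $\Gamma:[0,T]\times\mathbb R^d\times A\times B\to\mathbb R^+$ is continuous, $(a,b)\mapsto\Gamma(t,x,a,b)$ is uniformly continuous, uniformly in $(t,x)$, and $|\Gamma(t,x,a,b)|\le C(1+|x|^p)$ for some positive $C,p$. - $f:[0,T]\times\mathbb R^d\times A\times B\to\mathbb R^d$ is continuous, $(a,b)\mapsto f(t,x,a,b)$ is continuous uniformly w.r.t. $t$, $f$ is Lipschitz in $x$ (with constant independent of $(t,a,b)$), and $|f(t,x,a,b)|\le C(1+|x|)$. $H(t,x,z,a,b)=z\sigma^{-1}(t,x)f(t,x,a,b)+\Gamma(t,x,a,b)$ for $z\in\mathbb R^d$ (row vector), and Isaacs' condition holds: $H^*(t,x,z):=\inf_{a\in A}\sup_{b\in B}H(t,x,z,a,b)=\sup_{b\in B}\inf_{a\in A}H(t,x,z,a,b)$ for all $(t,x,z)$. $\mathcal L=\frac12\sum_{i,j=1}^d(\sigma\sigma^* )_{ij}(t,x)\frac{\partial^2}{\partial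 x_i\partial x_j}$, where $\sigma^*$ is the transpose of $\sigma$. The gradient $\nabla$ is in $x$ and is a row vector. Viscosity solutions of the quasi-variational inequality $$\min\Big\{\overline v(t,x)-e^{t}h(t,x),\ \max\Big[-\frac{\partial\overline v}{\partial t}(t,x)+\overline v(t,x)-\mathcal L\overline v(t,x)-e^{t}H^*\big(t,x,\nabla(e^{-t}\overline v(t,x))\sigma(t,x)\big),\ \overline v(t,x)-e^{t}h'(t,x)\Big]\Big\}=0$$ on $[0,T)\times\mathbb R^d$, with terminal condition $\overline v(T,x)=e^{T}g(x)$ for $x\in\mathbb R^d$: a continuous $w:[0,T]\times\mathbb R^d\to\mathbb R$ is a viscosity subsolution (resp. supersolution) if $w(T,x)\le e^Tg(x)$ (resp. $\ge$) for all $x$ and, for any $\phi\in\mathcal C^{1,2}([0,T]\times\mathbb R^d)$ and any local maximum (resp. minimum) point $(t,x)\in[0,T)\times\mathbb R^d$ of $w-\phi$, $$\min\Big\{w(t,x)-e^th(t,x),\max\Big[-\frac{\partial\phi}{\partial t}(t,x)+w(t,x)-\mathcal L\phi(t,x)-e^tH^*(t,x,e^{-t}\nabla\phi(t,x)\sigma(t,x)),w(t,x)-e^th'(t,x)\Big]\Big\}\le0\ (\text{resp. }\ge0).$$ It is a viscosity solution if it is both. *)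

theory Defs
  imports "HOL-Analysis.Analysis"
begin

text \<open>
  Functions of \<open>(t, x)\<close> are curried and total; only their values for \<open>0 \<le> t \<le> T\<close> matter.
  Row vectors are elements of \<^typ>\<open>real ^ 'n\<close> acting on matrices by \<open>v*\<close>.
\<close>

definition hamiltonian ::
  "(real \<Rightarrow> real ^ 'n \<Rightarrow> real ^ 'n ^ 'n) \<Rightarrow> (real \<Rightarrow> real ^ 'n \<Rightarrow> 'a \<Rightarrow> 'b \<Rightarrow> real ^ 'n) \<Rightarrow>
   (real \<Rightarrow> real ^ 'n \<Rightarrow> 'a \<Rightarrow> 'b \<Rightarrow> real) \<Rightarrow> real \<Rightarrow> real ^ 'n \<Rightarrow> real ^ 'n \<Rightarrow> 'a \<Rightarrow> 'b \<Rightarrow> real"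
  where "hamiltonian \<sigma> f \<Gamma> t x z a b =
    (z v* matrix_inv (\<sigma> t x)) \<bullet> f t x a b + \<Gamma> t x a b"

definition upper_hamiltonian ::
  "'a set \<Rightarrow> 'b set \<Rightarrow> (real \<Rightarrow> real ^ 'n \<Rightarrow> real ^ 'n ^ 'n) \<Rightarrow>
   (real \<Rightarrow> real ^ 'n \<Rightarrow> 'a \<Rightarrow> 'b \<Rightarrow> real ^ 'n) \<Rightarrow> (real \<Rightarrow> real ^ 'n \<Rightarrow> 'a \<Rightarrow> 'b \<Rightarrow> real) \<Rightarrow>
   real \<Rightarrow> real ^ 'n \<Rightarrow> real ^ 'n \<Rightarrow> real"
  where "upper_hamiltonian A B \<sigma> f \<Gamma> t x z =
    (INF a\<in>A. SUP b\<in>B. hamiltonian \<sigma> f \<Gamma> t x z a b)"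

definition lower_hamiltonian ::
  "'a set \<Rightarrow> 'b set \<Rightarrow> (real \<Rightarrow> real ^ 'n \<Rightarrow> real ^ 'n ^ 'n) \<Rightarrow>
   (real \<Rightarrow> real ^ 'n \<Rightarrow> 'a \<Rightarrow> 'b \<Rightarrow> real ^ 'n) \<Rightarrow> (real \<Rightarrow> real ^ 'n \<Rightarrow> 'a \<Rightarrow> 'b \<Rightarrow> real) \<Rightarrow>
   real \<Rightarrow> real ^ 'n \<Rightarrow> real ^ 'n \<Rightarrow> real"
  where "lower_hamiltonian A B \<sigma> f \<Gamma> t x z =
    (SUP b\<in>B. INF a\<in>A. hamiltonian \<sigma> f \<Gamma> t x z a b)"

text \<open>\<open>\<L>\<phi>\<close> at \<open>(t, x)\<close>, as a function of the Hessian \<open>X\<close> of \<open>\<phi>(t, \<cdot>)\<close> at \<open>x\<close>.\<close>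

definition diffusion_op ::
  "(real \<Rightarrow> real ^ 'n \<Rightarrow> real ^ 'n ^ 'n) \<Rightarrow> real \<Rightarrow> real ^ 'n \<Rightarrow> real ^ 'n ^ 'n \<Rightarrow> real"
  where "diffusion_op \<sigma> t x X =
    1 / 2 * (\<Sum>i\<in>UNIV. \<Sum>j\<in>UNIV. (\<sigma> t x ** transpose (\<sigma> t x)) $ i $ j * X $ i $ j)"

text \<open>
  Left-hand side of the quasi-variational inequality at \<open>(t, x)\<close>, where \<open>r\<close>, \<open>q\<close>, \<open>p\<close>, \<open>X\<close>
  stand for the value, the time derivative, the gradient and the Hessian.
\<close>

definition qvi_op ::
  "'a set \<Rightarrow> 'b set \<Rightarrow> (real \<Rightarrow> real ^ 'n \<Rightarrow> real ^ 'n ^ 'n) \<Rightarrow>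
   (real \<Rightarrow> real ^ 'n \<Rightarrow> 'a \<Rightarrow> 'b \<Rightarrow> real ^ 'n) \<Rightarrow> (real \<Rightarrow> real ^ 'n \<Rightarrow> 'a \<Rightarrow> 'b \<Rightarrow> real) \<Rightarrow>
   (real \<Rightarrow> real ^ 'n \<Rightarrow> real) \<Rightarrow> (real \<Rightarrow> real ^ 'n \<Rightarrow> real) \<Rightarrow>
   real \<Rightarrow> real ^ 'n \<Rightarrow> real \<Rightarrow> real \<Rightarrow> real ^ 'n \<Rightarrow> real ^ 'n ^ 'n \<Rightarrow> real"
  where "qvi_op A B \<sigma> f \<Gamma> h h' t x r q p X =
    min (r - exp t * h t x)
      (max (- q + r - diffusion_op \<sigma> t x X
              - exp t * upper_hamiltonian A B \<sigma> f \<Gamma> t x ((exp (- t) *\<^sub>R p) v* \<sigma> t x))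
           (r - exp t * h' t x))"

text \<open>
  \<open>\<phi> \<in> C\<^sup>1\<^sup>,\<^sup>2([0,T] \<times> \<real>\<^sup>d)\<close> with time derivative \<open>\<phi>t\<close> (one-sided at \<open>0\<close> and \<open>T\<close>),
  spatial gradient \<open>\<phi>x\<close> and spatial Hessian \<open>\<phi>xx\<close>.
\<close>

definition C12 ::
  "real \<Rightarrow> (real \<Rightarrow> real ^ 'n \<Rightarrow> real) \<Rightarrow> (real \<Rightarrow> real ^ 'n \<Rightarrow> real) \<Rightarrow>
   (real \<Rightarrow> real ^ 'n \<Rightarrow> real ^ 'n) \<Rightarrow> (real \<Rightarrow> real ^ 'n \<Rightarrow> real ^ 'n ^ 'n) \<Rightarrow> bool"
  where "C12 T \<phi> \<phi>t \<phi>x \<phi>xx \<longleftrightarrow>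
    (\<forall>t\<in>{0..T}. \<forall>x.
       ((\<lambda>s. \<phi> s x) has_real_derivative \<phi>t t x) (at t within {0..T}) \<and>
       GDERIV (\<phi> t) x :> \<phi>x t x \<and>
       (\<phi>x t has_derivative (\<lambda>v. \<phi>xx t x *v v)) (at x)) \<and>
    continuous_on ({0..T} \<times> UNIV) (\<lambda>(t, x). \<phi> t x) \<and>
    continuous_on ({0..T} \<times> UNIV) (\<lambda>(t, x). \<phi>t t x) \<and>
    continuous_on ({0..T} \<times> UNIV) (\<lambda>(t, x). \<phi>x t x) \<and>
    continuous_on ({0..T} \<times> UNIV) (\<lambda>(t, x). \<phi>xx t x)"

text \<open>Local extrema relative to \<open>S\<close>.\<close>

definition local_max_on :: "'c::topological_space set \<Rightarrow> ('c \<Rightarrow> real) \<Rightarrow> 'c \<Rightarrow> bool"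
  where "local_max_on S u p \<longleftrightarrow> p \<in> S \<and> (\<forall>\<^sub>F q in at p within S. u q \<le> u p)"

definition local_min_on :: "'c::topological_space set \<Rightarrow> ('c \<Rightarrow> real) \<Rightarrow> 'c \<Rightarrow> bool"
  where "local_min_on S u p \<longleftrightarrow> p \<in> S \<and> (\<forall>\<^sub>F q in at p within S. u p \<le> u q)"

definition viscosity_subsolution ::
  "real \<Rightarrow> 'a set \<Rightarrow> 'b set \<Rightarrow> (real \<Rightarrow> real ^ 'n \<Rightarrow> real ^ 'n ^ 'n) \<Rightarrow>
   (real \<Rightarrow> real ^ 'n \<Rightarrow> 'a \<Rightarrow> 'b \<Rightarrow> real ^ 'n) \<Rightarrow> (real \<Rightarrow> real ^ 'n \<Rightarrow> 'a \<Rightarrow> 'b \<Rightarrow> real) \<Rightarrow>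
   (real \<Rightarrow> real ^ 'n \<Rightarrow> real) \<Rightarrow> (real \<Rightarrow> real ^ 'n \<Rightarrow> real) \<Rightarrow> (real ^ 'n \<Rightarrow> real) \<Rightarrow>
   (real \<Rightarrow> real ^ 'n \<Rightarrow> real) \<Rightarrow> bool"
  where "viscosity_subsolution T A B \<sigma> f \<Gamma> h h' g w \<longleftrightarrow>
    continuous_on ({0..T} \<times> UNIV) (\<lambda>(t, x). w t x) \<and>
    (\<forall>x. w T x \<le> exp T * g x) \<and>
    (\<forall>\<phi> \<phi>t \<phi>x \<phi>xx t x.
       C12 T \<phi> \<phi>t \<phi>x \<phi>xx \<longrightarrow> t \<in> {0..<T} \<longrightarrow>
       local_max_on ({0..T} \<times> UNIV) (\<lambda>(s, y). w s y - \<phi> s y) (t, x) \<longrightarrow>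
       qvi_op A B \<sigma> f \<Gamma> h h' t x (w t x) (\<phi>t t x) (\<phi>x t x) (\<phi>xx t x) \<le> 0)"

definition viscosity_supersolution ::
  "real \<Rightarrow> 'a set \<Rightarrow> 'b set \<Rightarrow> (real \<Rightarrow> real ^ 'n \<Rightarrow> real ^ 'n ^ 'n) \<Rightarrow>
   (real \<Rightarrow> real ^ 'n \<Rightarrow> 'a \<Rightarrow> 'b \<Rightarrow> real ^ 'n) \<Rightarrow> (real \<Rightarrow> real ^ 'n \<Rightarrow> 'a \<Rightarrow> 'b \<Rightarrow> real) \<Rightarrow>
   (real \<Rightarrow> real ^ 'n \<Rightarrow> real) \<Rightarrow> (real \<Rightarrow> real ^ 'n \<Rightarrow> real) \<Rightarrow> (real ^ 'n \<Rightarrow> real) \<Rightarrow>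
   (real \<Rightarrow> real ^ 'n \<Rightarrow> real) \<Rightarrow> bool"
  where "viscosity_supersolution T A B \<sigma> f \<Gamma> h h' g w \<longleftrightarrow>
    continuous_on ({0..T} \<times> UNIV) (\<lambda>(t, x). w t x) \<and>
    (\<forall>x. exp T * g x \<le> w T x) \<and>
    (\<forall>\<phi> \<phi>t \<phi>x \<phi>xx t x.
       C12 T \<phi> \<phi>t \<phi>x \<phi>xx \<longrightarrow> t \<in> {0..<T} \<longrightarrow>
       local_min_on ({0..T} \<times> UNIV) (\<lambda>(s, y). w s y - \<phi> s y) (t, x) \<longrightarrow>
       0 \<le> qvi_op A B \<sigma> f \<Gamma> h h' t x (w t x) (\<phi>t t x) (\<phi>x t x) (\<phi>xx t x))"

definition viscosity_solution ::
  "real \<Rightarrow> 'a set \<Rightarrow> 'b set \<Rightarrow> (real \<Rightarrow> real ^ 'n \<Rightarrow> real ^ 'n ^ 'n) \<Rightarrow>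
   (real \<Rightarrow> real ^ 'n \<Rightarrow> 'a \<Rightarrow> 'b \<Rightarrow> real ^ 'n) \<Rightarrow> (real \<Rightarrow> real ^ 'n \<Rightarrow> 'a \<Rightarrow> 'b \<Rightarrow> real) \<Rightarrow>
   (real \<Rightarrow> real ^ 'n \<Rightarrow> real) \<Rightarrow> (real \<Rightarrow> real ^ 'n \<Rightarrow> real) \<Rightarrow> (real ^ 'n \<Rightarrow> real) \<Rightarrow>
   (real \<Rightarrow> real ^ 'n \<Rightarrow> real) \<Rightarrow> bool"
  where "viscosity_solution T A B \<sigma> f \<Gamma> h h' g w \<longleftrightarrow>
    viscosity_subsolution T A B \<sigma> f \<Gamma> h h' g w \<and> viscosity_supersolution T A B \<sigma> f \<Gamma> h h' g w"

text \<open>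
  The sign of \<open>\<gamma>\<close> is immaterial for continuous \<open>\<phi>\<close>: for \<open>\<gamma> \<le> 0\<close> the bound only says that
  \<open>\<phi>\<close> is bounded.
\<close>

definition poly_growth :: "real \<Rightarrow> (real \<Rightarrow> real ^ 'n \<Rightarrow> real) \<Rightarrow> bool"
  where "poly_growth T \<phi> \<longleftrightarrow>
    (\<exists>C \<gamma>. \<forall>t\<in>{0..T}. \<forall>x. \<bar>\<phi> t x\<bar> \<le> C * (1 + norm x powr \<gamma>))"

end

theory Submission
  imports Defs "HOL-Complex_Analysis.Great_Picard"
begin

text \<open>
  Uniqueness is a comparison principle. Doubling the variables and penalizing a subsolution \<open>u\<close> and a
  supersolution \<open>v\<close> with \<open>u > v\<close> somewhere yields a maximum point of
  \<open>u(t, x) - v(s, y) - N/2 |x - y|\<^sup>2 - K/2 (t - s)\<^sup>2\<close>. The second-order information there comes without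
  Aleksandrov's theorem, because the equation is linear in the Hessian and \<open>\<sigma>\<close> is invertible: the
  sup-convolutions of \<open>u\<close> and \<open>- v\<close> around the maximum lie between two paraboloids, so their
  blow-ups, in the coordinates given by \<open>\<sigma>(t, x)\<close> and \<open>\<sigma>(s, y)\<close>, are equi-Lipschitz. By
  Arzela--Ascoli they converge in the unit ball to functions \<open>U\<close>, \<open>V\<close> that are subsolutions of Poisson
  equations with constant right-hand sides \<open>c\<^sub>1\<close>, \<open>c\<^sub>2\<close> and satisfy \<open>U + V \<le> Q\<close>, with equality at \<open>0\<close>, for a
  quadratic \<open>Q\<close>. Approximating \<open>U\<close>, \<open>V\<close> on the sphere by polynomials, and solving the Dirichlet problem for
  polynomials explicitly, reduces \<open>c\<^sub>1 + c\<^sub>2 \<le> 1/2 \<Delta>Q\<close> to the classical maximum principle. The left-hand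
  side is the difference of the first-order parts of the two viscosity inequalities and the right-hand
  side is \<open>N |\<sigma>(t, x) - \<sigma>(s, y)|\<^sup>2\<close>, from where the usual Lipschitz estimates conclude.
\<close>

section \<open>Harmonic polynomials\<close>

text \<open>Division by r^2 after removal of the first-order part freezes everything but the
  Hessian: the points tend to the doubled maximum, the gradients to that of the penalty, and time,
  which enters only to first order, shifts the time derivative by O(r). Both blow-ups share one
  variable z. The images \<sigma>(t, x) z and \<sigma>(s, y) z differ by M z with M = \<sigma>(t, x)
  - \<sigma>(s, y), and completing squares gives Q(z) = N |M z|^2. The factor 2 lost against N/2 |M
  z|^2 is harmless because N |x - y|^2 is small. The unknown enters the equation with coefficient 1,
  so the resulting inequality bounds u - v itself. No limit in N is taken: N and K are fixed from
  moduli of continuity on a compact set. The gap between u and v at the doubled maximum makes the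
  lower obstacle inactive for u, then the upper one inactive for v, which leaves the two parabolic
  inequalities. Local extrema are relative to the closed strip, so t = 0 is no special case.\<close>

definition C2 :: "(real ^ 'n \<Rightarrow> real) \<Rightarrow> (real ^ 'n \<Rightarrow> real ^ 'n) \<Rightarrow> (real ^ 'n \<Rightarrow> real ^ 'n ^ 'n) \<Rightarrow> bool"
  where "C2 f g H \<longleftrightarrow>
    (\<forall>x. GDERIV f x :> g x \<and> (g has_derivative (\<lambda>v. H x *v v)) (at x)) \<and> continuous_on UNIV H"

text \<open>The rank-one matrix a b^T, which the product rule contributes to Hessians.\<close>

definition outer :: "real ^ 'n \<Rightarrow> real ^ 'n \<Rightarrow> real ^ 'n ^ 'n"
  where "outer a b = (\<chi> i j. a $ i * b $ j)"

lemma outer_mult_vec: "outer a b *v v = (b \<bullet> v) *\<^sub>R a"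
  by (simp add: outer_def vec_eq_iff matrix_vector_mult_def inner_vec_def sum_distrib_left
      sum_distrib_right mult_ac)

lemma trace_outer: "trace (outer a b) = a \<bullet> b"
  by (simp add: outer_def trace_def inner_vec_def)

lemma trace_scaleR: "trace (c *\<^sub>R M) = c * trace (M :: real ^ 'n ^ 'n)"
  by (simp add: trace_def sum_distrib_left)

lemma continuous_on_outer [continuous_intros]:
  "continuous_on S f \<Longrightarrow> continuous_on S g \<Longrightarrow> continuous_on S (\<lambda>x. outer (f x) (g x))"
  unfolding outer_def by (intro continuous_intros)

lemma C2_continuous_grad: "C2 f g H \<Longrightarrow> continuous_on S g"
  by (meson C2_def continuous_at_imp_continuous_on has_derivative_continuous)

lemma C2_continuous: "C2 f g H \<Longrightarrow> continuous_on S f"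
  by (meson C2_def continuous_at_imp_continuous_on has_derivative_continuous gderiv_def)

lemma C2_const: "C2 (\<lambda>x. c) (\<lambda>x. 0) (\<lambda>x. 0)"
  by (simp add: C2_def GDERIV_const)

lemma C2_add:
  assumes "C2 f g H" "C2 f' g' H'"
  shows "C2 (\<lambda>x. f x + f' x) (\<lambda>x. g x + g' x) (\<lambda>x. H x + H' x)"
  using assms unfolding C2_def
  by (auto intro!: GDERIV_add continuous_intros derivative_eq_intros simp: matrix_vector_mult_add_rdistrib)

lemma C2_mult:
  assumes "C2 f g H" "C2 f' g' H'"
  shows "C2 (\<lambda>x. f x * f' x) (\<lambda>x. f x *\<^sub>R g' x + f' x *\<^sub>R g x)
    (\<lambda>x. f x *\<^sub>R H' x + f' x *\<^sub>R H x + outer (g' x) (g x) + outer (g x) (g' x))"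
proof -
  have G: "GDERIV f x :> g x" "GDERIV f' x :> g' x"
    "(g has_derivative (\<lambda>v. H x *v v)) (at x)" "(g' has_derivative (\<lambda>v. H' x *v v)) (at x)" for x
    using assms by (auto simp: C2_def)
  have D: "(f has_derivative (\<lambda>v. v \<bullet> g x)) (at x)" "(f' has_derivative (\<lambda>v. v \<bullet> g' x)) (at x)" for x
    using G by (auto simp: gderiv_def)
  show ?thesis
    unfolding C2_def
  proof (intro conjI allI)
    show "GDERIV (\<lambda>x. f x * f' x) x :> f x *\<^sub>R g' x + f' x *\<^sub>R g x" for x
      by (rule GDERIV_mult[OF G(1,2)])
    show "((\<lambda>x. f x *\<^sub>R g' x + f' x *\<^sub>R g x) has_derivative
       (\<lambda>v. (f x *\<^sub>R H' x + f' x *\<^sub>R H x + outer (g' x) (g x) + outer (g x) (g' x)) *v v)) (at x)" for x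
      by (rule derivative_eq_intros D G refl)+
        (auto simp: matrix_vector_mult_add_rdistrib outer_mult_vec scaleR_matrix_vector_assoc
          algebra_simps inner_commute)
    show "continuous_on UNIV (\<lambda>x. f x *\<^sub>R H' x + f' x *\<^sub>R H x + outer (g' x) (g x) + outer (g x) (g' x))"
      using assms
      by (intro continuous_intros C2_continuous[OF assms(1)] C2_continuous[OF assms(2)]
          C2_continuous_grad[OF assms(1)] C2_continuous_grad[OF assms(2)]) (auto simp: C2_def)
  qed
qed

lemma C2_cmult:
  fixes f :: "real ^ 'n \<Rightarrow> real"
  assumes "C2 f g H"
  shows "C2 (\<lambda>x. c * f x) (\<lambda>x. c *\<^sub>R g x) (\<lambda>x. c *\<^sub>R H x)"
proof -
  have "outer a (0 :: real ^ 'n) = 0" "outer (0 :: real ^ 'n) a = 0" for a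
    by (simp_all add: outer_def vec_eq_iff)
  then show ?thesis
    using C2_mult[OF C2_const[of c] assms] by simp
qed

lemma C2_diff:
  assumes "C2 f g H" "C2 f' g' H'"
  shows "C2 (\<lambda>x. f x - f' x) (\<lambda>x. g x - g' x) (\<lambda>x. H x - H' x)"
  using C2_add[OF assms(1) C2_cmult[OF assms(2), of "-1"]] by simp

lemma C2_coordinate: "C2 (\<lambda>x. x $ i) (\<lambda>x. axis i 1) (\<lambda>x. 0)"
  unfolding C2_def gderiv_def
  by (auto intro!: derivative_eq_intros bounded_linear_imp_has_derivative bounded_linear_vec_nth
      simp: inner_axis)

lemma C2_normsq: "C2 (\<lambda>x :: real ^ 'n. x \<bullet> x) (\<lambda>x. 2 *\<^sub>R x) (\<lambda>x. mat 2)"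
proof -
  have "(mat 2 :: real ^ 'n ^ 'n) *v v = 2 *\<^sub>R v" for v
    by (simp add: matrix_vector_mult_def mat_def vec_eq_iff if_distrib cong: if_cong)
      (simp add: if_distrib if_distribR cong: if_cong)
  then show ?thesis
    unfolding C2_def gderiv_def
    by (auto intro!: derivative_eq_intros simp: inner_commute)
qed

text \<open>Homogeneous polynomials as functions. Generation by one coordinate factor at a time lets
  Euler's identity and the degrees of derivatives be proved by rule induction. The zero function has
  every degree, which absorbs the derivatives of polynomials of low degree.\<close>

inductive homogeneous :: "nat \<Rightarrow> (real ^ 'n \<Rightarrow> real) \<Rightarrow> bool" where
  zero: "homogeneous m (\<lambda>x. 0)"
| const: "homogeneous 0 (\<lambda>x. c)"
| coordinate: "homogeneous m p \<Longrightarrow> homogeneous (Suc m) (\<lambda>x. x $ i * p x)"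
| add: "homogeneous m p \<Longrightarrow> homogeneous m q \<Longrightarrow> homogeneous m (\<lambda>x. p x + q x)"

lemma homogeneous_mult:
  assumes "homogeneous m p" "homogeneous l q"
  shows "homogeneous (m + l) (\<lambda>x. p x * q x)"
  using assms(1)
proof induction
  case (const c)
  show ?case
    using assms(2)
  proof induction
    case (coordinate m p i)
    then show ?case
      using homogeneous.coordinate[of "0 + m" "\<lambda>x. c * p x" i] by (simp add: mult_ac)
  next
    case (const d)
    show ?case using homogeneous.const[of "c * d"] by simp
  next
    case (add m p q)
    then show ?case by (simp add: homogeneous.add distrib_left)
  qed (auto intro: homogeneous.zero)
next
  case (coordinate m p i)
  then show ?case
    using homogeneous.coordinate[of "m + l" "\<lambda>x. p x * q x" i] by (simp add: mult_ac)
next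
  case (add m p q)
  then show ?case by (simp add: homogeneous.add distrib_right)
qed (auto intro: homogeneous.zero)

lemma homogeneous_cmult: "homogeneous m p \<Longrightarrow> homogeneous m (\<lambda>x. c * p x)"
  using homogeneous_mult[OF homogeneous.const[of c]] by simp

lemma homogeneous_diff:
  "homogeneous m p \<Longrightarrow> homogeneous m q \<Longrightarrow> homogeneous m (\<lambda>x. p x - q x)"
  using homogeneous.add[OF _ homogeneous_cmult[of m q "-1"], of p] by simp

lemma homogeneous_sum:
  "finite A \<Longrightarrow> (\<And>i. i \<in> A \<Longrightarrow> homogeneous m (p i)) \<Longrightarrow> homogeneous m (\<lambda>x. \<Sum>i\<in>A. p i x)"
  by (induction A rule: finite_induct) (auto intro: homogeneous.intros)

lemma homogeneous_normsq: "homogeneous 2 (\<lambda>x :: real ^ 'n. x \<bullet> x)"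
proof -
  have "homogeneous 2 (\<lambda>x :: real ^ 'n. \<Sum>i\<in>UNIV. x $ i * (x $ i * 1))"
    unfolding numeral_2_eq_2 by (intro homogeneous_sum homogeneous.intros) auto
  then show ?thesis by (simp add: inner_vec_def)
qed

text \<open>
  The degrees \<open>m - 1\<close> and \<open>m - 2\<close> are truncated; the clauses for small \<open>m\<close> make up for it.
\<close>

lemma homogeneous_C2:
  assumes "homogeneous m p"
  shows "\<exists>g H. C2 p g H \<and> (\<forall>x. g x \<bullet> x = m * p x)
    \<and> (\<forall>i. homogeneous (m - 1) (\<lambda>x. g x $ i)) \<and> (m = 0 \<longrightarrow> (\<forall>x. g x = 0))
    \<and> homogeneous (m - 2) (\<lambda>x. trace (H x)) \<and> (m < 2 \<longrightarrow> (\<forall>x. trace (H x) = 0))"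
  using assms
proof induction
  case (zero m)
  show ?case
    by (rule exI[of _ "\<lambda>x. 0"], rule exI[of _ "\<lambda>x. 0"])
      (auto simp: C2_const trace_def intro: homogeneous.intros)
next
  case (const c)
  show ?case
    by (rule exI[of _ "\<lambda>x. 0"], rule exI[of _ "\<lambda>x. 0"])
      (auto simp: C2_const trace_def intro: homogeneous.intros)
next
  case (coordinate m p i)
  then obtain g H where gH: "C2 p g H" "\<And>x. g x \<bullet> x = m * p x"
    "\<And>i. homogeneous (m - 1) (\<lambda>x. g x $ i)" "m = 0 \<Longrightarrow> \<forall>x. g x = 0"
    "homogeneous (m - 2) (\<lambda>x. trace (H x))" "m < 2 \<Longrightarrow> \<forall>x. trace (H x) = 0"
    by blast
  let ?g = "\<lambda>x. x $ i *\<^sub>R g x + p x *\<^sub>R axis i 1"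
  let ?H = "\<lambda>x. x $ i *\<^sub>R H x + p x *\<^sub>R 0 + outer (g x) (axis i 1) + outer (axis i 1) (g x)"
  have tr: "trace (?H x) = x $ i * trace (H x) + 2 * g x $ i" for x
    by (simp add: trace_add trace_scaleR trace_outer inner_axis inner_axis' trace_0)
  have "homogeneous m (\<lambda>x. x $ i * g x $ j)" for j
  proof (cases "m = 0")
    case True
    then show ?thesis using gH(4) by (auto intro: homogeneous.intros)
  next
    case False
    then show ?thesis using homogeneous.coordinate[OF gH(3)[of j], of i] by simp
  qed
  then have 1: "homogeneous m (\<lambda>x. ?g x $ j)" for j
    using coordinate.hyps homogeneous.zero[of m]
    by (auto simp: axis_def intro!: homogeneous.add)
  have "homogeneous (m - 1) (\<lambda>x. x $ i * trace (H x))"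
  proof (cases "m < 2")
    case True
    then show ?thesis using gH(6) by (auto intro: homogeneous.intros)
  next
    case False
    then have "Suc (m - 2) = m - 1" by simp
    then show ?thesis using homogeneous.coordinate[OF gH(5), of i] by simp
  qed
  then have 2: "homogeneous (m - 1) (\<lambda>x. trace (?H x))"
    unfolding tr by (intro homogeneous.add homogeneous_cmult gH)
  have 3: "?g x \<bullet> x = Suc m * (x $ i * p x)" for x
    by (simp add: inner_add_left gH(2) inner_axis' algebra_simps)
  show ?case
    using C2_mult[OF C2_coordinate[of i] gH(1)] 1 2 3 gH(4,6) tr
    by (intro exI[of _ ?g] exI[of _ ?H]) (auto simp: numeral_2_eq_2)
next
  case (add m p q)
  from add.IH(1) obtain g H where gH: "C2 p g H" "\<And>x. g x \<bullet> x = m * p x"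
    "\<And>i. homogeneous (m - 1) (\<lambda>x. g x $ i)" "m = 0 \<Longrightarrow> \<forall>x. g x = 0"
    "homogeneous (m - 2) (\<lambda>x. trace (H x))" "m < 2 \<Longrightarrow> \<forall>x. trace (H x) = 0"
    by blast
  from add.IH(2) obtain g' H' where gH': "C2 q g' H'" "\<And>x. g' x \<bullet> x = m * q x"
    "\<And>i. homogeneous (m - 1) (\<lambda>x. g' x $ i)" "m = 0 \<Longrightarrow> \<forall>x. g' x = 0"
    "homogeneous (m - 2) (\<lambda>x. trace (H' x))" "m < 2 \<Longrightarrow> \<forall>x. trace (H' x) = 0"
    by blast
  show ?case
    using C2_add[OF gH(1) gH'(1)] homogeneous.add[OF gH(3) gH'(3)] homogeneous.add[OF gH(5) gH'(5)]
      gH(2,4,6) gH'(2,4,6)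
    by (intro exI[of _ "\<lambda>x. g x + g' x"] exI[of _ "\<lambda>x. H x + H' x"])
      (simp add: inner_add_left trace_add distrib_left)
qed

text \<open>The argument rests on Euler's identity: for f of degree k, \<Delta>(|x|^2 f) = |x|^2
  \<Delta>f + (4 k + 2 n) f. Summation over the degrees m, m + 2, ..., m + 2 j gives the coefficient
  2 (j + 1) (2 m + 2 j + n).\<close>

lemma normsq_power_mult_C2:
  fixes p :: "real ^ 'n \<Rightarrow> real"
  assumes "C2 p g H" "\<And>x. g x \<bullet> x = m * p x"
  shows "\<exists>g' H'. C2 (\<lambda>x. (x \<bullet> x) ^ Suc j * p x) g' H' \<and> (\<forall>x. g' x \<bullet> x = (m + 2 * real (Suc j)) * ((x \<bullet> x) ^ Suc j * p x)) \<and>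
     (\<forall>x. trace (H' x) = (x \<bullet> x) ^ Suc j * trace (H x)
        + 2 * real (Suc j) * (2 * m + 2 * real j + real CARD('n)) * ((x \<bullet> x) ^ j * p x))"
proof (induction j)
  have tr: "trace (mat 2 :: real ^ 'n ^ 'n) = 2 * real CARD('n)"
    by (simp add: trace_def mat_def)
  have step: "\<exists>g' H'. C2 (\<lambda>x. (x \<bullet> x) * f x) g' H' \<and> (\<forall>x. g' x \<bullet> x = (k + 2) * ((x \<bullet> x) * f x)) \<and>
     (\<forall>x. trace (H' x) = (x \<bullet> x) * trace (H1 x) + (4 * k + 2 * real CARD('n)) * f x)"
    if C: "C2 f g1 H1" and E: "\<And>x :: real ^ 'n. g1 x \<bullet> x = k * f x" for f g1 H1 k
    by (rule exI, rule exI, rule conjI, rule C2_mult[OF C2_normsq C])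
      (use E in \<open>auto simp: trace_add trace_scaleR trace_outer tr inner_add_left inner_commute algebra_simps\<close>)
  {
    case 0
    show ?case
      using step[OF assms] by (auto simp: algebra_simps)
  next
    case (Suc j)
    then obtain g' H' where gH': "C2 (\<lambda>x. (x \<bullet> x) ^ Suc j * p x) g' H'"
      "\<And>x. g' x \<bullet> x = (m + 2 * real (Suc j)) * ((x \<bullet> x) ^ Suc j * p x)"
      "\<And>x. trace (H' x) = (x \<bullet> x) ^ Suc j * trace (H x)
        + 2 * real (Suc j) * (2 * m + 2 * real j + real CARD('n)) * ((x \<bullet> x) ^ j * p x)"
      by blast
    obtain g'' H'' where gH'': "C2 (\<lambda>x. (x \<bullet> x) * ((x \<bullet> x) ^ Suc j * p x)) g'' H''"
      "\<And>x. g'' x \<bullet> x = (m + 2 * real (Suc j) + 2) * ((x \<bullet> x) * ((x \<bullet> x) ^ Suc j * p x))"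
      "\<And>x. trace (H'' x) = (x \<bullet> x) * trace (H' x) +
         (4 * (m + 2 * real (Suc j)) + 2 * real CARD('n)) * ((x \<bullet> x) ^ Suc j * p x)"
      using step[OF gH'(1,2)] by blast
    have "(\<lambda>x. (x \<bullet> x) ^ Suc (Suc j) * p x) = (\<lambda>x. (x \<bullet> x) * ((x \<bullet> x) ^ Suc j * p x))"
      by (simp add: mult_ac)
    then show ?case
      using gH'' gH'(3) by (intro exI[of _ g''] exI[of _ H'']) (auto simp: algebra_simps)
  }
qed

text \<open>Surjectivity in Fischer's decomposition; the induction on the degree needs all powers \<open>j\<close>.\<close>

lemma fischer_surjective:
  fixes p :: "real ^ 'n \<Rightarrow> real"
  assumes "homogeneous m p"
  shows "\<exists>q g H. homogeneous m q \<and> C2 (\<lambda>x. (x \<bullet> x) ^ Suc j * q x) g H \<and>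
    (\<forall>x. trace (H x) = (x \<bullet> x) ^ j * p x)"
  using assms
proof (induction m arbitrary: p j rule: less_induct)
  case (less m)
  obtain g H where gH: "C2 p g H" "\<And>x. g x \<bullet> x = m * p x"
    "homogeneous (m - 2) (\<lambda>x. trace (H x))" "m < 2 \<Longrightarrow> \<forall>x. trace (H x) = 0"
    using homogeneous_C2[OF less.prems] by metis
  \<comment> \<open>The coefficient of |x|^(2j) p in \<Delta>(|x|^(2j+2) p). As it is positive, the
    equation can be solved for p up to a term with \<Delta>p, which has lower degree.\<close>
  define \<beta> where "\<beta> = 2 * real (Suc j) * (2 * real m + 2 * real j + real CARD('n))"
  have "\<beta> > 0"
    unfolding \<beta>_def by (intro mult_pos_pos) (auto intro!: add_nonneg_pos)
  obtain g1 H1 where gH1: "C2 (\<lambda>x. (x \<bullet> x) ^ Suc j * p x) g1 H1"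
    "\<And>x. trace (H1 x) = (x \<bullet> x) ^ Suc j * trace (H x) + \<beta> * ((x \<bullet> x) ^ j * p x)"
    using normsq_power_mult_C2[OF gH(1,2), of j] unfolding \<beta>_def by blast
  show ?case
  proof (cases "m < 2")
    case True
    have eq: "(\<lambda>x. (x \<bullet> x) ^ Suc j * (1 / \<beta> * p x)) = (\<lambda>x. 1 / \<beta> * ((x \<bullet> x) ^ Suc j * p x))"
      by (simp add: mult_ac)
    show ?thesis
      by (rule exI[of _ "\<lambda>x. 1 / \<beta> * p x"], rule exI[of _ "\<lambda>x. (1 / \<beta>) *\<^sub>R g1 x"],
          rule exI[of _ "\<lambda>x. (1 / \<beta>) *\<^sub>R H1 x"], unfold eq)
        (use gH(4)[OF True] \<open>\<beta> > 0\<close> homogeneous_cmult[OF less.prems, of "1 / \<beta>"]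
          C2_cmult[OF gH1(1), of "1 / \<beta>"] in \<open>auto simp: trace_scaleR gH1(2)\<close>)
  next
    case False
    \<comment> \<open>The error |x|^(2j+2) \<Delta>p is itself the Laplacian of |x|^(2j+4) s, by the
      induction hypothesis for degree m - 2 and exponent j + 1. Subtracting it leads to the witness
      (p - |x|^2 s) / \<beta>.\<close>
    then obtain s g2 H2 where s: "homogeneous (m - 2) s" "C2 (\<lambda>x. (x \<bullet> x) ^ Suc (Suc j) * s x) g2 H2"
      "\<And>x. trace (H2 x) = (x \<bullet> x) ^ Suc j * trace (H x)"
      using less.IH[OF _ gH(3), of "Suc j"] by auto
    have eq: "(\<lambda>x. (x \<bullet> x) ^ Suc j * (1 / \<beta> * (p x - (x \<bullet> x) * s x))) =
       (\<lambda>x. 1 / \<beta> * ((x \<bullet> x) ^ Suc j * p x - (x \<bullet> x) ^ Suc (Suc j) * s x))"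
      by (simp add: algebra_simps)
    have "homogeneous (2 + (m - 2)) (\<lambda>x. (x \<bullet> x) * s x)"
      by (rule homogeneous_mult[OF homogeneous_normsq s(1)])
    moreover have "2 + (m - 2) = m"
      using False by simp
    ultimately have hs: "homogeneous m (\<lambda>x. (x \<bullet> x) * s x)"
      by (simp only:)
    show ?thesis
      by (rule exI[of _ "\<lambda>x. 1 / \<beta> * (p x - (x \<bullet> x) * s x)"], rule exI[of _ "\<lambda>x. (1 / \<beta>) *\<^sub>R (g1 x - g2 x)"],
          rule exI[of _ "\<lambda>x. (1 / \<beta>) *\<^sub>R (H1 x - H2 x)"], unfold eq)
        (use \<open>\<beta> > 0\<close> homogeneous_cmult[OF homogeneous_diff[OF less.prems hs], of "1 / \<beta>"]
          C2_cmult[OF C2_diff[OF gH1(1) s(2)], of "1 / \<beta>"] in \<open>auto simp: trace_scaleR trace_sub gH1(2) s(3)\<close>)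
  qed
qed

text \<open>With \<Delta>(|x|^2 s) = \<Delta>p, the polynomial p - |x|^2 s is harmonic and equals p
  - s on the sphere. The defect s has degree m - 2 and is treated by induction.\<close>

lemma homogeneous_dirichlet:
  fixes p :: "real ^ 'n \<Rightarrow> real"
  assumes "homogeneous m p"
  shows "\<exists>k g H. C2 k g H \<and> (\<forall>x. trace (H x) = 0) \<and> (\<forall>x\<in>sphere 0 1. k x = p x)"
  using assms
proof (induction m arbitrary: p rule: less_induct)
  case (less m)
  obtain g H where gH: "C2 p g H"
    "homogeneous (m - 2) (\<lambda>x. trace (H x))" "m < 2 \<Longrightarrow> \<forall>x. trace (H x) = 0"
    using homogeneous_C2[OF less.prems] by metis
  show ?case
  proof (cases "m < 2")
    case True
    then show ?thesis using gH by blast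
  next
    case False
    obtain s g1 H1 where s: "homogeneous (m - 2) s" "C2 (\<lambda>x. (x \<bullet> x) * s x) g1 H1"
      "\<And>x. trace (H1 x) = trace (H x)"
      using fischer_surjective[OF gH(2), of 0] by auto
    obtain k g2 H2 where k: "C2 k g2 H2" "\<forall>x. trace (H2 x) = 0" "\<forall>x\<in>sphere 0 1. k x = s x"
      using less.IH[OF _ s(1)] False by auto
    have "C2 (\<lambda>x. p x - (x \<bullet> x) * s x + k x) (\<lambda>x. g x - g1 x + g2 x) (\<lambda>x. H x - H1 x + H2 x)"
      by (intro C2_add C2_diff gH s k)
    moreover have "\<forall>x\<in>sphere 0 1. p x - (x \<bullet> x) * s x + k x = p x"
      using k(3) by (simp add: norm_eq_1)
    ultimately show ?thesis
      using s(3) k(2)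
      by (intro exI[of _ "\<lambda>x. p x - (x \<bullet> x) * s x + k x"] exI[of _ "\<lambda>x. g x - g1 x + g2 x"]
          exI[of _ "\<lambda>x. H x - H1 x + H2 x"]) (auto simp: trace_add trace_sub)
  qed
qed

section \<open>Harmonic approximation of continuous functions on the sphere\<close>

inductive homogeneous_sums :: "(real ^ 'n \<Rightarrow> real) \<Rightarrow> bool" where
  hom: "homogeneous m p \<Longrightarrow> homogeneous_sums p"
| sum: "homogeneous_sums p \<Longrightarrow> homogeneous_sums q \<Longrightarrow> homogeneous_sums (\<lambda>x. p x + q x)"

lemma homogeneous_sums_mult:
  assumes "homogeneous_sums p" "homogeneous_sums q"
  shows "homogeneous_sums (\<lambda>x. p x * q x)"
  using assms(1)
proof induction
  case (hom m p)
  show ?case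
    using assms(2)
  proof induction
    case (hom l q)
    show ?case
      by (rule homogeneous_sums.hom[OF homogeneous_mult[OF \<open>homogeneous m p\<close> \<open>homogeneous l q\<close>]])
  next
    case (sum q q')
    then show ?case by (simp add: homogeneous_sums.sum distrib_left)
  qed
next
  case (sum p p')
  then show ?case by (simp add: homogeneous_sums.sum distrib_right)
qed

lemma real_polynomial_homogeneous_sums:
  fixes p :: "real ^ 'n \<Rightarrow> real"
  assumes "real_polynomial_function p"
  shows "homogeneous_sums p"
  using assms
proof induction
  case (linear f)
  interpret bounded_linear f by fact
  have eq: "f = (\<lambda>x. \<Sum>i\<in>UNIV. x $ i * f (axis i 1))"
  proof
    fix x
    have "f x = f (\<Sum>i\<in>UNIV. x $ i *\<^sub>R axis i 1)"
      using basis_expansion[of x] by (simp add: scalar_mult_eq_scaleR)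
    then show "f x = (\<Sum>i\<in>UNIV. x $ i * f (axis i 1))" by (simp add: sum scaleR)
  qed
  have "homogeneous 1 f"
    unfolding One_nat_def
    by (subst eq, rule homogeneous_sum, simp, rule homogeneous.coordinate, rule homogeneous.const)
  then show ?case by (rule homogeneous_sums.hom)
next
  case (const c)
  show ?case by (rule homogeneous_sums.hom, rule homogeneous.const)
next
  case (add f g)
  show ?case by (rule homogeneous_sums.sum) fact+
next
  case (mult f g)
  show ?case by (rule homogeneous_sums_mult) fact+
qed

text \<open>Uniform approximation on the sphere takes the place of a solution of the Dirichlet
  problem with data U. The approximants are twice differentiable on the whole space, hence usable as
  test functions up to the boundary of the ball.\<close>

lemma harmonic_approximation:
  fixes U :: "real ^ 'n \<Rightarrow> real"
  assumes "continuous_on (sphere 0 1) U" "\<eta> > 0"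
  shows "\<exists>k g H. C2 k g H \<and> (\<forall>x. trace (H x) = 0) \<and> (\<forall>x\<in>sphere 0 1. \<bar>U x - k x\<bar> < \<eta>)"
proof -
  obtain p where p: "real_polynomial_function p" "\<And>x. x \<in> sphere 0 1 \<Longrightarrow> \<bar>U x - p x\<bar> < \<eta>"
    using Stone_Weierstrass_real_polynomial_function[OF compact_sphere assms] by metis
  have "\<exists>k g H. C2 k g H \<and> (\<forall>x. trace (H x) = 0) \<and> (\<forall>x\<in>sphere 0 1. k x = p x)"
    using real_polynomial_homogeneous_sums[OF p(1)]
  proof induction
    case (sum p q)
    then obtain k g H k' g' H' where
      "C2 k g H" "\<forall>x. trace (H x) = 0" "\<forall>x\<in>sphere 0 1. k x = p x"
      "C2 k' g' H'" "\<forall>x. trace (H' x) = 0" "\<forall>x\<in>sphere 0 1. k' x = q x"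
      by blast
    then show ?case
      by (intro exI[of _ "\<lambda>x. k x + k' x"] exI[of _ "\<lambda>x. g x + g' x"] exI[of _ "\<lambda>x. H x + H' x"])
        (auto simp: trace_add intro: C2_add)
  qed (rule homogeneous_dirichlet)
  then obtain k g H where "C2 k g H" "\<forall>x. trace (H x) = 0" "\<forall>x\<in>sphere 0 1. k x = p x"
    by blast
  then show ?thesis using p(2) by (intro exI[of _ k] exI[of _ g] exI[of _ H]) auto
qed

section \<open>Asymptotically subharmonic sequences\<close>

text \<open>The second-derivative test along each axis. If a diagonal entry were positive, the
  corresponding partial derivative would vanish at z and be positive just beyond it, so by the mean
  value theorem f would exceed f(z) there.\<close>

lemma C2_interior_max_trace:
  fixes f :: "real ^ 'n \<Rightarrow> real"
  assumes C2: "C2 f g H" and z: "z \<in> ball 0 1" and max: "\<And>y. y \<in> cball 0 1 \<Longrightarrow> f y \<le> f z"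
  shows "trace (H z) \<le> 0"
proof -
  have "H z $ i $ i \<le> 0" for i
  proof (rule ccontr)
    assume "\<not> H z $ i $ i \<le> 0"
    then have pos: "H z $ i $ i > 0" by simp
    define e :: "real ^ 'n" where "e = axis i 1"
    have Df: "((\<lambda>t. f (z + t *\<^sub>R e)) has_real_derivative g (z + t *\<^sub>R e) $ i) (at t)" for t
    proof -
      have "(f has_derivative (\<lambda>v. v \<bullet> g (z + t *\<^sub>R e))) (at (z + t *\<^sub>R e))"
        using C2 by (simp add: C2_def gderiv_def)
      then have "((\<lambda>t. f (z + t *\<^sub>R e)) has_derivative (\<lambda>s. (s *\<^sub>R e) \<bullet> g (z + t *\<^sub>R e))) (at t)"
        by (rule has_derivative_compose[rotated]) (auto intro!: derivative_eq_intros)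
      then show ?thesis
        by (simp add: has_field_derivative_def e_def inner_axis' mult_commute_abs)
    qed
    have Dg: "((\<lambda>t. g (z + t *\<^sub>R e) $ i) has_real_derivative H z $ i $ i) (at 0)"
    proof -
      have "(g has_derivative (\<lambda>v. H z *v v)) (at (z + 0 *\<^sub>R e))"
        using C2 by (simp add: C2_def)
      then have "((\<lambda>t. g (z + t *\<^sub>R e)) has_derivative (\<lambda>s. H z *v (s *\<^sub>R e))) (at 0)"
        by (rule has_derivative_compose[rotated]) (auto intro!: derivative_eq_intros)
      then have "((\<lambda>t. g (z + t *\<^sub>R e) $ i) has_derivative (\<lambda>s. (H z *v (s *\<^sub>R e)) $ i)) (at 0)"
        by (rule bounded_linear.has_derivative[OF bounded_linear_vec_nth])
      moreover have "(H z *v (s *\<^sub>R e)) $ i = H z $ i $ i * s" for s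
        by (simp add: e_def matrix_vector_mult_def axis_def if_distrib cong: if_cong)
      ultimately show ?thesis
        by (simp add: has_field_derivative_def)
    qed
    obtain d1 where d1: "d1 > 0" "\<And>h. 0 < h \<Longrightarrow> h < d1 \<Longrightarrow> g (z + 0 *\<^sub>R e) $ i < g (z + h *\<^sub>R e) $ i"
      using DERIV_pos_inc_right[OF Dg pos] by auto
    have nz: "norm z < 1" using z by simp
    have in_ball: "z + t *\<^sub>R e \<in> cball 0 1" if "\<bar>t\<bar> < 1 - norm z" for t
      using that norm_triangle_ineq[of z "t *\<^sub>R e"] by (simp add: e_def)
    have "g (z + 0 *\<^sub>R e) $ i = 0"
      by (rule DERIV_local_max[OF Df, of "1 - norm z"]) (use nz in_ball max in auto)
    then have gpos: "g (z + h *\<^sub>R e) $ i > 0" if "0 < h" "h < d1" for h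
      using d1(2)[OF that] by simp
    define h where "h = min d1 (1 - norm z) / 2"
    have h: "0 < h" "h < d1" "\<bar>h\<bar> < 1 - norm z"
      using nz d1(1) by (auto simp: h_def min_def)
    obtain s where s: "0 < s" "s < h"
      "f (z + h *\<^sub>R e) - f (z + 0 *\<^sub>R e) = (h - 0) * g (z + s *\<^sub>R e) $ i"
      using MVT2[OF h(1), of "\<lambda>t. f (z + t *\<^sub>R e)" "\<lambda>t. g (z + t *\<^sub>R e) $ i"] Df by auto
    have "h * g (z + s *\<^sub>R e) $ i > 0"
      using gpos[of s] s h by (intro mult_pos_pos) auto
    then show False
      using s(3) max[OF in_ball[OF h(3)]] by simp
  qed
  then show ?thesis by (auto simp: trace_def intro: sum_nonpos)
qed

text \<open>
  The functions \<open>U k\<close> are asymptotically viscosity subsolutions of \<open>1/2 \<Delta>U \<ge> c\<^sub>1\<close> in the unit ball.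
  Test functions with constant Laplacian are enough.
\<close>

definition asymp_subharmonic :: "(nat \<Rightarrow> real ^ 'n \<Rightarrow> real) \<Rightarrow> real \<Rightarrow> bool"
  where "asymp_subharmonic U c\<^sub>1 \<longleftrightarrow>
    (\<forall>\<psi> g H c \<kappa> \<zeta>. C2 \<psi> g H \<longrightarrow> (\<forall>x. trace (H x) = 2 * c) \<longrightarrow> strict_mono \<kappa> \<longrightarrow>
       (\<forall>j :: nat. \<zeta> j \<in> ball 0 1 \<and>
         (\<forall>y\<in>cball 0 1. U (\<kappa> j) y - \<psi> y \<le> U (\<kappa> j) (\<zeta> j) - \<psi> (\<zeta> j))) \<longrightarrow> c\<^sub>1 \<le> c)"

lemma trace_mat2: "trace (mat 2 :: real ^ 'n ^ 'n) = 2 * real CARD('n)"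
  by (simp add: trace_def mat_def)

text \<open>A function of Laplacian 2 c with c < \<open>c\<^sub>1\<close> cannot touch U from above
  in the open ball along a subsequence. So a barrier that dominates on the sphere dominates inside,
  up to finitely many indices.\<close>

lemma harmonic_majorant:
  fixes U :: "nat \<Rightarrow> real ^ 'n \<Rightarrow> real"
  assumes sub: "asymp_subharmonic U c\<^sub>1" and cont: "\<And>k. continuous_on (cball 0 1) (U k)"
    and \<kappa>: "strict_mono \<kappa>" and V: "continuous_on (cball 0 1) V"
    and lim: "\<And>e. e > 0 \<Longrightarrow> \<forall>\<^sub>F j in sequentially. \<forall>z\<in>cball 0 1. \<bar>U (\<kappa> j) z - V z\<bar> < e"
    and "c < c\<^sub>1" "\<eta> > 0"
  obtains k g H where "C2 k g H" "\<And>x. trace (H x) = 2 * c" "\<And>z. z \<in> sphere 0 1 \<Longrightarrow> k z \<le> V z + 3 * \<eta>"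
    "\<forall>\<^sub>F j in sequentially. \<forall>z\<in>cball 0 1. U (\<kappa> j) z \<le> k z"
proof -
  have "continuous_on (sphere 0 1) V"
    using V by (rule continuous_on_subset) auto
  then obtain P gP HP where P: "C2 P gP HP" "\<And>x. trace (HP x) = 0" "\<And>x. x \<in> sphere 0 1 \<Longrightarrow> \<bar>V x - P x\<bar> < \<eta>"
    using harmonic_approximation \<open>\<eta> > 0\<close> by metis
  \<comment> \<open>This is P + c/n (|x|^2 - 1) + 2 \<eta>: the quadratic supplies the Laplacian 2 c
    and vanishes on the sphere. Of the margin 2 \<eta>, one \<eta> covers V - P and the other U -
    V.\<close>
  define k where "k = (\<lambda>x. P x + (c / CARD('n) * (x \<bullet> x) + (2 * \<eta> - c / CARD('n))))"
  define g where "g = (\<lambda>x. gP x + ((c / CARD('n)) *\<^sub>R 2 *\<^sub>R x + 0))"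
  define H where "H = (\<lambda>x. HP x + ((c / CARD('n)) *\<^sub>R (mat 2 :: real ^ 'n ^ 'n) + 0))"
  have k: "C2 k g H"
    unfolding k_def g_def H_def by (intro C2_add P C2_cmult C2_normsq C2_const)
  have tr: "trace (H x) = 2 * c" for x
    by (simp add: H_def trace_add trace_scaleR trace_mat2 P(2))
  have ksph: "k z = P z + 2 * \<eta>" if "z \<in> sphere 0 1" for z
    using that by (simp add: k_def norm_eq_1)
  have sphere: "\<forall>\<^sub>F j in sequentially. \<forall>z\<in>sphere 0 1. U (\<kappa> j) z < k z"
    using lim[OF \<open>\<eta> > 0\<close>]
  proof eventually_elim
    case (elim j)
    show ?case
    proof
      fix z :: "real ^ 'n" assume z: "z \<in> sphere 0 1"
      then have "z \<in> cball 0 1" by simp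
      with elim have "\<bar>U (\<kappa> j) z - V z\<bar> < \<eta>" by blast
      then show "U (\<kappa> j) z < k z" using P(3)[OF z] ksph[OF z] by linarith
    qed
  qed
  have "\<forall>\<^sub>F j in sequentially. \<forall>z\<in>cball 0 1. U (\<kappa> j) z \<le> k z"
  proof (rule ccontr)
    assume "\<not> ?thesis"
    then have "\<exists>\<^sub>F j in sequentially. \<not> (\<forall>z\<in>cball 0 1. U (\<kappa> j) z \<le> k z)"
      by (simp add: frequently_def)
    then have "\<exists>\<^sub>F j in sequentially. (\<exists>z\<in>cball 0 1. U (\<kappa> j) z > k z) \<and> (\<forall>z\<in>sphere 0 1. U (\<kappa> j) z < k z)"
      by (rule frequently_rev_mp) (use sphere in eventually_elim, force simp: not_le)
    then have "\<not> (\<forall>\<^sub>F j in sequentially. \<not> ((\<exists>z\<in>cball 0 1. U (\<kappa> j) z > k z) \<and> (\<forall>z\<in>sphere 0 1. U (\<kappa> j) z < k z)))"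
      by (simp add: frequently_def)
    \<comment> \<open>The violations may occur only along a subsequence, which is why
      \<open>asymp_subharmonic\<close> quantifies over \<kappa>.\<close>
    from not_eventually_sequentiallyD[OF this] obtain r :: "nat \<Rightarrow> nat" where r: "strict_mono r"
      "\<And>j. (\<exists>z\<in>cball 0 1. U (\<kappa> (r j)) z > k z) \<and> (\<forall>z\<in>sphere 0 1. U (\<kappa> (r j)) z < k z)"
      unfolding not_not by blast
    have "\<exists>\<zeta>\<in>ball 0 1. \<forall>y\<in>cball 0 1. U (\<kappa> (r j)) y - k y \<le> U (\<kappa> (r j)) \<zeta> - k \<zeta>" for j
    proof -
      have "continuous_on (cball 0 1) (\<lambda>y. U (\<kappa> (r j)) y - k y)"
        by (intro continuous_intros cont C2_continuous[OF k])
      then obtain \<zeta> where \<zeta>: "\<zeta> \<in> cball 0 1"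
        "\<forall>y\<in>cball 0 1. U (\<kappa> (r j)) y - k y \<le> U (\<kappa> (r j)) \<zeta> - k \<zeta>"
        using continuous_attains_sup[of "cball 0 1" "\<lambda>y. U (\<kappa> (r j)) y - k y"] by auto
      obtain z where "z \<in> cball 0 1" "U (\<kappa> (r j)) z > k z"
        using r(2) by blast
      then have "U (\<kappa> (r j)) \<zeta> > k \<zeta>"
        using \<zeta>(2) by force
      then have "\<zeta> \<notin> sphere 0 1"
        using r(2)[of j] by force
      then have "\<zeta> \<in> ball 0 1" using \<zeta>(1) by auto
      then show ?thesis using \<zeta>(2) by blast
    qed
    then obtain \<zeta> where \<zeta>: "\<And>j. \<zeta> j \<in> ball 0 1"
      "\<And>j. \<forall>y\<in>cball 0 1. U (\<kappa> (r j)) y - k y \<le> U (\<kappa> (r j)) (\<zeta> j) - k (\<zeta> j)"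
      by metis
    have "strict_mono (\<lambda>j. \<kappa> (r j))"
      using strict_mono_o[OF \<kappa> r(1)] by (simp add: o_def)
    then have "c\<^sub>1 \<le> c"
      using sub[unfolded asymp_subharmonic_def, rule_format, OF k tr, of "\<lambda>j. \<kappa> (r j)" \<zeta>] \<zeta> by blast
    with \<open>c < c\<^sub>1\<close> show False by simp
  qed
  moreover have "k z \<le> V z + 3 * \<eta>" if "z \<in> sphere 0 1" for z
    using ksph[OF that] P(3)[OF that] by linarith
  ultimately show ?thesis using that k tr by blast
qed

text \<open>If the claim failed, barriers for the two limits could be chosen whose Laplacians add up
  to more than that of Q. Their excess over Q is then strictly subharmonic and peaks on the sphere,
  where the limits obey the bound by Q. At 0 the excess is nonnegative, and subtracting a small
  multiple of |x|^2 makes the two facts incompatible.\<close>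

lemma asymp_subharmonic_pair:
  fixes U\<^sub>1 U\<^sub>2 :: "nat \<Rightarrow> real ^ 'n \<Rightarrow> real"
  assumes sub: "asymp_subharmonic U\<^sub>1 c\<^sub>1" "asymp_subharmonic U\<^sub>2 c\<^sub>2"
    and lip: "\<And>k. L-lipschitz_on (cball 0 1) (U\<^sub>1 k)" "\<And>k. L-lipschitz_on (cball 0 1) (U\<^sub>2 k)"
    and bound: "\<And>k z. z \<in> cball 0 1 \<Longrightarrow> \<bar>U\<^sub>1 k z\<bar> \<le> M" "\<And>k z. z \<in> cball 0 1 \<Longrightarrow> \<bar>U\<^sub>2 k z\<bar> \<le> M"
    and zero: "\<And>k. 0 \<le> U\<^sub>1 k 0" "\<And>k. 0 \<le> U\<^sub>2 k 0"
    and Q: "C2 Q gQ HQ" "\<And>x. trace (HQ x) = 2 * e" "Q 0 = 0"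
    and le_Q: "\<And>k z. z \<in> cball 0 1 \<Longrightarrow> U\<^sub>1 k z + U\<^sub>2 k z \<le> Q z"
  shows "c\<^sub>1 + c\<^sub>2 \<le> e"
proof (rule ccontr)
  assume "\<not> c\<^sub>1 + c\<^sub>2 \<le> e"
  \<comment> \<open>One third of the excess: after lowering both \<open>c\<^sub>1\<close> and
    \<open>c\<^sub>2\<close> by \<delta>, their sum still exceeds e by \<delta>.\<close>
  define \<delta> where "\<delta> = (c\<^sub>1 + c\<^sub>2 - e) / 3"
  have "\<delta> > 0" using \<open>\<not> c\<^sub>1 + c\<^sub>2 \<le> e\<close> by (simp add: \<delta>_def)
  \<comment> \<open>Matched with \<open>b\<close> below: the total error 6 \<eta> = \<delta> / (4 n)
    on the sphere is half of b = \<delta> / (2 n).\<close>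
  define \<eta> where "\<eta> = \<delta> / (24 * CARD('n))"
  have "\<eta> > 0" using \<open>\<delta> > 0\<close> by (simp add: \<eta>_def)
  have "L \<ge> 0" using lip(1) lipschitz_on_nonneg by blast
  have d1: "\<bar>U\<^sub>1 k x - U\<^sub>1 k y\<bar> \<le> L * norm (x - y)" if "x \<in> cball 0 1" "y \<in> cball 0 1" for k x y
    using lipschitz_onD[OF lip(1) that] by (simp add: dist_norm)
  have d2: "\<bar>U\<^sub>2 k x - U\<^sub>2 k y\<bar> \<le> L * norm (x - y)" if "x \<in> cball 0 1" "y \<in> cball 0 1" for k x y
    using lipschitz_onD[OF lip(2) that] by (simp add: dist_norm)
  \<comment> \<open>The pair is treated as one map into the plane, so that a single subsequence
    serves both sequences.\<close>
  obtain W :: "real ^ 'n \<Rightarrow> real \<times> real" and \<kappa> :: "nat \<Rightarrow> nat"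
    where W: "continuous_on (cball 0 1) W" and \<kappa>: "strict_mono \<kappa>"
      and lim: "\<And>e. 0 < e \<Longrightarrow> \<exists>N. \<forall>n x. n \<ge> N \<and> x \<in> cball 0 1 \<longrightarrow> norm ((U\<^sub>1 (\<kappa> n) x, U\<^sub>2 (\<kappa> n) x) - W x) < e"
  proof (rule Arzela_Ascoli[of "cball 0 1" "\<lambda>k x. (U\<^sub>1 k x, U\<^sub>2 k x)" "2 * M"])
    show "norm (U\<^sub>1 n x, U\<^sub>2 n x) \<le> 2 * M" if "x \<in> cball 0 1" for n x
      using norm_Pair_le[of "U\<^sub>1 n x" "U\<^sub>2 n x"] bound(1)[OF that, of n] bound(2)[OF that, of n] by simp
    show "\<exists>d>0. \<forall>n y. y \<in> cball 0 1 \<and> norm (x - y) < d \<longrightarrow> norm ((U\<^sub>1 n x, U\<^sub>2 n x) - (U\<^sub>1 n y, U\<^sub>2 n y)) < e"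
      if x: "x \<in> cball 0 1" and "0 < e" for x e
    proof (intro exI[of _ "e / (2 * L + 1)"] conjI allI impI)
      show "0 < e / (2 * L + 1)" using \<open>0 < e\<close> \<open>L \<ge> 0\<close> by simp
      fix n y assume y: "y \<in> cball 0 1 \<and> norm (x - y) < e / (2 * L + 1)"
      have "norm ((U\<^sub>1 n x, U\<^sub>2 n x) - (U\<^sub>1 n y, U\<^sub>2 n y)) \<le> 2 * L * norm (x - y)"
        using norm_Pair_le[of "U\<^sub>1 n x - U\<^sub>1 n y" "U\<^sub>2 n x - U\<^sub>2 n y"] d1[OF x, of y n] d2[OF x, of y n] y
        by simp
      also have "\<dots> \<le> (2 * L + 1) * norm (x - y)"
        by (simp add: algebra_simps)
      also have "\<dots> < e"
        using y \<open>L \<ge> 0\<close> by (simp add: pos_less_divide_eq mult.commute)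
      finally show "norm ((U\<^sub>1 n x, U\<^sub>2 n x) - (U\<^sub>1 n y, U\<^sub>2 n y)) < e" .
    qed
  qed auto
  have ev: "\<forall>\<^sub>F j in sequentially. \<forall>z\<in>cball 0 1. norm ((U\<^sub>1 (\<kappa> j) z, U\<^sub>2 (\<kappa> j) z) - W z) < e" if "e > 0" for e
    using lim[OF that] unfolding eventually_sequentially by blast
  have ev1: "\<forall>\<^sub>F j in sequentially. \<forall>z\<in>cball 0 1. \<bar>U\<^sub>1 (\<kappa> j) z - fst (W z)\<bar> < e" if "e > 0" for e
    using ev[OF that]
  proof eventually_elim
    case (elim j)
    have "\<bar>U\<^sub>1 (\<kappa> j) z - fst (W z)\<bar> \<le> norm ((U\<^sub>1 (\<kappa> j) z, U\<^sub>2 (\<kappa> j) z) - W z)" for z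
      using norm_fst_le[of "U\<^sub>1 (\<kappa> j) z - fst (W z)" "U\<^sub>2 (\<kappa> j) z - snd (W z)"] by (cases "W z") simp
    then show ?case using elim by (meson le_less_trans)
  qed
  have ev2: "\<forall>\<^sub>F j in sequentially. \<forall>z\<in>cball 0 1. \<bar>U\<^sub>2 (\<kappa> j) z - snd (W z)\<bar> < e" if "e > 0" for e
    using ev[OF that]
  proof eventually_elim
    case (elim j)
    have "\<bar>U\<^sub>2 (\<kappa> j) z - snd (W z)\<bar> \<le> norm ((U\<^sub>1 (\<kappa> j) z, U\<^sub>2 (\<kappa> j) z) - W z)" for z
      using norm_snd_le[of "U\<^sub>2 (\<kappa> j) z - snd (W z)" "U\<^sub>1 (\<kappa> j) z - fst (W z)"] by (cases "W z") simp
    then show ?case using elim by (meson le_less_trans)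
  qed
  obtain k1 g1 H1 where k1: "C2 k1 g1 H1" "\<And>x. trace (H1 x) = 2 * (c\<^sub>1 - \<delta>)"
    "\<And>z. z \<in> sphere 0 1 \<Longrightarrow> k1 z \<le> fst (W z) + 3 * \<eta>"
    "\<forall>\<^sub>F j in sequentially. \<forall>z\<in>cball 0 1. U\<^sub>1 (\<kappa> j) z \<le> k1 z"
    using harmonic_majorant[OF sub(1) lipschitz_on_continuous_on[OF lip(1)] \<kappa> continuous_on_fst[OF W] ev1 _ \<open>\<eta> > 0\<close>, of "c\<^sub>1 - \<delta>"]
      \<open>\<delta> > 0\<close> by auto
  obtain k2 g2 H2 where k2: "C2 k2 g2 H2" "\<And>x. trace (H2 x) = 2 * (c\<^sub>2 - \<delta>)"
    "\<And>z. z \<in> sphere 0 1 \<Longrightarrow> k2 z \<le> snd (W z) + 3 * \<eta>"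
    "\<forall>\<^sub>F j in sequentially. \<forall>z\<in>cball 0 1. U\<^sub>2 (\<kappa> j) z \<le> k2 z"
    using harmonic_majorant[OF sub(2) lipschitz_on_continuous_on[OF lip(2)] \<kappa> continuous_on_snd[OF W] ev2 _ \<open>\<eta> > 0\<close>, of "c\<^sub>2 - \<delta>"]
      \<open>\<delta> > 0\<close> by auto
  \<comment> \<open>The term b |x|^2 uses 2 n b = \<delta> of the available Laplacian 2 \<delta>; it
    lowers F by b on the sphere and by nothing at 0.\<close>
  define b where "b = \<delta> / (2 * CARD('n))"
  define F where "F = (\<lambda>x. k1 x + k2 x - Q x - b * (x \<bullet> x))"
  have F: "C2 F (\<lambda>x. g1 x + g2 x - gQ x - b *\<^sub>R 2 *\<^sub>R x) (\<lambda>x. H1 x + H2 x - HQ x - b *\<^sub>R mat 2)"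
    unfolding F_def by (intro C2_diff C2_add C2_cmult C2_normsq k1 k2 Q)
  have trF: "trace (H1 x + H2 x - HQ x - b *\<^sub>R mat 2) = \<delta>" for x
    by (simp add: trace_add trace_sub trace_scaleR trace_mat2 k1 k2 Q b_def) (simp add: \<delta>_def field_simps)
  obtain z where z: "z \<in> cball 0 1" "\<forall>y\<in>cball 0 1. F y \<le> F z"
    using continuous_attains_sup[of "cball 0 1" F] C2_continuous[OF F] by auto
  have "z \<in> sphere 0 1"
  proof (rule ccontr)
    assume "z \<notin> sphere 0 1"
    then have "z \<in> ball 0 1" using z(1) by auto
    from C2_interior_max_trace[OF F this] z(2) trF \<open>\<delta> > 0\<close> show False by auto
  qed
  have W_le: "fst (W z) + snd (W z) \<le> Q z"
  proof (rule field_le_epsilon)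
    fix e :: real assume "e > 0"
    then have "e / 2 > 0" by simp
    have "\<forall>\<^sub>F j in sequentially. \<forall>z\<in>cball 0 1. \<bar>U\<^sub>1 (\<kappa> j) z - fst (W z)\<bar> < e / 2"
      "\<forall>\<^sub>F j in sequentially. \<forall>z\<in>cball 0 1. \<bar>U\<^sub>2 (\<kappa> j) z - snd (W z)\<bar> < e / 2"
      by (rule ev1[OF \<open>e / 2 > 0\<close>], rule ev2[OF \<open>e / 2 > 0\<close>])
    then have "\<forall>\<^sub>F j in sequentially. fst (W z) + snd (W z) \<le> Q z + e"
    proof eventually_elim
      case (elim j)
      then have "\<bar>U\<^sub>1 (\<kappa> j) z - fst (W z)\<bar> < e / 2" "\<bar>U\<^sub>2 (\<kappa> j) z - snd (W z)\<bar> < e / 2"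
        using z(1) by blast+
      then show ?case
        using le_Q[OF z(1), of "\<kappa> j"] by linarith
    qed
    then show "fst (W z) + snd (W z) \<le> Q z + e" by simp
  qed
  have "\<forall>\<^sub>F j in sequentially. 0 \<le> k1 0 + k2 0"
    using k1(4) k2(4)
  proof eventually_elim
    case (elim j)
    then have "U\<^sub>1 (\<kappa> j) 0 \<le> k1 0" "U\<^sub>2 (\<kappa> j) 0 \<le> k2 0" by auto
    then show ?case using zero[of "\<kappa> j"] by linarith
  qed
  then have "0 \<le> F 0"
    by (simp add: F_def Q(3))
  also have "\<dots> \<le> F z" using z(2) by simp
  also have "\<dots> = k1 z + k2 z - Q z - b"
    using \<open>z \<in> sphere 0 1\<close> by (simp add: F_def norm_eq_1)
  also have "\<dots> \<le> 6 * \<eta> - b"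
    using k1(3)[OF \<open>z \<in> sphere 0 1\<close>] k2(3)[OF \<open>z \<in> sphere 0 1\<close>] W_le by linarith
  also have "\<dots> < 0"
    using \<open>\<delta> > 0\<close> by (simp add: \<eta>_def b_def field_simps)
  finally show False by simp
qed

section \<open>Blow-up of a sup-convolution\<close>

lemma invertible_matrix_inv:
  fixes M :: "real ^ 'n ^ 'n"
  assumes "invertible M"
  shows "M ** matrix_inv M = mat 1" "matrix_inv M ** M = mat 1"
  using someI_ex[OF assms[unfolded invertible_def]] unfolding matrix_inv_def by auto

text \<open>One half of the doubled maximum, with the other point frozen. Expanding the penalties
  about the touching point yields p and q as first-order coefficients and leaves the quadratics in
  \<open>touch\<close>. The matrix \<open>S\<close> will be \<sigma> at the touching point.\<close>

locale touching =
  fixes T :: real and w :: "real \<Rightarrow> real ^ 'n \<Rightarrow> real" and N K t\<^sub>0 q :: real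
    and x\<^sub>0 p :: "real ^ 'n" and S :: "real ^ 'n ^ 'n"
  assumes w: "continuous_on ({0..T} \<times> UNIV) (\<lambda>(t, x). w t x)"
    and N: "N > 0" and K: "K > 0" and t\<^sub>0: "t\<^sub>0 \<in> {0..T}"
    and touch: "\<And>t a. t \<in> {0..T} \<Longrightarrow>
      w t (x\<^sub>0 + a) - w t\<^sub>0 x\<^sub>0 - p \<bullet> a - q * (t - t\<^sub>0) \<le> N / 2 * (a \<bullet> a) + K / 2 * (t - t\<^sub>0)\<^sup>2"
begin

text \<open>Maximizers in the sup-convolution have norm at most \<open>8/3 |S z|\<close>, hence less than \<open>\<rho>\<close>.\<close>

definition "\<rho> = 3 * onorm ((*v) S) + 1"

text \<open>
  The sup-convolution of \<open>w\<close> around \<open>(t\<^sub>0, x\<^sub>0)\<close>, rescaled by \<open>r\<close> in space after subtraction of the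
  first-order part. The penalty \<open>K\<close> on the time shift eliminates the time variable.
\<close>

definition kernel :: "real \<Rightarrow> real \<Rightarrow> real ^ 'n \<Rightarrow> real ^ 'n \<Rightarrow> real"
  where "kernel r t a z =
    (w t (x\<^sub>0 + r *\<^sub>R a) - w t\<^sub>0 x\<^sub>0 - r * (p \<bullet> a) - q * (t - t\<^sub>0) - K * (t - t\<^sub>0)\<^sup>2) / r\<^sup>2
      - 2 * N * ((S *v z - a) \<bullet> (S *v z - a))"

definition blowup :: "real \<Rightarrow> real ^ 'n \<Rightarrow> real"
  where "blowup r z = (SUP (t, a)\<in>{0..T} \<times> cball 0 \<rho>. kernel r t a z)"

lemma onorm_S: "norm (S *v z) \<le> onorm ((*v) S) * norm z" "0 \<le> onorm ((*v) S)"
  by (auto intro!: onorm onorm_pos_le)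

lemma rho_pos: "0 < \<rho>"
  using onorm_S(2) by (simp add: \<rho>_def)

text \<open>\<open>kernel\<close> subtracts twice the time quadratic that \<open>touch\<close>
  permits, so a negative half remains. In space the weight 2 N outweighs N/2 in the same
  way.\<close>

lemma kernel_le:
  assumes "r > 0" "t \<in> {0..T}"
  shows "kernel r t a z \<le> N / 2 * (a \<bullet> a) - K / 2 * ((t - t\<^sub>0)\<^sup>2 / r\<^sup>2) - 2 * N * ((S *v z - a) \<bullet> (S *v z - a))"
proof -
  have "w t (x\<^sub>0 + r *\<^sub>R a) - w t\<^sub>0 x\<^sub>0 - r * (p \<bullet> a) - q * (t - t\<^sub>0) - K * (t - t\<^sub>0)\<^sup>2
    \<le> N / 2 * (a \<bullet> a) * r\<^sup>2 - K / 2 * (t - t\<^sub>0)\<^sup>2"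
    using touch[OF assms(2), of "r *\<^sub>R a"] by (simp add: power2_eq_square algebra_simps)
  then have "(w t (x\<^sub>0 + r *\<^sub>R a) - w t\<^sub>0 x\<^sub>0 - r * (p \<bullet> a) - q * (t - t\<^sub>0) - K * (t - t\<^sub>0)\<^sup>2) / r\<^sup>2
    \<le> (N / 2 * (a \<bullet> a) * r\<^sup>2 - K / 2 * (t - t\<^sub>0)\<^sup>2) / r\<^sup>2"
    by (rule divide_right_mono) simp
  also have "\<dots> = N / 2 * (a \<bullet> a) - K / 2 * ((t - t\<^sub>0)\<^sup>2 / r\<^sup>2)"
    using \<open>r > 0\<close> by (simp add: diff_divide_distrib)
  finally show ?thesis by (simp add: kernel_def)
qed

lemma kernel_0: "kernel r t\<^sub>0 0 z = - 2 * N * ((S *v z) \<bullet> (S *v z))"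
  by (simp add: kernel_def)

lemma blowup_attained:
  shows "\<exists>t\<in>{0..T}. \<exists>a\<in>cball 0 \<rho>. blowup r z = kernel r t a z"
    and "\<And>t a. t \<in> {0..T} \<Longrightarrow> a \<in> cball 0 \<rho> \<Longrightarrow> kernel r t a z \<le> blowup r z"
proof -
  have "continuous_on ({0..T} \<times> cball 0 \<rho>) ((\<lambda>(t, x). w t x) \<circ> (\<lambda>(t, a). (t, x\<^sub>0 + r *\<^sub>R a)))"
    by (intro continuous_on_compose continuous_on_subset[OF w])
      (auto intro!: continuous_intros simp: split_beta)
  then have cont: "continuous_on ({0..T} \<times> cball 0 \<rho>) (\<lambda>(t, a). kernel r t a z)"
    unfolding kernel_def split_beta divide_inverse o_def by (auto intro!: continuous_intros)
  have "compact ({0..T} \<times> cball (0 :: real ^ 'n) \<rho>)" "{0..T} \<times> cball (0 :: real ^ 'n) \<rho> \<noteq> {}"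
    using t\<^sub>0 rho_pos by (auto intro: compact_Times)
  then obtain m where m: "m \<in> {0..T} \<times> cball 0 \<rho>"
    "\<And>y. y \<in> {0..T} \<times> cball 0 \<rho> \<Longrightarrow> (\<lambda>(t, a). kernel r t a z) y \<le> (\<lambda>(t, a). kernel r t a z) m"
    using continuous_attains_sup[OF _ _ cont] by metis
  have eq: "blowup r z = (\<lambda>(t, a). kernel r t a z) m"
    unfolding blowup_def by (rule cSup_eq_maximum) (use m in auto)
  show "\<exists>t\<in>{0..T}. \<exists>a\<in>cball 0 \<rho>. blowup r z = kernel r t a z"
    using m(1) eq by auto
  show "kernel r t a z \<le> blowup r z" if "t \<in> {0..T}" "a \<in> cball 0 \<rho>" for t a
    unfolding eq using m(2)[of "(t, a)"] that by simp
qed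

lemma blowup_ge: "- 2 * N * ((S *v z) \<bullet> (S *v z)) \<le> blowup r z"
  using blowup_attained(2)[of t\<^sub>0 0 r z] kernel_0 t\<^sub>0 rho_pos by (simp add: less_imp_le)

lemma blowup_0: "0 \<le> blowup r 0"
  using blowup_ge[of 0] by simp

text \<open>Comparison with the competitor a = 0 at time \<open>t\<^sub>0\<close> bounds 3/2 N |a|^2
  plus K/2 times the squared time shift over r^2 by 4 N times the inner product of S z and a. The
  strict bound keeps a inside the ball over which \<open>blowup\<close> takes its supremum, and the
  time shift is O(r).\<close>

lemma maximizer_bounds:
  assumes "r > 0" "z \<in> cball 0 1" "t \<in> {0..T}" "a \<in> cball 0 \<rho>" "blowup r z = kernel r t a z"
  shows "norm a < \<rho>" "(t - t\<^sub>0)\<^sup>2 \<le> r\<^sup>2 * (8 * N * \<rho> * \<rho> / K)"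
proof -
  have Sz: "norm (S *v z) \<le> onorm ((*v) S)"
    using onorm_S(1)[of z] mult_left_le[OF _ onorm_S(2), of "norm z"] assms(2) by simp
  have "- 2 * N * ((S *v z) \<bullet> (S *v z)) \<le> N / 2 * (a \<bullet> a) - K / 2 * ((t - t\<^sub>0)\<^sup>2 / r\<^sup>2) - 2 * N * ((S *v z - a) \<bullet> (S *v z - a))"
    using blowup_ge[of z r] kernel_le[OF assms(1,3), of a z] assms(5) by linarith
  then have 1: "3 / 2 * N * (a \<bullet> a) + K / 2 * ((t - t\<^sub>0)\<^sup>2 / r\<^sup>2) \<le> 4 * N * ((S *v z) \<bullet> a)"
    by (simp add: algebra_simps inner_commute)
  have 2: "(S *v z) \<bullet> a \<le> onorm ((*v) S) * norm a"
    using norm_cauchy_schwarz[of "S *v z" a] mult_right_mono[OF Sz, of "norm a"] by simp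
  have "K / 2 * ((t - t\<^sub>0)\<^sup>2 / r\<^sup>2) \<ge> 0"
    using K by simp
  then have "3 / 2 * N * (a \<bullet> a) \<le> 4 * N * (onorm ((*v) S) * norm a)"
    using 1 mult_left_mono[OF 2, of "4 * N"] N by linarith
  then have "N * ((3 / 2 * norm a) * norm a) \<le> N * ((4 * onorm ((*v) S)) * norm a)"
    by (simp add: dot_square_norm power2_eq_square mult_ac)
  then have "(3 / 2 * norm a) * norm a \<le> (4 * onorm ((*v) S)) * norm a"
    using N by (simp only: mult_le_cancel_left_pos)
  then have "norm a = 0 \<or> 3 / 2 * norm a \<le> 4 * onorm ((*v) S)"
    using mult_le_cancel_right_pos[of "norm a" "3 / 2 * norm a" "4 * onorm ((*v) S)"] by force
  then show "norm a < \<rho>"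
    using onorm_S(2) rho_pos unfolding \<rho>_def by auto
  have "onorm ((*v) S) * norm a \<le> \<rho> * \<rho>"
    using \<open>norm a < \<rho>\<close> onorm_S(2) by (intro mult_mono) (auto simp: \<rho>_def)
  then have "4 * N * ((S *v z) \<bullet> a) \<le> 4 * N * (\<rho> * \<rho>)"
    using 2 N by (intro mult_left_mono) auto
  moreover have "0 \<le> 3 / 2 * N * (a \<bullet> a)" using N by simp
  ultimately have "K / 2 * ((t - t\<^sub>0)\<^sup>2 / r\<^sup>2) \<le> 4 * N * (\<rho> * \<rho>)"
    using 1 by linarith
  then show "(t - t\<^sub>0)\<^sup>2 \<le> r\<^sup>2 * (8 * N * \<rho> * \<rho> / K)"
    using K \<open>r > 0\<close> by (simp add: field_simps)
qed

lemma norm_S_le_rho: "z \<in> cball 0 1 \<Longrightarrow> norm (S *v z) \<le> \<rho>"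
  using onorm_S(1)[of z] onorm_S(2) mult_left_le[of "norm z" "onorm ((*v) S)"] by (simp add: \<rho>_def)

lemma blowup_bounded:
  assumes "r > 0" "z \<in> cball 0 1"
  shows "\<bar>blowup r z\<bar> \<le> 2 * N * \<rho>\<^sup>2"
proof -
  obtain t a where ta: "t \<in> {0..T}" "a \<in> cball 0 \<rho>" "blowup r z = kernel r t a z"
    using blowup_attained(1) by blast
  have "(S *v z) \<bullet> (S *v z) \<le> \<rho>\<^sup>2"
    using norm_S_le_rho[OF assms(2)] by (simp add: dot_square_norm power_mono)
  then have "- 2 * N * \<rho>\<^sup>2 \<le> blowup r z"
    using blowup_ge[of z r] N mult_left_mono[of "(S *v z) \<bullet> (S *v z)" "\<rho>\<^sup>2" "2 * N"] by linarith
  moreover have "a \<bullet> a \<le> \<rho>\<^sup>2"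
    using ta(2) by (simp add: dot_square_norm power_mono)
  then have "N / 2 * (a \<bullet> a) \<le> N / 2 * \<rho>\<^sup>2"
    using N by simp
  moreover have "K / 2 * ((t - t\<^sub>0)\<^sup>2 / r\<^sup>2) \<ge> 0" "2 * N * ((S *v z - a) \<bullet> (S *v z - a)) \<ge> 0" "N * \<rho>\<^sup>2 \<ge> 0"
    using N K by auto
  ultimately show ?thesis
    using kernel_le[OF assms(1) ta(1), of a z] ta(3) by linarith
qed

text \<open>For a fixed competitor only the quadratic term depends on z, and its increments are
  bounded independently of r. This is the equicontinuity of the blow-ups.\<close>

lemma blowup_lipschitz: "(8 * N * \<rho> * \<rho>)-lipschitz_on (cball 0 1) (blowup r)"
proof (rule lipschitz_onI)
  have one: "blowup r x - blowup r y \<le> 8 * N * \<rho> * \<rho> * norm (x - y)" if "x \<in> cball 0 1" "y \<in> cball 0 1" for x y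
  proof -
    obtain t a where ta: "t \<in> {0..T}" "a \<in> cball 0 \<rho>" "blowup r x = kernel r t a x"
      using blowup_attained(1) by blast
    have "blowup r x - blowup r y \<le> kernel r t a x - kernel r t a y"
      using blowup_attained(2)[OF ta(1,2), of r y] ta(3) by simp
    also have "\<dots> = 2 * N * ((S *v (y - x)) \<bullet> (S *v x + S *v y - 2 *\<^sub>R a))"
      by (simp add: kernel_def matrix_vector_mult_diff_distrib algebra_simps inner_commute)
    also have "\<dots> \<le> 2 * N * (norm (S *v (y - x)) * norm (S *v x + S *v y - 2 *\<^sub>R a))"
      using N by (intro mult_left_mono norm_cauchy_schwarz) auto
    also have "\<dots> \<le> 2 * N * ((\<rho> * norm (x - y)) * (4 * \<rho>))"
    proof (intro mult_left_mono mult_mono)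
      have "norm (S *v (y - x)) \<le> onorm ((*v) S) * norm (x - y)"
        using onorm_S(1)[of "y - x"] by (simp add: norm_minus_commute)
      also have "\<dots> \<le> \<rho> * norm (x - y)"
        using onorm_S(2) by (intro mult_right_mono) (auto simp: \<rho>_def)
      finally show "norm (S *v (y - x)) \<le> \<rho> * norm (x - y)" .
      have "norm (S *v x + S *v y - 2 *\<^sub>R a) \<le> norm (S *v x) + norm (S *v y) + norm (2 *\<^sub>R a)"
        using norm_triangle_ineq4[of "S *v x + S *v y" "2 *\<^sub>R a"] norm_triangle_ineq[of "S *v x" "S *v y"] by linarith
      then show "norm (S *v x + S *v y - 2 *\<^sub>R a) \<le> 4 * \<rho>"
        using norm_S_le_rho[OF that(1)] norm_S_le_rho[OF that(2)] ta(2) by simp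
    qed (use N rho_pos in auto)
    finally show ?thesis by (simp add: mult_ac)
  qed
  show "dist (blowup r x) (blowup r y) \<le> 8 * N * \<rho> * \<rho> * dist x y" if "x \<in> cball 0 1" "y \<in> cball 0 1" for x y
    using one[OF that] one[OF that(2,1)] by (simp add: dist_norm norm_minus_commute abs_le_iff)
  show "0 \<le> 8 * N * \<rho> * \<rho>" using N rho_pos by simp
qed

text \<open>A test function for the blow-up, transported back to the original variables. The
  argument of \<psi> moves with y in such a way that its image under S minus the rescaled y keeps
  the value S z - a. The quadratic term of \<open>kernel\<close> is then constant and drops
  out.\<close>

definition lifted_test :: "(real ^ 'n \<Rightarrow> real) \<Rightarrow> real \<Rightarrow> real ^ 'n \<Rightarrow> real ^ 'n \<Rightarrow> real \<Rightarrow> real ^ 'n \<Rightarrow> real"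
  where "lifted_test \<psi> r a z s y = p \<bullet> (y - x\<^sub>0) + q * (s - t\<^sub>0) + K * (s - t\<^sub>0)\<^sup>2
    + r\<^sup>2 * \<psi> (matrix_inv S *v ((1 / r) *\<^sub>R (y - x\<^sub>0) - a) + z)"

text \<open>Locality concerns y alone: the argument of \<psi> has to stay in the unit ball and the
  rescaled y in the ball of radius \<rho>. In time the comparison holds on all of [0, T].\<close>

lemma lifted_test_local_max:
  assumes r: "r > 0" and inv: "invertible S" and z: "z \<in> ball 0 1"
    and max: "\<And>y. y \<in> cball 0 1 \<Longrightarrow> blowup r y - \<psi> y \<le> blowup r z - \<psi> z"
    and ta: "t \<in> {0..T}" "norm a < \<rho>" "blowup r z = kernel r t a z"
  shows "local_max_on ({0..T} \<times> UNIV) (\<lambda>(s, y). w s y - lifted_test \<psi> r a z s y) (t, x\<^sub>0 + r *\<^sub>R a)"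
proof -
  define Z where "Z = (\<lambda>y. matrix_inv S *v ((1 / r) *\<^sub>R (y - x\<^sub>0) - a) + z)"
  have Za: "Z (x\<^sub>0 + r *\<^sub>R a) = z"
    using r by (simp add: Z_def)
  have "isCont Z (x\<^sub>0 + r *\<^sub>R a)"
    unfolding Z_def by (intro continuous_intros isCont_o2[OF _ matrix_vector_mult_linear_continuous_at])
  then have "(Z \<longlongrightarrow> Z (x\<^sub>0 + r *\<^sub>R a)) (nhds (x\<^sub>0 + r *\<^sub>R a))"
    by (simp add: continuous_at tendsto_at_iff_tendsto_nhds)
  then have Zev: "\<forall>\<^sub>F y in nhds (x\<^sub>0 + r *\<^sub>R a). Z y \<in> ball 0 1"
    by (rule topological_tendstoD) (use z Za in auto)
  have "((\<lambda>y. norm ((1 / r) *\<^sub>R (y - x\<^sub>0))) \<longlongrightarrow> norm ((1 / r) *\<^sub>R ((x\<^sub>0 + r *\<^sub>R a) - x\<^sub>0))) (nhds (x\<^sub>0 + r *\<^sub>R a))"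
    by (intro tendsto_intros filterlim_ident)
  then have "\<forall>\<^sub>F y in nhds (x\<^sub>0 + r *\<^sub>R a). norm ((1 / r) *\<^sub>R (y - x\<^sub>0)) < \<rho>"
    by (rule order_tendstoD) (use r ta in auto)
  with Zev have ev: "\<forall>\<^sub>F y in nhds (x\<^sub>0 + r *\<^sub>R a). Z y \<in> ball 0 1 \<and> norm ((1 / r) *\<^sub>R (y - x\<^sub>0)) < \<rho>"
    by (rule eventually_conj)
  have key: "w s y - lifted_test \<psi> r a z s y \<le> w t (x\<^sub>0 + r *\<^sub>R a) - lifted_test \<psi> r a z t (x\<^sub>0 + r *\<^sub>R a)"
    if s: "s \<in> {0..T}" and y: "Z y \<in> ball 0 1" "norm ((1 / r) *\<^sub>R (y - x\<^sub>0)) < \<rho>" for s y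
  proof -
    define b where "b = (1 / r) *\<^sub>R (y - x\<^sub>0)"
    have yb: "y = x\<^sub>0 + r *\<^sub>R b" using r by (simp add: b_def)
    have Zb: "Z y = matrix_inv S *v (b - a) + z" by (simp add: Z_def b_def)
    have "S *v (matrix_inv S *v (b - a)) = b - a"
      using invertible_matrix_inv(1)[OF inv] by (simp add: matrix_vector_mul_assoc)
    then have SZ: "S *v Z y - b = S *v z - a"
      by (simp add: Zb matrix_vector_right_distrib)
    have cancel: "r\<^sup>2 * (X / r\<^sup>2 - Y) = X - r\<^sup>2 * Y" for X Y
      using r by (simp add: field_simps)
    have "kernel r s b (Z y) - \<psi> (Z y) \<le> kernel r t a z - \<psi> z"
      using blowup_attained(2)[of s b r "Z y"] max[of "Z y"] y s ta(3) by (auto simp: b_def)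
    then have "(w s y - w t\<^sub>0 x\<^sub>0 - r * (p \<bullet> b) - q * (s - t\<^sub>0) - K * (s - t\<^sub>0)\<^sup>2) / r\<^sup>2 - \<psi> (Z y)
      \<le> (w t (x\<^sub>0 + r *\<^sub>R a) - w t\<^sub>0 x\<^sub>0 - r * (p \<bullet> a) - q * (t - t\<^sub>0) - K * (t - t\<^sub>0)\<^sup>2) / r\<^sup>2 - \<psi> z"
      unfolding kernel_def SZ yb[symmetric] by simp
    then have "r\<^sup>2 * ((w s y - w t\<^sub>0 x\<^sub>0 - r * (p \<bullet> b) - q * (s - t\<^sub>0) - K * (s - t\<^sub>0)\<^sup>2) / r\<^sup>2 - \<psi> (Z y))
      \<le> r\<^sup>2 * ((w t (x\<^sub>0 + r *\<^sub>R a) - w t\<^sub>0 x\<^sub>0 - r * (p \<bullet> a) - q * (t - t\<^sub>0) - K * (t - t\<^sub>0)\<^sup>2) / r\<^sup>2 - \<psi> z)"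
      by (rule mult_left_mono) simp
    then have "w s y - r * (p \<bullet> b) - q * (s - t\<^sub>0) - K * (s - t\<^sub>0)\<^sup>2 - r\<^sup>2 * \<psi> (Z y)
      \<le> w t (x\<^sub>0 + r *\<^sub>R a) - r * (p \<bullet> a) - q * (t - t\<^sub>0) - K * (t - t\<^sub>0)\<^sup>2 - r\<^sup>2 * \<psi> z"
      unfolding cancel by linarith
    moreover have "lifted_test \<psi> r a z s y = r * (p \<bullet> b) + q * (s - t\<^sub>0) + K * (s - t\<^sub>0)\<^sup>2 + r\<^sup>2 * \<psi> (Z y)"
      by (simp add: lifted_test_def Z_def yb)
    moreover have "lifted_test \<psi> r a z t (x\<^sub>0 + r *\<^sub>R a) = r * (p \<bullet> a) + q * (t - t\<^sub>0) + K * (t - t\<^sub>0)\<^sup>2 + r\<^sup>2 * \<psi> z"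
      using r by (simp add: lifted_test_def)
    ultimately show ?thesis by linarith
  qed
  have "\<forall>\<^sub>F u in nhds t \<times>\<^sub>F nhds (x\<^sub>0 + r *\<^sub>R a). Z (snd u) \<in> ball 0 1 \<and> norm ((1 / r) *\<^sub>R (snd u - x\<^sub>0)) < \<rho>"
    using ev by (rule eventually_compose_filterlim[OF _ filterlim_snd])
  then have "\<forall>\<^sub>F u in nhds (t, x\<^sub>0 + r *\<^sub>R a). Z (snd u) \<in> ball 0 1 \<and> norm ((1 / r) *\<^sub>R (snd u - x\<^sub>0)) < \<rho>"
    by (simp add: nhds_prod)
  then have "\<forall>\<^sub>F u in at (t, x\<^sub>0 + r *\<^sub>R a) within {0..T} \<times> UNIV. Z (snd u) \<in> ball 0 1 \<and> norm ((1 / r) *\<^sub>R (snd u - x\<^sub>0)) < \<rho>"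
    by (simp add: eventually_at_filter eventually_mono)
  moreover have "\<forall>\<^sub>F u in at (t, x\<^sub>0 + r *\<^sub>R a) within {0..T} \<times> UNIV. u \<in> {0..T} \<times> UNIV"
    by (simp add: eventually_at_filter)
  ultimately have "\<forall>\<^sub>F u in at (t, x\<^sub>0 + r *\<^sub>R a) within {0..T} \<times> UNIV.
      (\<lambda>(s, y). w s y - lifted_test \<psi> r a z s y) u \<le> (\<lambda>(s, y). w s y - lifted_test \<psi> r a z s y) (t, x\<^sub>0 + r *\<^sub>R a)"
    by eventually_elim (use key in auto)
  then show ?thesis
    using ta(1) unfolding local_max_on_def by blast
qed

text \<open>The factor r^2 meets one factor 1 / r per derivative in space: the gradient differs from
  p by a term with the factor r, whereas no power of r remains in the Hessian.\<close>

lemma lifted_test_C12: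
  assumes C2: "C2 \<psi> g H" and r: "r > 0"
  shows "C12 T (lifted_test \<psi> r a z) (\<lambda>s y. q + 2 * K * (s - t\<^sub>0))
    (\<lambda>s y. p + r *\<^sub>R (g (matrix_inv S *v ((1 / r) *\<^sub>R (y - x\<^sub>0) - a) + z) v* matrix_inv S))
    (\<lambda>s y. transpose (matrix_inv S) ** H (matrix_inv S *v ((1 / r) *\<^sub>R (y - x\<^sub>0) - a) + z) ** matrix_inv S)"
proof -
  define R where "R = matrix_inv S"
  define Z where "Z = (\<lambda>y. R *v ((1 / r) *\<^sub>R (y - x\<^sub>0) - a) + z)"
  have R_lin: "bounded_linear ((*v) R)" by simp
  have DZ: "(Z has_derivative (\<lambda>v. R *v ((1 / r) *\<^sub>R v))) (at y)" for y
  proof -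
    have "((\<lambda>y. (1 / r) *\<^sub>R (y - x\<^sub>0) - a) has_derivative (\<lambda>v. (1 / r) *\<^sub>R v)) (at y)"
      by (auto intro!: derivative_eq_intros)
    then have "((\<lambda>y. R *v ((1 / r) *\<^sub>R (y - x\<^sub>0) - a)) has_derivative (\<lambda>v. R *v ((1 / r) *\<^sub>R v))) (at y)"
      by (rule bounded_linear.has_derivative[OF R_lin])
    then show ?thesis unfolding Z_def by (auto intro!: derivative_eq_intros)
  qed
  have Zc: "continuous_on S' Z" for S'
    using DZ by (meson has_derivative_continuous continuous_at_imp_continuous_on)
  have Zc2: "continuous_on ({0..T} \<times> UNIV) (\<lambda>u. Z (snd u))"
    by (rule continuous_on_compose2[OF Zc[of UNIV]]) (auto intro: continuous_intros)
  have D\<psi>: "(\<psi> has_derivative (\<lambda>v. v \<bullet> g y)) (at y)" and Dg: "(g has_derivative (\<lambda>v. H y *v v)) (at y)" for y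
    using C2 by (auto simp: C2_def gderiv_def)
  have R_adj: "(R *v v) \<bullet> u = v \<bullet> (u v* R)" for u v
    by (metis dot_lmul_matrix inner_commute)
  have Hc: "continuous_on UNIV H" using C2 by (simp add: C2_def)
  have vec_cont: "continuous_on A (\<lambda>u. f u v* R)" if "continuous_on A f" for f :: "real \<times> (real ^ 'n) \<Rightarrow> real ^ 'n" and A
    unfolding vector_matrix_mult_def by (intro continuous_intros that)
  have mat_cont: "continuous_on A (\<lambda>u. transpose R ** M u ** R)" if "continuous_on A M" for M :: "real \<times> (real ^ 'n) \<Rightarrow> real ^ 'n ^ 'n" and A
    unfolding matrix_matrix_mult_def by (intro continuous_intros that)
  show ?thesis
    unfolding C12_def R_def[symmetric]
  proof (intro conjI ballI allI)
    fix t and x :: "real ^ 'n"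
    show "((\<lambda>s. lifted_test \<psi> r a z s x) has_real_derivative q + 2 * K * (t - t\<^sub>0)) (at t within {0..T})"
      unfolding lifted_test_def by (auto intro!: derivative_eq_intros)
    have "((\<lambda>y. \<psi> (Z y)) has_derivative (\<lambda>v. (R *v ((1 / r) *\<^sub>R v)) \<bullet> g (Z x))) (at x)"
      by (rule has_derivative_compose[OF DZ D\<psi>])
    moreover have "(R *v ((1 / r) *\<^sub>R v)) \<bullet> g (Z x) = (1 / r) * (v \<bullet> (g (Z x) v* R))" for v
      unfolding R_adj by simp
    ultimately have D: "((\<lambda>y. \<psi> (Z y)) has_derivative (\<lambda>v. (1 / r) * (v \<bullet> (g (Z x) v* R)))) (at x)"
      by simp
    have "((\<lambda>y. p \<bullet> (y - x\<^sub>0) + q * (t - t\<^sub>0) + K * (t - t\<^sub>0)\<^sup>2 + r\<^sup>2 * \<psi> (Z y)) has_derivative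
      (\<lambda>v. v \<bullet> (p + r *\<^sub>R (g (Z x) v* R)))) (at x)"
      by (rule derivative_eq_intros D refl)+
        (use r in \<open>auto simp: inner_add_right inner_commute power2_eq_square\<close>)
    then show "GDERIV (lifted_test \<psi> r a z t) x :> p + r *\<^sub>R (g (R *v ((1 / r) *\<^sub>R (x - x\<^sub>0) - a) + z) v* R)"
      unfolding gderiv_def lifted_test_def Z_def R_def by simp
    have "((\<lambda>y. g (Z y)) has_derivative (\<lambda>v. H (Z x) *v (R *v ((1 / r) *\<^sub>R v)))) (at x)"
      by (rule has_derivative_compose[OF DZ Dg])
    then have "((\<lambda>y. transpose R *v g (Z y)) has_derivative (\<lambda>v. transpose R *v (H (Z x) *v (R *v ((1 / r) *\<^sub>R v))))) (at x)"
      by (rule bounded_linear.has_derivative[OF matrix_vector_mul_bounded_linear])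
    then have "((\<lambda>y. p + r *\<^sub>R (transpose R *v g (Z y))) has_derivative
      (\<lambda>v. r *\<^sub>R (transpose R *v (H (Z x) *v (R *v ((1 / r) *\<^sub>R v)))))) (at x)"
      by (auto intro!: derivative_eq_intros)
    moreover have "r *\<^sub>R (transpose R *v (H (Z x) *v (R *v ((1 / r) *\<^sub>R v)))) = (transpose R ** H (Z x) ** R) *v v" for v
      using r by (simp add: matrix_vector_mul_assoc matrix_vector_mult_scaleR matrix_mul_assoc)
    ultimately show "((\<lambda>y. p + r *\<^sub>R (g (R *v ((1 / r) *\<^sub>R (y - x\<^sub>0) - a) + z) v* R)) has_derivative
       (\<lambda>v. (transpose R ** H (R *v ((1 / r) *\<^sub>R (x - x\<^sub>0) - a) + z) ** R) *v v)) (at x)"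
      by (simp add: Z_def)
  next
    have "continuous_on ({0..T} \<times> UNIV) (\<lambda>u. \<psi> (Z (snd u)))"
      by (rule continuous_on_compose2[OF C2_continuous[OF C2, of UNIV] Zc2]) auto
    then show "continuous_on ({0..T} \<times> UNIV) (\<lambda>(t, x). lifted_test \<psi> r a z t x)"
      unfolding lifted_test_def split_beta Z_def R_def by (intro continuous_intros) 
    show "continuous_on ({0..T} \<times> UNIV) (\<lambda>(t :: real, x :: real ^ 'n). q + 2 * K * (t - t\<^sub>0))"
      unfolding split_beta by (intro continuous_intros)
    have "continuous_on ({0..T} \<times> UNIV) (\<lambda>u. g (Z (snd u)))"
      by (rule continuous_on_compose2[OF C2_continuous_grad[OF C2, of UNIV] Zc2]) auto
    then show "continuous_on ({0..T} \<times> UNIV) (\<lambda>(t :: real, x). p + r *\<^sub>R (g (R *v ((1 / r) *\<^sub>R (x - x\<^sub>0) - a) + z) v* R))"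
      unfolding split_beta Z_def by (intro continuous_intros vec_cont)
    have "continuous_on ({0..T} \<times> UNIV) (\<lambda>u. H (Z (snd u)))"
      by (rule continuous_on_compose2[OF Hc Zc2]) auto
    then show "continuous_on ({0..T} \<times> UNIV) (\<lambda>(t :: real, x). transpose R ** H (R *v ((1 / r) *\<^sub>R (x - x\<^sub>0) - a) + z) ** R)"
      unfolding split_beta Z_def by (intro mat_cont)
  qed
qed

end

section \<open>The second-order inequality at a doubled maximum\<close>

lemma trace_transpose: "trace (transpose M) = trace M"
  by (simp add: trace_def transpose_def)

text \<open>The transpose of X appears because X is an arbitrary, possibly non-symmetric
  matrix.\<close>

lemma diffusion_op_trace:
  fixes X :: "real ^ 'n ^ 'n"
  shows "diffusion_op \<sigma> t x X = 1 / 2 * trace (\<sigma> t x ** transpose (\<sigma> t x) ** transpose X)"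
proof -
  have "(A ** transpose X) $ i $ i = (\<Sum>j\<in>UNIV. A $ i $ j * X $ i $ j)" for A :: "real ^ 'n ^ 'n" and i
    by (simp add: matrix_matrix_mult_def transpose_def)
  then show ?thesis
    by (simp add: diffusion_op_def trace_def)
qed

text \<open>By cyclicity of the trace, the coordinates given by \<sigma> turn the diffusion into
  half the Laplacian.\<close>

lemma diffusion_op_conjugate:
  assumes "invertible (\<sigma> t x)"
  shows "diffusion_op \<sigma> t x (transpose (matrix_inv (\<sigma> t x)) ** Y ** matrix_inv (\<sigma> t x)) = 1 / 2 * trace Y"
proof -
  define S where "S = \<sigma> t x"
  define R where "R = matrix_inv S"
  have RS: "R ** S = mat 1"
    using invertible_matrix_inv(2)[OF assms] by (simp add: R_def S_def)
  have "trace (S ** transpose S ** transpose (transpose R ** Y ** R))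
      = trace (S ** (transpose S ** transpose R ** transpose Y ** R))"
    by (simp add: matrix_transpose_mul matrix_mul_assoc)
  also have "\<dots> = trace (transpose S ** transpose R ** transpose Y ** R ** S)"
    by (rule trace_mul_sym)
  also have "transpose S ** transpose R ** transpose Y ** R ** S = transpose (R ** S) ** transpose Y ** (R ** S)"
    by (simp add: matrix_transpose_mul matrix_mul_assoc)
  also have "trace \<dots> = trace Y"
    by (simp add: RS trace_transpose)
  finally show ?thesis
    by (simp add: diffusion_op_trace S_def R_def)
qed

lemma tendsto_matrix_mult [tendsto_intros]:
  fixes f :: "'a \<Rightarrow> real ^ 'n ^ 'm" and g :: "'a \<Rightarrow> real ^ 'k ^ 'n"
  assumes "(f \<longlongrightarrow> a) F" "(g \<longlongrightarrow> b) F"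
  shows "((\<lambda>x. f x ** g x) \<longlongrightarrow> a ** b) F"
  unfolding matrix_matrix_mult_def by (intro tendsto_intros assms)

lemma tendsto_vector_matrix_mult [tendsto_intros]:
  fixes f :: "'a \<Rightarrow> real ^ 'n" and g :: "'a \<Rightarrow> real ^ 'k ^ 'n"
  assumes "(f \<longlongrightarrow> a) F" "(g \<longlongrightarrow> b) F"
  shows "((\<lambda>x. f x v* g x) \<longlongrightarrow> a v* b) F"
  unfolding vector_matrix_mult_def by (intro tendsto_intros assms)

lemma tendsto_transpose [tendsto_intros]:
  fixes f :: "'a \<Rightarrow> real ^ 'n ^ 'm"
  assumes "(f \<longlongrightarrow> a) F"
  shows "((\<lambda>x. transpose (f x)) \<longlongrightarrow> transpose a) F"
  unfolding transpose_def by (intro tendsto_intros assms)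

lemma tendsto_trace [tendsto_intros]:
  fixes f :: "'a \<Rightarrow> real ^ 'n ^ 'n"
  assumes "(f \<longlongrightarrow> a) F"
  shows "((\<lambda>x. trace (f x)) \<longlongrightarrow> trace a) F"
  unfolding trace_def by (intro tendsto_intros assms)

lemma continuous_on_within_tendsto:
  assumes "continuous_on S f" "a \<in> S" "(g \<longlongrightarrow> a) F" "\<And>j. g j \<in> S"
  shows "((\<lambda>j. f (g j)) \<longlongrightarrow> f a) F"
  using continuous_on_tendsto_compose[OF assms(1,3,2)] assms(4) by auto

text \<open>The viscosity inequality at the lifted tests passes to the limit r -> 0: the first-order
  part tends to its value at the touching point and the diffusion term, by conjugation, to c. The
  inequality \<open>visc\<close> is demanded only near that point, because only there will the
  obstacles be known to be inactive.\<close>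

lemma (in touching) blowup_asymp_subharmonic:
  assumes S: "S = \<sigma> t\<^sub>0 x\<^sub>0" "invertible S" and \<sigma>: "continuous_on ({0..T} \<times> UNIV) (\<lambda>(t, x). \<sigma> t x)"
    and "t\<^sub>0 < T" "d > 0"
    and G: "continuous (at (t\<^sub>0, x\<^sub>0, p) within {0..T} \<times> UNIV \<times> UNIV) (\<lambda>(t, x, \<pi>). G t x \<pi>)"
    and visc: "\<And>\<phi> \<phi>t \<phi>x \<phi>xx t x. C12 T \<phi> \<phi>t \<phi>x \<phi>xx \<Longrightarrow> t \<in> {0..<T} \<Longrightarrow> dist (t, x) (t\<^sub>0, x\<^sub>0) < d \<Longrightarrow>
      local_max_on ({0..T} \<times> UNIV) (\<lambda>(s, y). w s y - \<phi> s y) (t, x) \<Longrightarrow>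
      G t x (\<phi>x t x) - \<phi>t t x \<le> diffusion_op \<sigma> t x (\<phi>xx t x)"
  shows "asymp_subharmonic (\<lambda>k. blowup (1 / real (Suc k))) (G t\<^sub>0 x\<^sub>0 p - q)"
  unfolding asymp_subharmonic_def
proof (intro allI impI)
  fix \<psi> g H c and \<kappa> :: "nat \<Rightarrow> nat" and \<zeta>' :: "nat \<Rightarrow> real ^ 'n"
  assume C2: "C2 \<psi> g H" and tr: "\<forall>x. trace (H x) = 2 * c" and \<kappa>: "strict_mono \<kappa>"
    and \<zeta>': "\<forall>j. \<zeta>' j \<in> ball 0 1 \<and> (\<forall>y\<in>cball 0 1. blowup (1 / real (Suc (\<kappa> j))) y - \<psi> y
      \<le> blowup (1 / real (Suc (\<kappa> j))) (\<zeta>' j) - \<psi> (\<zeta>' j))"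
  \<comment> \<open>The trace of \<open>H\<close> is constant but \<open>H\<close> is not, and
    \<sigma> is evaluated off the touching point. To pass to the limit in the diffusion term, the
    maximizers in the unit ball are made to converge.\<close>
  have "\<forall>j. \<zeta>' j \<in> cball 0 1"
    using \<zeta>' ball_subset_cball by blast
  then obtain \<zeta>0 l where l: "strict_mono l" "(\<zeta>' \<circ> l) \<longlonglongrightarrow> \<zeta>0"
    using compact_cball[of "0 :: real ^ 'n" 1] unfolding compact_eq_seq_compact_metric seq_compact_def by metis
  define \<zeta> where "\<zeta> = \<zeta>' \<circ> l"
  define r where "r = (\<lambda>j. 1 / real (Suc (\<kappa> (l j))))"
  have r_pos: "r j > 0" for j by (simp add: r_def)
  have "strict_mono (\<kappa> \<circ> l)" using strict_mono_o[OF \<kappa> l(1)] .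
  then have r_lim: "r \<longlonglongrightarrow> 0"
    using LIMSEQ_subseq_LIMSEQ[OF lim_1_over_n[THEN LIMSEQ_Suc], of "\<kappa> \<circ> l"] unfolding r_def o_def by simp
  have \<zeta>: "\<zeta> j \<in> ball 0 1" "\<And>y. y \<in> cball 0 1 \<Longrightarrow> blowup (r j) y - \<psi> y \<le> blowup (r j) (\<zeta> j) - \<psi> (\<zeta> j)" for j
    using \<zeta>' by (auto simp: \<zeta>_def r_def)
  have \<zeta>c: "\<zeta> j \<in> cball 0 1" for j using \<zeta>(1)[of j] by simp
  have "\<forall>j. \<exists>t a. t \<in> {0..T} \<and> a \<in> cball 0 \<rho> \<and> blowup (r j) (\<zeta> j) = kernel (r j) t a (\<zeta> j)"
    using blowup_attained(1) by blast
  then obtain t a where ta: "\<And>j. t j \<in> {0..T}" "\<And>j. a j \<in> cball 0 \<rho>"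
    "\<And>j. blowup (r j) (\<zeta> j) = kernel (r j) (t j) (a j) (\<zeta> j)"
    by metis
  note bounds = maximizer_bounds[OF r_pos \<zeta>c ta]
  define x where "x = (\<lambda>j. x\<^sub>0 + r j *\<^sub>R a j)"
  define R where "R = matrix_inv S"
  have Z: "matrix_inv S *v ((1 / r j) *\<^sub>R (x j - x\<^sub>0) - a j) + \<zeta> j = \<zeta> j" for j
    using r_pos[of j] by (simp add: x_def)
  have ineq: "G (t j) (x j) (p + r j *\<^sub>R (g (\<zeta> j) v* R)) - (q + 2 * K * (t j - t\<^sub>0))
      \<le> diffusion_op \<sigma> (t j) (x j) (transpose R ** H (\<zeta> j) ** R)"
    if "t j < T" "dist (t j, x j) (t\<^sub>0, x\<^sub>0) < d" for j
  proof -
    have "local_max_on ({0..T} \<times> UNIV) (\<lambda>(s, y). w s y - lifted_test \<psi> (r j) (a j) (\<zeta> j) s y) (t j, x j)"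
      unfolding x_def by (rule lifted_test_local_max[OF r_pos S(2) \<zeta> ta(1) bounds(1) ta(3)])
    from visc[OF lifted_test_C12[OF C2 r_pos] _ that(2) this] show ?thesis
      using ta(1)[of j] that(1) by (simp add: Z R_def)
  qed
  have "(\<lambda>j. (t j - t\<^sub>0)\<^sup>2) \<longlonglongrightarrow> 0"
  proof (rule tendsto_sandwich[OF _ _ tendsto_const])
    show "\<forall>\<^sub>F j in sequentially. (t j - t\<^sub>0)\<^sup>2 \<le> (r j)\<^sup>2 * (8 * N * \<rho> * \<rho> / K)"
      using bounds(2) by simp
    show "(\<lambda>j. (r j)\<^sup>2 * (8 * N * \<rho> * \<rho> / K)) \<longlonglongrightarrow> 0"
      using r_lim K by (auto intro!: tendsto_eq_intros)
  qed simp
  then have "(\<lambda>j. t j - t\<^sub>0) \<longlonglongrightarrow> 0"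
    using tendsto_real_sqrt[of "\<lambda>j. (t j - t\<^sub>0)\<^sup>2" 0] by (simp add: tendsto_rabs_zero_iff)
  then have t_lim: "t \<longlonglongrightarrow> t\<^sub>0"
    by (simp add: LIM_zero_cancel)
  have "(\<lambda>j. r j *\<^sub>R a j) \<longlonglongrightarrow> 0"
  proof (rule Lim_null_comparison)
    show "\<forall>\<^sub>F j in sequentially. norm (r j *\<^sub>R a j) \<le> r j * \<rho>"
      using ta(2) r_pos by (auto intro!: always_eventually mult_left_mono simp: less_imp_le)
    show "(\<lambda>j. r j * \<rho>) \<longlonglongrightarrow> 0"
      using r_lim by (auto intro!: tendsto_eq_intros)
  qed
  then have x_lim: "x \<longlonglongrightarrow> x\<^sub>0"
    using tendsto_add[OF tendsto_const[of x\<^sub>0]] unfolding x_def by force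
  have \<zeta>_lim: "\<zeta> \<longlonglongrightarrow> \<zeta>0" using l(2) by (simp add: \<zeta>_def)
  have g_lim: "(\<lambda>j. g (\<zeta> j)) \<longlonglongrightarrow> g \<zeta>0"
    using continuous_on_within_tendsto[OF C2_continuous_grad[OF C2, of UNIV] _ \<zeta>_lim] by simp
  have H_lim: "(\<lambda>j. H (\<zeta> j)) \<longlonglongrightarrow> H \<zeta>0"
    using continuous_on_within_tendsto[of UNIV H, OF _ _ \<zeta>_lim] C2 by (simp add: C2_def)
  have \<pi>_lim: "(\<lambda>j. p + r j *\<^sub>R (g (\<zeta> j) v* R)) \<longlonglongrightarrow> p"
    by (rule tendsto_eq_intros r_lim g_lim refl | simp)+
  have "(\<lambda>j. (t j, x j)) \<longlonglongrightarrow> (t\<^sub>0, x\<^sub>0)"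
    by (intro tendsto_intros t_lim x_lim)
  then have near: "\<forall>\<^sub>F j in sequentially. dist (t j, x j) (t\<^sub>0, x\<^sub>0) < d"
    using \<open>d > 0\<close> by (rule tendstoD)
  have "(\<lambda>j. (\<lambda>(t, x). \<sigma> t x) (t j, x j)) \<longlonglongrightarrow> (\<lambda>(t, x). \<sigma> t x) (t\<^sub>0, x\<^sub>0)"
    by (rule continuous_on_within_tendsto[OF \<sigma>]) (use t\<^sub>0 ta(1) in \<open>auto intro!: tendsto_intros t_lim x_lim\<close>)
  then have \<sigma>_lim: "(\<lambda>j. \<sigma> (t j) (x j)) \<longlonglongrightarrow> S"
    by (simp add: S)
  have "((\<lambda>j. (\<lambda>(t, x, \<pi>). G t x \<pi>) (t j, x j, p + r j *\<^sub>R (g (\<zeta> j) v* R))) \<longlonglongrightarrow> (\<lambda>(t, x, \<pi>). G t x \<pi>) (t\<^sub>0, x\<^sub>0, p))"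
    by (rule continuous_within_tendsto_compose[OF G])
      (use ta(1) in \<open>auto intro!: tendsto_intros t_lim x_lim \<pi>_lim\<close>)
  then have G_lim: "(\<lambda>j. G (t j) (x j) (p + r j *\<^sub>R (g (\<zeta> j) v* R))) \<longlonglongrightarrow> G t\<^sub>0 x\<^sub>0 p"
    by simp
  have lhs: "(\<lambda>j. G (t j) (x j) (p + r j *\<^sub>R (g (\<zeta> j) v* R)) - (q + 2 * K * (t j - t\<^sub>0))) \<longlonglongrightarrow> G t\<^sub>0 x\<^sub>0 p - q"
    by (rule tendsto_eq_intros G_lim t_lim refl | simp)+
  have "(\<lambda>j. diffusion_op \<sigma> (t j) (x j) (transpose R ** H (\<zeta> j) ** R))
      \<longlonglongrightarrow> 1 / 2 * trace (S ** transpose S ** transpose (transpose R ** H \<zeta>0 ** R))"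
    unfolding diffusion_op_trace by (intro tendsto_intros \<sigma>_lim H_lim)
  then have rhs: "(\<lambda>j. diffusion_op \<sigma> (t j) (x j) (transpose R ** H (\<zeta> j) ** R)) \<longlonglongrightarrow> c"
    using diffusion_op_conjugate[of \<sigma> t\<^sub>0 x\<^sub>0 "H \<zeta>0"] S tr by (simp add: R_def diffusion_op_trace)
  have "\<forall>\<^sub>F j in sequentially. t j < T"
    using t_lim \<open>t\<^sub>0 < T\<close> by (rule order_tendstoD)
  then have "\<forall>\<^sub>F j in sequentially. G (t j) (x j) (p + r j *\<^sub>R (g (\<zeta> j) v* R)) - (q + 2 * K * (t j - t\<^sub>0))
      \<le> diffusion_op \<sigma> (t j) (x j) (transpose R ** H (\<zeta> j) ** R)"
    using near by eventually_elim (rule ineq)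
  then show "G t\<^sub>0 x\<^sub>0 p - q \<le> c"
    by (rule tendsto_le[OF sequentially_bot rhs lhs])
qed

lemma C2_quadratic:
  fixes M :: "real ^ 'n ^ 'n"
  shows "C2 (\<lambda>z. (M *v z) \<bullet> (M *v z)) (\<lambda>z. 2 *\<^sub>R (transpose M *v (M *v z))) (\<lambda>z. 2 *\<^sub>R (transpose M ** M))"
proof -
  have adj: "(M *v v) \<bullet> u = v \<bullet> (u v* M)" for u v
    by (metis dot_lmul_matrix inner_commute)
  have DM: "((*v) M has_derivative (*v) M) (at x)" for x
    by (rule bounded_linear_imp_has_derivative) simp
  have "((\<lambda>z. (M *v z) \<bullet> (M *v z)) has_derivative (\<lambda>v. v \<bullet> (2 *\<^sub>R (transpose M *v (M *v x))))) (at x)" for x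
  proof -
    have "(M *v x) \<bullet> (M *v v) + (M *v v) \<bullet> (M *v x) = v \<bullet> (2 *\<^sub>R (transpose M *v (M *v x)))" for v
      using adj[of v "M *v x"] inner_commute[of "M *v x" "M *v v"] by simp
    then show ?thesis
      using has_derivative_inner[OF DM[of x] DM[of x]] by simp
  qed
  moreover have "((\<lambda>z. 2 *\<^sub>R (transpose M *v (M *v z))) has_derivative (\<lambda>v. (2 *\<^sub>R (transpose M ** M)) *v v)) (at x)" for x
    by (rule derivative_eq_intros bounded_linear.has_derivative[OF matrix_vector_mul_bounded_linear] DM refl)+
      (simp add: scaleR_matrix_vector_assoc matrix_vector_mul_assoc del: transpose_matrix_vector)
  ultimately show ?thesis
    unfolding C2_def gderiv_def by (intro conjI allI continuous_on_const)
qed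

text \<open>On nested vectors \<open>norm\<close> is the Frobenius norm.\<close>

lemma trace_transpose_mult_self: "trace (transpose M ** M) = (norm (M :: real ^ 'n ^ 'n))\<^sup>2"
proof -
  have "(norm M)\<^sup>2 = (\<Sum>i\<in>UNIV. \<Sum>j\<in>UNIV. M $ i $ j * M $ i $ j)"
    by (simp add: power2_norm_eq_inner inner_vec_def)
  then show ?thesis
    by (simp add: trace_def matrix_matrix_mult_def transpose_def) (rule sum.swap)
qed

text \<open>\<open>G\<^sub>1\<close> and \<open>G\<^sub>2\<close> stand for the two inequalities
  without their time-derivative and Hessian terms. The time derivatives at the doubled maximum are
  opposite and cancel, so K does not appear in the bound.\<close>

lemma theorem_on_sums:
  fixes w\<^sub>1 w\<^sub>2 :: "real \<Rightarrow> real ^ 'n \<Rightarrow> real"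
  assumes w: "continuous_on ({0..T} \<times> UNIV) (\<lambda>(t, x). w\<^sub>1 t x)" "continuous_on ({0..T} \<times> UNIV) (\<lambda>(t, x). w\<^sub>2 t x)"
    and NK: "N > 0" "K > 0" and t: "t\<^sub>1 \<in> {0..<T}" "t\<^sub>2 \<in> {0..<T}" and "d > 0"
    and p: "p = N *\<^sub>R (x\<^sub>1 - x\<^sub>2)"
    and max: "\<And>t x s y. t \<in> {0..T} \<Longrightarrow> s \<in> {0..T} \<Longrightarrow>
      w\<^sub>1 t x + w\<^sub>2 s y - N / 2 * ((x - y) \<bullet> (x - y)) - K / 2 * (t - s)\<^sup>2
      \<le> w\<^sub>1 t\<^sub>1 x\<^sub>1 + w\<^sub>2 t\<^sub>2 x\<^sub>2 - N / 2 * ((x\<^sub>1 - x\<^sub>2) \<bullet> (x\<^sub>1 - x\<^sub>2)) - K / 2 * (t\<^sub>1 - t\<^sub>2)\<^sup>2"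
    and \<sigma>: "continuous_on ({0..T} \<times> UNIV) (\<lambda>(t, x). \<sigma> t x)"
    and inv: "\<And>t x. t \<in> {0..T} \<Longrightarrow> invertible (\<sigma> t x)"
    and G\<^sub>1: "continuous (at (t\<^sub>1, x\<^sub>1, p) within {0..T} \<times> UNIV \<times> UNIV) (\<lambda>(t, x, \<pi>). G\<^sub>1 t x \<pi>)"
    and G\<^sub>2: "continuous (at (t\<^sub>2, x\<^sub>2, - p) within {0..T} \<times> UNIV \<times> UNIV) (\<lambda>(t, x, \<pi>). G\<^sub>2 t x \<pi>)"
    and visc\<^sub>1: "\<And>\<phi> \<phi>t \<phi>x \<phi>xx t x. C12 T \<phi> \<phi>t \<phi>x \<phi>xx \<Longrightarrow> t \<in> {0..<T} \<Longrightarrow> dist (t, x) (t\<^sub>1, x\<^sub>1) < d \<Longrightarrow>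
      local_max_on ({0..T} \<times> UNIV) (\<lambda>(s, y). w\<^sub>1 s y - \<phi> s y) (t, x) \<Longrightarrow>
      G\<^sub>1 t x (\<phi>x t x) - \<phi>t t x \<le> diffusion_op \<sigma> t x (\<phi>xx t x)"
    and visc\<^sub>2: "\<And>\<phi> \<phi>t \<phi>x \<phi>xx t x. C12 T \<phi> \<phi>t \<phi>x \<phi>xx \<Longrightarrow> t \<in> {0..<T} \<Longrightarrow> dist (t, x) (t\<^sub>2, x\<^sub>2) < d \<Longrightarrow>
      local_max_on ({0..T} \<times> UNIV) (\<lambda>(s, y). w\<^sub>2 s y - \<phi> s y) (t, x) \<Longrightarrow>
      G\<^sub>2 t x (\<phi>x t x) - \<phi>t t x \<le> diffusion_op \<sigma> t x (\<phi>xx t x)"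
  shows "G\<^sub>1 t\<^sub>1 x\<^sub>1 p + G\<^sub>2 t\<^sub>2 x\<^sub>2 (- p) \<le> N * (norm (\<sigma> t\<^sub>1 x\<^sub>1 - \<sigma> t\<^sub>2 x\<^sub>2))\<^sup>2"
proof -
  \<comment> \<open>The time derivative of K/2 (t - s)^2 at the maximum, just as p is the gradient
    of the penalty in space.\<close>
  define q where "q = K * (t\<^sub>1 - t\<^sub>2)"
  interpret A: touching T w\<^sub>1 N K t\<^sub>1 q x\<^sub>1 p "\<sigma> t\<^sub>1 x\<^sub>1"
  proof
    fix t a assume "t \<in> {0..T}"
    then show "w\<^sub>1 t (x\<^sub>1 + a) - w\<^sub>1 t\<^sub>1 x\<^sub>1 - p \<bullet> a - q * (t - t\<^sub>1) \<le> N / 2 * (a \<bullet> a) + K / 2 * (t - t\<^sub>1)\<^sup>2"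
      using max[of t t\<^sub>2 "x\<^sub>1 + a" x\<^sub>2] \<open>t\<^sub>2 \<in> _\<close>
      by (simp add: p q_def power2_eq_square algebra_simps inner_commute)
  qed (use w NK t in auto)
  interpret B: touching T w\<^sub>2 N K t\<^sub>2 "- q" x\<^sub>2 "- p" "\<sigma> t\<^sub>2 x\<^sub>2"
  proof
    fix t a assume "t \<in> {0..T}"
    then show "w\<^sub>2 t (x\<^sub>2 + a) - w\<^sub>2 t\<^sub>2 x\<^sub>2 - - p \<bullet> a - - q * (t - t\<^sub>2) \<le> N / 2 * (a \<bullet> a) + K / 2 * (t - t\<^sub>2)\<^sup>2"
      using max[of t\<^sub>1 t x\<^sub>1 "x\<^sub>2 + a"] \<open>t\<^sub>1 \<in> _\<close>
      by (simp add: p q_def power2_eq_square algebra_simps inner_commute)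
  qed (use w NK t in auto)
  define M where "M = \<sigma> t\<^sub>1 x\<^sub>1 - \<sigma> t\<^sub>2 x\<^sub>2"
  have sum_le: "A.blowup r z + B.blowup r z \<le> N * ((M *v z) \<bullet> (M *v z))" if r: "r > 0" for r z
  proof -
    obtain t a where ta: "t \<in> {0..T}" "A.blowup r z = A.kernel r t a z"
      using A.blowup_attained(1) by blast
    obtain s b where sb: "s \<in> {0..T}" "B.blowup r z = B.kernel r s b z"
      using B.blowup_attained(1) by blast
    define \<alpha> where "\<alpha> = \<sigma> t\<^sub>1 x\<^sub>1 *v z - a"
    define \<beta> where "\<beta> = \<sigma> t\<^sub>2 x\<^sub>2 *v z - b"
    define X where "X = w\<^sub>1 t (x\<^sub>1 + r *\<^sub>R a) - w\<^sub>1 t\<^sub>1 x\<^sub>1 - r * (p \<bullet> a) - q * (t - t\<^sub>1) - K * (t - t\<^sub>1)\<^sup>2"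
    define Y where "Y = w\<^sub>2 s (x\<^sub>2 + r *\<^sub>R b) - w\<^sub>2 t\<^sub>2 x\<^sub>2 - r * (- p \<bullet> b) - - q * (s - t\<^sub>2) - K * (s - t\<^sub>2)\<^sup>2"
    \<comment> \<open>The two subtracted time quadratics exceed the penalty by a perfect square: K
      a^2 + K b^2 - K/2 (a - b)^2 = K/2 (a + b)^2.\<close>
    have "X + Y \<le> N / 2 * ((a - b) \<bullet> (a - b)) * r\<^sup>2 - K / 2 * ((t - t\<^sub>1) + (s - t\<^sub>2))\<^sup>2"
      using max[OF ta(1) sb(1), of "x\<^sub>1 + r *\<^sub>R a" "x\<^sub>2 + r *\<^sub>R b"]
      by (simp add: X_def Y_def p q_def power2_eq_square algebra_simps inner_commute)
    also have "\<dots> \<le> N / 2 * ((a - b) \<bullet> (a - b)) * r\<^sup>2"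
      using NK by simp
    finally have "X / r\<^sup>2 + Y / r\<^sup>2 \<le> N / 2 * ((a - b) \<bullet> (a - b))"
      using r by (simp add: add_divide_distrib[symmetric] pos_divide_le_eq)
    moreover have "A.kernel r t a z = X / r\<^sup>2 - 2 * N * (\<alpha> \<bullet> \<alpha>)" "B.kernel r s b z = Y / r\<^sup>2 - 2 * N * (\<beta> \<bullet> \<beta>)"
      by (simp_all add: A.kernel_def B.kernel_def X_def Y_def \<alpha>_def \<beta>_def)
    ultimately have "A.blowup r z + B.blowup r z
      \<le> N / 2 * ((a - b) \<bullet> (a - b)) - 2 * N * (\<alpha> \<bullet> \<alpha>) - 2 * N * (\<beta> \<bullet> \<beta>)"
      using ta sb by linarith
    \<comment> \<open>Completion of squares. The weight 2 N in \<open>kernel\<close> is what makes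
      the remainder minus a sum of two squares.\<close>
    also have "\<dots> = N * ((M *v z) \<bullet> (M *v z)) - N / 2 * ((M *v z + \<alpha> - \<beta>) \<bullet> (M *v z + \<alpha> - \<beta>))
        - N * ((\<alpha> + \<beta>) \<bullet> (\<alpha> + \<beta>))"
    proof -
      have ab: "a - b = M *v z - \<alpha> + \<beta>"
        by (simp add: M_def \<alpha>_def \<beta>_def matrix_vector_mult_diff_rdistrib)
      show ?thesis
        unfolding ab by (simp add: algebra_simps inner_commute)
    qed
    also have "\<dots> \<le> N * ((M *v z) \<bullet> (M *v z))"
    proof -
      have "0 \<le> N / 2 * ((M *v z + \<alpha> - \<beta>) \<bullet> (M *v z + \<alpha> - \<beta>))" "0 \<le> N * ((\<alpha> + \<beta>) \<bullet> (\<alpha> + \<beta>))"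
        using NK by simp_all
      then show ?thesis by linarith
    qed
    finally show ?thesis .
  qed
  define L where "L = max (8 * N * A.\<rho> * A.\<rho>) (8 * N * B.\<rho> * B.\<rho>)"
  define B where "B = max (2 * N * A.\<rho>\<^sup>2) (2 * N * B.\<rho>\<^sup>2)"
  have "(G\<^sub>1 t\<^sub>1 x\<^sub>1 p - q) + (G\<^sub>2 t\<^sub>2 x\<^sub>2 (- p) - - q) \<le> N * (norm M)\<^sup>2"
  proof (rule asymp_subharmonic_pair)
    show "asymp_subharmonic (\<lambda>k. A.blowup (1 / real (Suc k))) (G\<^sub>1 t\<^sub>1 x\<^sub>1 p - q)"
      by (rule A.blowup_asymp_subharmonic[where \<sigma> = \<sigma> and G = G\<^sub>1 and d = d])
        (use t inv \<sigma> \<open>d > 0\<close> G\<^sub>1 visc\<^sub>1 in auto)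
    show "asymp_subharmonic (\<lambda>k. B.blowup (1 / real (Suc k))) (G\<^sub>2 t\<^sub>2 x\<^sub>2 (- p) - - q)"
      by (rule B.blowup_asymp_subharmonic[where \<sigma> = \<sigma> and G = G\<^sub>2 and d = d])
        (use t inv \<sigma> \<open>d > 0\<close> G\<^sub>2 visc\<^sub>2 in auto)
    show "L-lipschitz_on (cball 0 1) (A.blowup (1 / real (Suc k)))"
      "L-lipschitz_on (cball 0 1) (B.blowup (1 / real (Suc k)))" for k
      by (rule lipschitz_on_le[OF A.blowup_lipschitz], simp add: L_def)
        (rule lipschitz_on_le[OF B.blowup_lipschitz], simp add: L_def)
    show "\<bar>A.blowup (1 / real (Suc k)) z\<bar> \<le> B" "\<bar>B.blowup (1 / real (Suc k)) z\<bar> \<le> B"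
      if "z \<in> cball 0 1" for k z
      using A.blowup_bounded[OF _ that, of "1 / real (Suc k)"] B.blowup_bounded[OF _ that, of "1 / real (Suc k)"]
      by (auto simp: B_def)
    show "C2 (\<lambda>z. N * ((M *v z) \<bullet> (M *v z))) (\<lambda>z. N *\<^sub>R 2 *\<^sub>R (transpose M *v (M *v z))) (\<lambda>z. N *\<^sub>R 2 *\<^sub>R (transpose M ** M))"
      by (rule C2_cmult[OF C2_quadratic])
    show "trace (N *\<^sub>R 2 *\<^sub>R (transpose M ** M)) = 2 * (N * (norm M)\<^sup>2)"
      by (simp add: trace_scaleR trace_transpose_mult_self)
    show "A.blowup (1 / real (Suc k)) z + B.blowup (1 / real (Suc k)) z \<le> N * ((M *v z) \<bullet> (M *v z))" for k z
      by (rule sum_le) simp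
  qed (auto simp: A.blowup_0 B.blowup_0)
  then show ?thesis by (simp add: M_def)
qed

section \<open>The Hamiltonian\<close>

text \<open>Infima and suprema of reals are meaningful only for bounded families, hence the two
  bounds. The affine form is there to absorb the different factors exp (- t) and exp (- s) at two
  times.\<close>

lemma INF_SUP_affine_mono:
  fixes F F' :: "'a \<Rightarrow> 'b \<Rightarrow> real"
  assumes ne: "A \<noteq> {}" "B \<noteq> {}" and c: "c > 0"
    and bF: "\<And>a b. a \<in> A \<Longrightarrow> b \<in> B \<Longrightarrow> \<bar>F a b\<bar> \<le> M"
    and bF': "\<And>a b. a \<in> A \<Longrightarrow> b \<in> B \<Longrightarrow> \<bar>F' a b\<bar> \<le> M'"
    and le: "\<And>a b. a \<in> A \<Longrightarrow> b \<in> B \<Longrightarrow> F a b \<le> c * F' a b + d"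
  shows "(INF a\<in>A. SUP b\<in>B. F a b) \<le> c * (INF a\<in>A. SUP b\<in>B. F' a b) + d"
proof -
  obtain b\<^sub>0 where b\<^sub>0: "b\<^sub>0 \<in> B" using ne by blast
  have bdd: "bdd_above (F a ` B)" "bdd_above (F' a ` B)" if "a \<in> A" for a
    using bF[OF that] bF'[OF that] by (auto simp: abs_le_iff intro!: bdd_aboveI)
  have lower: "bdd_below ((\<lambda>a. SUP b\<in>B. F a b) ` A)"
  proof (rule bdd_belowI2)
    fix a assume a: "a \<in> A"
    show "- M \<le> (SUP b\<in>B. F a b)"
      using cSUP_upper[OF b\<^sub>0 bdd(1)[OF a]] bF[OF a b\<^sub>0] by linarith
  qed
  have "((INF a\<in>A. SUP b\<in>B. F a b) - d) / c \<le> (INF a\<in>A. SUP b\<in>B. F' a b)"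
  proof (rule cINF_greatest[OF ne(1)])
    fix a assume a: "a \<in> A"
    have "(INF a\<in>A. SUP b\<in>B. F a b) \<le> (SUP b\<in>B. F a b)"
      by (rule cINF_lower[OF lower a])
    also have "\<dots> \<le> c * (SUP b\<in>B. F' a b) + d"
    proof (rule cSUP_least[OF ne(2)])
      fix b assume b: "b \<in> B"
      have "c * F' a b \<le> c * (SUP b\<in>B. F' a b)"
        using c cSUP_upper[OF b bdd(2)[OF a]] by simp
      then show "F a b \<le> c * (SUP b\<in>B. F' a b) + d"
        using le[OF a b] by linarith
    qed
    finally show "((INF a\<in>A. SUP b\<in>B. F a b) - d) / c \<le> (SUP b\<in>B. F' a b)"
      using c by (simp add: pos_divide_le_eq mult.commute)
  qed
  then show ?thesis
    using c by (simp add: pos_divide_le_eq mult.commute)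
qed

lemma uniform_on_controls:
  fixes F :: "real \<Rightarrow> 'x::metric_space \<Rightarrow> 'a::metric_space \<Rightarrow> 'b::metric_space \<Rightarrow> 'c::metric_space"
  assumes cont: "continuous_on ({0..T} \<times> X \<times> A \<times> B) (\<lambda>(t, x, a, b). F t x a b)"
    and compact: "compact X" "compact A" "compact B" and "e > 0"
  obtains \<delta> where "\<delta> > 0" "\<And>t s x y a b. t \<in> {0..T} \<Longrightarrow> s \<in> {0..T} \<Longrightarrow> x \<in> X \<Longrightarrow> y \<in> X \<Longrightarrow> a \<in> A \<Longrightarrow> b \<in> B \<Longrightarrow>
    \<bar>t - s\<bar> < \<delta> \<Longrightarrow> dist x y < \<delta> \<Longrightarrow> dist (F t x a b) (F s y a b) < e"
proof -
  have "uniformly_continuous_on ({0..T} \<times> X \<times> A \<times> B) (\<lambda>(t, x, a, b). F t x a b)"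
    by (intro compact_uniformly_continuous[OF cont] compact_Times compact) auto
  then obtain \<delta> where \<delta>: "\<delta> > 0" "\<And>u u'. u \<in> {0..T} \<times> X \<times> A \<times> B \<Longrightarrow> u' \<in> {0..T} \<times> X \<times> A \<times> B \<Longrightarrow>
      dist u' u < \<delta> \<Longrightarrow> dist ((\<lambda>(t, x, a, b). F t x a b) u') ((\<lambda>(t, x, a, b). F t x a b) u) < e"
    using \<open>e > 0\<close> unfolding uniformly_continuous_on_def by metis
  show ?thesis
  proof (rule that[of "\<delta> / 2"])
    fix t s x y a b
    assume *: "t \<in> {0..T}" "s \<in> {0..T}" "x \<in> X" "y \<in> X" "a \<in> A" "b \<in> B" "\<bar>t - s\<bar> < \<delta> / 2" "dist x y < \<delta> / 2"
    have "dist (t, x, a, b) (s, y, a, b) \<le> \<bar>t - s\<bar> + dist x y"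
      using sqrt_sum_squares_le_sum_abs[of "t - s" "dist x y"] by (simp add: dist_Pair_Pair dist_real_def)
    then have "dist (t, x, a, b) (s, y, a, b) < \<delta>"
      using * by linarith
    then show "dist (F t x a b) (F s y a b) < e"
      using \<delta>(2)[of "(s, y, a, b)" "(t, x, a, b)"] * by auto
  qed (use \<delta> in auto)
qed

lemma uniform_on_cball:
  fixes F :: "real \<Rightarrow> 'x::{heine_borel,real_normed_vector} \<Rightarrow> 'c::metric_space"
  assumes cont: "continuous_on ({0..T} \<times> UNIV) (\<lambda>(t, x). F t x)" and "e > 0"
  obtains \<delta> where "\<delta> > 0" "\<And>t s x y. t \<in> {0..T} \<Longrightarrow> s \<in> {0..T} \<Longrightarrow> x \<in> cball 0 R \<Longrightarrow> y \<in> cball 0 R \<Longrightarrow>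
    \<bar>t - s\<bar> < \<delta> \<Longrightarrow> dist x y < \<delta> \<Longrightarrow> dist (F t x) (F s y) < e"
proof -
  \<comment> \<open>One-point control sets reduce the claim to
    \<open>uniform_on_controls\<close>.\<close>
  have "continuous_on ({0..T} \<times> cball 0 R \<times> {0} \<times> {0}) ((\<lambda>(t, x). F t x) \<circ> (\<lambda>(t, x, a :: real, b :: real). (t, x)))"
    by (intro continuous_on_compose continuous_on_subset[OF cont])
      (auto intro!: continuous_intros simp: split_beta)
  then have "continuous_on ({0..T} \<times> cball 0 R \<times> {0} \<times> {0}) (\<lambda>(t, x, a :: real, b :: real). F t x)"
    by (simp add: o_def split_beta)
  then show ?thesis
    by (rule uniform_on_controls[where e = e]) (use \<open>e > 0\<close> that in auto)
qed

lemma continuous_on_pos_near: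
  fixes F :: "real \<Rightarrow> 'x::metric_space \<Rightarrow> real"
  assumes "continuous_on D (\<lambda>(t, x). F t x)" "(t\<^sub>0, x\<^sub>0) \<in> D" "F t\<^sub>0 x\<^sub>0 > 0"
  obtains d where "d > 0" "\<And>t x. (t, x) \<in> D \<Longrightarrow> dist (t, x) (t\<^sub>0, x\<^sub>0) < d \<Longrightarrow> F t x > 0"
proof -
  obtain d where d: "d > 0" "\<And>u. u \<in> D \<Longrightarrow> dist u (t\<^sub>0, x\<^sub>0) < d \<Longrightarrow> dist ((\<lambda>(t, x). F t x) u) (F t\<^sub>0 x\<^sub>0) < F t\<^sub>0 x\<^sub>0"
    using assms unfolding continuous_on_iff by fastforce
  show ?thesis
  proof (rule that[OF d(1)])
    fix t x assume "(t, x) \<in> D" "dist (t, x) (t\<^sub>0, x\<^sub>0) < d"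
    then have "dist (F t x) (F t\<^sub>0 x\<^sub>0) < F t\<^sub>0 x\<^sub>0" using d(2)[of "(t, x)"] by simp
    then show "F t x > 0" by (simp add: dist_real_def abs_if split: if_splits)
  qed
qed

text \<open>Constants that the theorem quantifies existentially become parameters here. The bound on
  \<sigma> is stated for \<sigma> \<sigma>^T, the matrix that enters the diffusion.\<close>

locale qvi_problem =
  fixes T :: real and A :: "'a::metric_space set" and B :: "'b::metric_space set"
    and \<sigma> :: "real \<Rightarrow> real ^ 'n \<Rightarrow> real ^ 'n ^ 'n"
    and f :: "real \<Rightarrow> real ^ 'n \<Rightarrow> 'a \<Rightarrow> 'b \<Rightarrow> real ^ 'n"
    and \<Gamma> :: "real \<Rightarrow> real ^ 'n \<Rightarrow> 'a \<Rightarrow> 'b \<Rightarrow> real"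
    and h h' :: "real \<Rightarrow> real ^ 'n \<Rightarrow> real" and g :: "real ^ 'n \<Rightarrow> real"
    and M\<^sub>\<sigma> L\<^sub>\<sigma> L\<^sub>f C\<^sub>f :: real
  assumes T_pos: "0 < T"
    and A: "compact A" "A \<noteq> {}" and B: "compact B" "B \<noteq> {}"
    and \<sigma>_bounded: "\<And>t x. t \<in> {0..T} \<Longrightarrow> norm (\<sigma> t x ** transpose (\<sigma> t x)) \<le> M\<^sub>\<sigma>"
    and \<sigma>_continuous: "continuous_on ({0..T} \<times> UNIV) (\<lambda>(t, x). \<sigma> t x)"
    and \<sigma>_lipschitz: "\<And>t x y. t \<in> {0..T} \<Longrightarrow> norm (\<sigma> t x - \<sigma> t y) \<le> L\<^sub>\<sigma> * norm (x - y)"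
    and \<sigma>_invertible: "\<And>t x. t \<in> {0..T} \<Longrightarrow> invertible (\<sigma> t x)"
    and h_continuous: "continuous_on ({0..T} \<times> UNIV) (\<lambda>(t, x). h t x)"
    and h'_continuous: "continuous_on ({0..T} \<times> UNIV) (\<lambda>(t, x). h' t x)"
    and \<Gamma>_continuous: "continuous_on ({0..T} \<times> UNIV \<times> A \<times> B) (\<lambda>(t, x, a, b). \<Gamma> t x a b)"
    and f_continuous: "continuous_on ({0..T} \<times> UNIV \<times> A \<times> B) (\<lambda>(t, x, a, b). f t x a b)"
    and f_lipschitz: "\<And>t x y a b. t \<in> {0..T} \<Longrightarrow> a \<in> A \<Longrightarrow> b \<in> B \<Longrightarrow>
      norm (f t x a b - f t y a b) \<le> L\<^sub>f * norm (x - y)"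
    and f_growth: "\<And>t x a b. t \<in> {0..T} \<Longrightarrow> a \<in> A \<Longrightarrow> b \<in> B \<Longrightarrow> norm (f t x a b) \<le> C\<^sub>f * (1 + norm x)"
    and constants_nonneg: "0 \<le> M\<^sub>\<sigma>" "0 \<le> L\<^sub>\<sigma>" "0 \<le> L\<^sub>f" "0 \<le> C\<^sub>f"
begin

text \<open>This is e^t times the Hamiltonian at the row vector e^(-t) \<pi> \<sigma>. After the
  cancellation of \<sigma> only f itself remains, so the Lipschitz bound of f in x applies
  directly.\<close>

definition J :: "real \<Rightarrow> real ^ 'n \<Rightarrow> real ^ 'n \<Rightarrow> 'a \<Rightarrow> 'b \<Rightarrow> real"
  where "J t x \<pi> a b = \<pi> \<bullet> f t x a b + exp t * \<Gamma> t x a b"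

text \<open>\<open>e\<^sup>t H\<^sup>*\<close> as a function of the gradient of the test function; the matrix \<open>\<sigma>\<close> cancels.\<close>

definition Ham :: "real \<Rightarrow> real ^ 'n \<Rightarrow> real ^ 'n \<Rightarrow> real"
  where "Ham t x \<pi> = exp t * upper_hamiltonian A B \<sigma> f \<Gamma> t x ((exp (- t) *\<^sub>R \<pi>) v* \<sigma> t x)"

lemma Ham_eq:
  assumes "t \<in> {0..T}"
  shows "Ham t x \<pi> = exp t * (INF a\<in>A. SUP b\<in>B. exp (- t) * J t x \<pi> a b)"
proof -
  have "hamiltonian \<sigma> f \<Gamma> t x ((exp (- t) *\<^sub>R \<pi>) v* \<sigma> t x) a b = exp (- t) * J t x \<pi> a b" for a b
    using invertible_matrix_inv(1)[OF \<sigma>_invertible[OF assms, of x]]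
    by (simp add: hamiltonian_def J_def vector_matrix_mul_assoc distrib_left exp_minus)
  then show ?thesis by (simp add: Ham_def upper_hamiltonian_def)
qed

lemma J_continuous:
  "continuous_on ({0..T} \<times> UNIV \<times> A \<times> B) (\<lambda>(t, x\<pi>, a, b). J t (fst x\<pi>) (snd x\<pi>) a b)"
proof -
  have 1: "continuous_on ({0..T} \<times> UNIV \<times> A \<times> B) ((\<lambda>(t, x, a, b). f t x a b) \<circ>
      (\<lambda>(t, x\<pi> :: (real ^ 'n) \<times> (real ^ 'n), a, b). (t, fst x\<pi>, a, b)))"
    by (intro continuous_on_compose continuous_on_subset[OF f_continuous])
      (auto intro!: continuous_intros simp: split_beta)
  have 2: "continuous_on ({0..T} \<times> UNIV \<times> A \<times> B) ((\<lambda>(t, x, a, b). \<Gamma> t x a b) \<circ>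
      (\<lambda>(t, x\<pi> :: (real ^ 'n) \<times> (real ^ 'n), a, b). (t, fst x\<pi>, a, b)))"
    by (intro continuous_on_compose continuous_on_subset[OF \<Gamma>_continuous])
      (auto intro!: continuous_intros simp: split_beta)
  show ?thesis
    using 1 2 unfolding J_def split_beta o_def by (auto intro!: continuous_intros)
qed

lemma J_bounded:
  assumes "t \<in> {0..T}"
  obtains M where "\<And>a b. a \<in> A \<Longrightarrow> b \<in> B \<Longrightarrow> \<bar>J t x \<pi> a b\<bar> \<le> M"
proof -
  have "continuous_on (A \<times> B) ((\<lambda>(t, x\<pi>, a, b). J t (fst x\<pi>) (snd x\<pi>) a b) \<circ> (\<lambda>(a, b). (t, (x, \<pi>), a, b)))"
    by (intro continuous_on_compose continuous_on_subset[OF J_continuous])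
      (use assms in \<open>auto intro!: continuous_intros simp: split_beta\<close>)
  then have "compact ((\<lambda>(a, b). J t x \<pi> a b) ` (A \<times> B))"
    by (intro compact_continuous_image compact_Times A B) (simp add: o_def split_beta)
  then obtain M where "\<forall>y\<in>(\<lambda>(a, b). J t x \<pi> a b) ` (A \<times> B). norm y \<le> M"
    using compact_imp_bounded bounded_iff by metis
  then have "\<bar>J t x \<pi> a b\<bar> \<le> M" if "a \<in> A" "b \<in> B" for a b
    using that by auto
  then show ?thesis using that by blast
qed

text \<open>A bound on \<open>J\<close> that is uniform in the controls survives the inf-sup. The
  factor exp (s - t) reconciles the normalizations at the two times.\<close>

lemma Ham_le:
  assumes ts: "t \<in> {0..T}" "s \<in> {0..T}"
    and le: "\<And>a b. a \<in> A \<Longrightarrow> b \<in> B \<Longrightarrow> J t x \<pi> a b \<le> J s y \<xi> a b + e"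
  shows "Ham t x \<pi> \<le> Ham s y \<xi> + e"
proof -
  obtain M M' where M: "\<And>a b. a \<in> A \<Longrightarrow> b \<in> B \<Longrightarrow> \<bar>J t x \<pi> a b\<bar> \<le> M"
    "\<And>a b. a \<in> A \<Longrightarrow> b \<in> B \<Longrightarrow> \<bar>J s y \<xi> a b\<bar> \<le> M'"
    using J_bounded[OF ts(1), of x \<pi>] J_bounded[OF ts(2), of y \<xi>] by metis
  have "(INF a\<in>A. SUP b\<in>B. exp (- t) * J t x \<pi> a b)
      \<le> exp (s - t) * (INF a\<in>A. SUP b\<in>B. exp (- s) * J s y \<xi> a b) + exp (- t) * e"
  proof (rule INF_SUP_affine_mono[OF A(2) B(2)])
    fix a b assume ab: "a \<in> A" "b \<in> B"
    show "\<bar>exp (- t) * J t x \<pi> a b\<bar> \<le> exp (- t) * M" "\<bar>exp (- s) * J s y \<xi> a b\<bar> \<le> exp (- s) * M'"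
      using M ab by (auto simp: abs_mult)
    have "exp (- t) * J t x \<pi> a b \<le> exp (- t) * (J s y \<xi> a b + e)"
      using le[OF ab] by simp
    also have "\<dots> = exp (s - t) * (exp (- s) * J s y \<xi> a b) + exp (- t) * e"
      by (simp add: distrib_left flip: mult.assoc exp_add)
    finally show "exp (- t) * J t x \<pi> a b \<le> exp (s - t) * (exp (- s) * J s y \<xi> a b) + exp (- t) * e" .
  qed simp
  then have "exp t * (INF a\<in>A. SUP b\<in>B. exp (- t) * J t x \<pi> a b)
      \<le> exp t * (exp (s - t) * (INF a\<in>A. SUP b\<in>B. exp (- s) * J s y \<xi> a b) + exp (- t) * e)"
    by (rule mult_left_mono) simp
  also have "\<dots> = Ham s y \<xi> + e"
    unfolding Ham_eq[OF ts(2)] by (simp add: distrib_left flip: mult.assoc exp_add)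
  finally show ?thesis
    unfolding Ham_eq[OF ts(1)] .
qed

text \<open>The growth of f makes the Lipschitz constant in the gradient linear in |x|, which
  dictates the weight 1 + |x| in the penalty estimates.\<close>

lemma Ham_gradient:
  assumes "t \<in> {0..T}"
  shows "\<bar>Ham t x \<pi> - Ham t x \<xi>\<bar> \<le> C\<^sub>f * (1 + norm x) * norm (\<pi> - \<xi>)"
proof -
  have *: "\<bar>J t x \<pi> a b - J t x \<xi> a b\<bar> \<le> C\<^sub>f * (1 + norm x) * norm (\<pi> - \<xi>)" if "a \<in> A" "b \<in> B" for a b
  proof -
    have "\<bar>J t x \<pi> a b - J t x \<xi> a b\<bar> = \<bar>(\<pi> - \<xi>) \<bullet> f t x a b\<bar>"
      by (simp add: J_def inner_diff_left)
    also have "\<dots> \<le> norm (\<pi> - \<xi>) * norm (f t x a b)"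
      by (rule Cauchy_Schwarz_ineq2)
    also have "\<dots> \<le> norm (\<pi> - \<xi>) * (C\<^sub>f * (1 + norm x))"
      using f_growth[OF assms that] by (intro mult_left_mono) auto
    finally show ?thesis by (simp add: mult_ac)
  qed
  have "Ham t x \<pi> \<le> Ham t x \<xi> + C\<^sub>f * (1 + norm x) * norm (\<pi> - \<xi>)"
    "Ham t x \<xi> \<le> Ham t x \<pi> + C\<^sub>f * (1 + norm x) * norm (\<pi> - \<xi>)"
    by (rule Ham_le[OF assms assms], drule (1) *, linarith)+
  then show ?thesis by linarith
qed

lemma Ham_continuous: "continuous_on ({0..T} \<times> UNIV \<times> UNIV) (\<lambda>(t, x, \<pi>). Ham t x \<pi>)"
  unfolding continuous_on_iff
proof (intro ballI allI impI)
  fix u :: "real \<times> (real ^ 'n) \<times> (real ^ 'n)" and e :: real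
  assume u: "u \<in> {0..T} \<times> UNIV \<times> UNIV" and "e > 0"
  obtain t x \<pi> where u_eq: "u = (t, x, \<pi>)" by (cases u)
  have t: "t \<in> {0..T}" using u u_eq by simp
  \<comment> \<open>The variables x and \<pi> are merged into one, so that
    \<open>uniform_on_controls\<close> applies on a single compact ball.\<close>
  have J': "continuous_on ({0..T} \<times> cball (x, \<pi>) 1 \<times> A \<times> B) (\<lambda>(t, x\<pi>, a, b). J t (fst x\<pi>) (snd x\<pi>) a b)"
    by (rule continuous_on_subset[OF J_continuous]) auto
  obtain \<delta> where \<delta>: "\<delta> > 0" "\<And>t s z z' a b. t \<in> {0..T} \<Longrightarrow> s \<in> {0..T} \<Longrightarrow> z \<in> cball (x, \<pi>) 1 \<Longrightarrow> z' \<in> cball (x, \<pi>) 1 \<Longrightarrow>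
      a \<in> A \<Longrightarrow> b \<in> B \<Longrightarrow> \<bar>t - s\<bar> < \<delta> \<Longrightarrow> dist z z' < \<delta> \<Longrightarrow>
      dist (J t (fst z) (snd z) a b) (J s (fst z') (snd z') a b) < e / 2"
    by (rule uniform_on_controls[OF J' compact_cball A(1) B(1), of "e / 2"])
      (use \<open>e > 0\<close> that in auto)
  show "\<exists>d>0. \<forall>u'\<in>{0..T} \<times> UNIV \<times> UNIV. dist u' u < d \<longrightarrow>
      dist ((\<lambda>(t, x, \<pi>). Ham t x \<pi>) u') ((\<lambda>(t, x, \<pi>). Ham t x \<pi>) u) < e"
  proof (intro exI[of _ "min \<delta> 1"] conjI ballI impI)
    fix u' :: "real \<times> (real ^ 'n) \<times> (real ^ 'n)"
    assume u': "u' \<in> {0..T} \<times> UNIV \<times> UNIV" and d: "dist u' u < min \<delta> 1"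
    obtain s y \<xi> where u'_eq: "u' = (s, y, \<xi>)" by (cases u')
    have s: "s \<in> {0..T}" using u' u'_eq by simp
    have d1: "\<bar>s - t\<bar> < \<delta>" and d2: "dist (y, \<xi>) (x, \<pi>) < min \<delta> 1"
      using d dist_fst_le[of u' u] dist_snd_le[of u' u] by (auto simp: u_eq u'_eq dist_real_def)
    have "dist (J s y \<xi> a b) (J t x \<pi> a b) < e / 2" if "a \<in> A" "b \<in> B" for a b
      using \<delta>(2)[OF s t, of "(y, \<xi>)" "(x, \<pi>)" a b] d1 d2 that by (auto simp: dist_commute)
    then have "Ham s y \<xi> \<le> Ham t x \<pi> + e / 2" "Ham t x \<pi> \<le> Ham s y \<xi> + e / 2"
      by (intro Ham_le s t; fastforce simp: dist_real_def abs_if split: if_splits)+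
    then show "dist ((\<lambda>(t, x, \<pi>). Ham t x \<pi>) u') ((\<lambda>(t, x, \<pi>). Ham t x \<pi>) u) < e"
      using \<open>e > 0\<close> by (simp add: u_eq u'_eq dist_real_def abs_if)
  qed (use \<delta> in auto)
qed

lemma diffusion_op_inner: "diffusion_op \<sigma> t x X = 1 / 2 * ((\<sigma> t x ** transpose (\<sigma> t x)) \<bullet> X)"
  by (simp add: diffusion_op_def inner_vec_def)

lemma diffusion_op_le:
  assumes "t \<in> {0..T}"
  shows "diffusion_op \<sigma> t x X \<le> M\<^sub>\<sigma> * norm X"
proof -
  have "(\<sigma> t x ** transpose (\<sigma> t x)) \<bullet> X \<le> M\<^sub>\<sigma> * norm X"
    using norm_cauchy_schwarz[of "\<sigma> t x ** transpose (\<sigma> t x)" X]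
      mult_right_mono[OF \<sigma>_bounded[OF assms, of x], of "norm X"] by simp
  moreover have "0 \<le> M\<^sub>\<sigma> * norm X" using constants_nonneg by simp
  ultimately show ?thesis by (simp add: diffusion_op_inner)
qed

end

section \<open>Penalization at infinity\<close>

lemma norm_outer: "norm (outer a b) = norm a * norm b"
proof -
  have "outer a b \<bullet> outer a b = (a \<bullet> a) * (b \<bullet> b)"
    by (simp add: outer_def inner_vec_def sum_product mult_ac)
  then show ?thesis
    by (simp add: norm_eq_sqrt_inner real_sqrt_mult)
qed

text \<open>The decay in t contributes \<mu> times the penalty to minus its time derivative, which
  pays for all other terms. The exponent m + 2 beats functions of growth order m, and two
  differentiations in space still leave natural powers.\<close>

definition penalty :: "real \<Rightarrow> nat \<Rightarrow> real \<Rightarrow> real ^ 'n \<Rightarrow> real"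
  where "penalty \<mu> m t x = exp (- \<mu> * t) * (1 + x \<bullet> x) ^ Suc (Suc m)"

definition penalty_x :: "real \<Rightarrow> nat \<Rightarrow> real \<Rightarrow> real ^ 'n \<Rightarrow> real ^ 'n"
  where "penalty_x \<mu> m t x = (exp (- \<mu> * t) * (2 * (real m + 2) * (1 + x \<bullet> x) ^ Suc m)) *\<^sub>R x"

definition penalty_xx :: "real \<Rightarrow> nat \<Rightarrow> real \<Rightarrow> real ^ 'n \<Rightarrow> real ^ 'n ^ 'n"
  where "penalty_xx \<mu> m t x = exp (- \<mu> * t) *\<^sub>R ((2 * (real m + 2) * (1 + x \<bullet> x) ^ Suc m) *\<^sub>R mat 1
    + (4 * (real m + 2) * (real m + 1) * (1 + x \<bullet> x) ^ m) *\<^sub>R outer x x)"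

lemma penalty_C12:
  "C12 T (penalty \<mu> m :: real \<Rightarrow> real ^ 'n \<Rightarrow> real) (\<lambda>t x. - \<mu> * penalty \<mu> m t x) (penalty_x \<mu> m) (penalty_xx \<mu> m)"
  unfolding C12_def
proof (intro conjI ballI allI)
  fix t and x :: "real ^ 'n"
  show "((\<lambda>s. penalty \<mu> m s x) has_real_derivative - \<mu> * penalty \<mu> m t x) (at t within {0..T})"
    unfolding penalty_def by (auto intro!: derivative_eq_intros)
  have D: "((\<lambda>x. (1 + x \<bullet> x) ^ Suc k) has_derivative (\<lambda>v. 2 * real (Suc k) * (1 + x \<bullet> x) ^ k * (v \<bullet> x))) (at x)" for k and x :: "real ^ 'n"
    by (rule derivative_eq_intros refl)+ (auto simp: inner_commute algebra_simps)
  have "((\<lambda>x. exp (- \<mu> * t) * (1 + x \<bullet> x) ^ Suc (Suc m)) has_derivative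
      (\<lambda>v. exp (- \<mu> * t) * (2 * real (Suc (Suc m)) * (1 + x \<bullet> x) ^ Suc m * (v \<bullet> x)))) (at x)"
    by (rule has_derivative_mult_right[OF D])
  then show "GDERIV (penalty \<mu> m t) x :> penalty_x \<mu> m t x"
    unfolding gderiv_def penalty_def penalty_x_def by (simp add: mult_ac add_ac)
  have "((\<lambda>x. (exp (- \<mu> * t) * (2 * (real m + 2) * (1 + x \<bullet> x) ^ Suc m)) *\<^sub>R x) has_derivative
      (\<lambda>v. (exp (- \<mu> * t) * (2 * (real m + 2) * (1 + x \<bullet> x) ^ Suc m)) *\<^sub>R v
        + (exp (- \<mu> * t) * (2 * (real m + 2) * (2 * real (Suc m) * (1 + x \<bullet> x) ^ m * (v \<bullet> x)))) *\<^sub>R x)) (at x)"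
    by (intro has_derivative_scaleR has_derivative_mult_right D has_derivative_ident)
  moreover have "(exp (- \<mu> * t) * (2 * (real m + 2) * (1 + x \<bullet> x) ^ Suc m)) *\<^sub>R v
        + (exp (- \<mu> * t) * (2 * (real m + 2) * (2 * real (Suc m) * (1 + x \<bullet> x) ^ m * (v \<bullet> x)))) *\<^sub>R x
      = penalty_xx \<mu> m t x *v v" for v
    by (simp add: penalty_xx_def scaleR_matrix_vector_assoc[symmetric] matrix_vector_mult_add_rdistrib outer_mult_vec
        scaleR_add_right inner_commute del: power_Suc) (simp add: algebra_simps)
  ultimately show "(penalty_x \<mu> m t has_derivative (\<lambda>v. penalty_xx \<mu> m t x *v v)) (at x)"
    unfolding penalty_x_def by simp
next
  show "continuous_on ({0..T} \<times> UNIV) (\<lambda>(t, x :: real ^ 'n). penalty \<mu> m t x)"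
    "continuous_on ({0..T} \<times> UNIV) (\<lambda>(t, x :: real ^ 'n). - \<mu> * penalty \<mu> m t x)"
    "continuous_on ({0..T} \<times> UNIV) (\<lambda>(t, x :: real ^ 'n). penalty_x \<mu> m t x)"
    "continuous_on ({0..T} \<times> UNIV) (\<lambda>(t, x :: real ^ 'n). penalty_xx \<mu> m t x)"
    unfolding penalty_def penalty_x_def penalty_xx_def split_beta by (intro continuous_intros)+
qed

lemma penalty_pos: "penalty \<mu> m t x > 0"
  unfolding penalty_def by (intro mult_pos_pos zero_less_power) (auto intro: add_pos_nonneg)

text \<open>One derivative lowers the order in |x| by one, which compensates the weight: (1 + |x|)
  |x| is at most 2 (1 + |x|^2).\<close>

lemma penalty_x_le: "(1 + norm x) * norm (penalty_x \<mu> m t x) \<le> 4 * (real m + 2) * penalty \<mu> m t x"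
proof -
  define Y where "Y = 1 + x \<bullet> x"
  have Y: "Y = 1 + (norm x)\<^sup>2" by (simp add: Y_def dot_square_norm)
  have "(1 + norm x) * norm x \<le> 2 * Y"
  proof -
    have "2 * (1 + (norm x)\<^sup>2) - (1 + norm x) * norm x = (norm x - 1 / 2)\<^sup>2 + 7 / 4"
      by (simp add: power2_eq_square algebra_simps)
    also have "\<dots> \<ge> 0"
      by simp
    finally show ?thesis unfolding Y by simp
  qed
  then have "exp (- \<mu> * t) * (2 * (real m + 2) * Y ^ Suc m) * ((1 + norm x) * norm x)
      \<le> exp (- \<mu> * t) * (2 * (real m + 2) * Y ^ Suc m) * (2 * Y)"
    by (intro mult_left_mono mult_nonneg_nonneg) (auto simp: Y)
  moreover have "norm (penalty_x \<mu> m t x) = exp (- \<mu> * t) * (2 * (real m + 2) * Y ^ Suc m) * norm x"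
    by (simp add: penalty_x_def Y_def[symmetric] Y abs_mult)
  ultimately show ?thesis
    by (simp add: penalty_def Y_def[symmetric] algebra_simps)
qed

lemma norm_mat_1: "norm (mat 1 :: real ^ 'n ^ 'n) \<le> real CARD('n)"
proof -
  have "(mat 1 :: real ^ 'n ^ 'n) \<bullet> mat 1 = real CARD('n)"
    by (simp add: inner_vec_def mat_def if_distrib if_distribR cong: if_cong)
  then have "norm (mat 1 :: real ^ 'n ^ 'n) = sqrt (real CARD('n))"
    by (simp add: norm_eq_sqrt_inner)
  also have "\<dots> \<le> real CARD('n)"
    by (rule real_le_lsqrt) (auto simp: power2_eq_square)
  finally show ?thesis .
qed

lemma penalty_xx_le:
  fixes x :: "real ^ 'n"
  shows "norm (penalty_xx \<mu> m t x) \<le> (2 * (real m + 2) * real CARD('n) + 4 * (real m + 2) * (real m + 1)) * penalty \<mu> m t x"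
proof -
  define Y where "Y = 1 + x \<bullet> x"
  have Y: "Y \<ge> 1" by (simp add: Y_def)
  define E where "E = exp (- \<mu> * t)"
  have "E > 0" by (simp add: E_def)
  have "norm (penalty_xx \<mu> m t x) \<le> E * (2 * (real m + 2) * Y ^ Suc m * norm (mat 1 :: real ^ 'n ^ 'n)
      + 4 * (real m + 2) * (real m + 1) * Y ^ m * (norm x * norm x))"
    unfolding penalty_xx_def Y_def[symmetric] E_def[symmetric] norm_scaleR
    using \<open>E > 0\<close> Y by (intro mult_mono order_trans[OF norm_triangle_ineq]) (auto simp: norm_outer)
  also have "\<dots> \<le> E * (2 * (real m + 2) * Y ^ Suc (Suc m) * real CARD('n)
      + 4 * (real m + 2) * (real m + 1) * Y ^ Suc m * Y)"
  proof (intro mult_left_mono add_mono mult_mono)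
    show "norm x * norm x \<le> Y" by (simp add: Y_def dot_square_norm power2_eq_square)
    show "Y ^ Suc m \<le> Y ^ Suc (Suc m)" "Y ^ m \<le> Y ^ Suc m"
      using Y by (auto intro!: power_increasing)
  qed (use norm_mat_1 \<open>E > 0\<close> Y in auto)
  finally show ?thesis
    unfolding penalty_def Y_def[symmetric] E_def[symmetric] by (simp add: algebra_simps)
qed

context qvi_problem
begin

text \<open>Boundedness of \<sigma> \<sigma>^T and linear growth of f bound both terms by multiples
  of the penalty itself, with constants that do not depend on \<mu>; their sum is taken as
  \<mu>.\<close>

lemma penalty_supersolution:
  obtains \<mu> where "\<mu> \<ge> 0" "\<And>t x. t \<in> {0..T} \<Longrightarrow>
    diffusion_op \<sigma> t x (penalty_xx \<mu> m t x) + C\<^sub>f * (1 + norm x) * norm (penalty_x \<mu> m t x) \<le> \<mu> * penalty \<mu> m t x"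
proof -
  define a\<^sub>1 where "a\<^sub>1 = 2 * (real m + 2) * real CARD('n) + 4 * (real m + 2) * (real m + 1)"
  define a\<^sub>2 where "a\<^sub>2 = 4 * (real m + 2)"
  define \<mu> where "\<mu> = M\<^sub>\<sigma> * a\<^sub>1 + C\<^sub>f * a\<^sub>2"
  show ?thesis
  proof (rule that[of \<mu>])
    show "\<mu> \<ge> 0" using constants_nonneg by (simp add: \<mu>_def a\<^sub>1_def a\<^sub>2_def)
    fix t and x :: "real ^ 'n" assume t: "t \<in> {0..T}"
    have "diffusion_op \<sigma> t x (penalty_xx \<mu> m t x) \<le> M\<^sub>\<sigma> * norm (penalty_xx \<mu> m t x)"
      by (rule diffusion_op_le[OF t])
    also have "\<dots> \<le> M\<^sub>\<sigma> * (a\<^sub>1 * penalty \<mu> m t x)"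
      unfolding a\<^sub>1_def using constants_nonneg by (intro mult_left_mono penalty_xx_le) auto
    finally have "diffusion_op \<sigma> t x (penalty_xx \<mu> m t x) \<le> M\<^sub>\<sigma> * (a\<^sub>1 * penalty \<mu> m t x)" .
    moreover have "C\<^sub>f * ((1 + norm x) * norm (penalty_x \<mu> m t x)) \<le> C\<^sub>f * (a\<^sub>2 * penalty \<mu> m t x)"
      unfolding a\<^sub>2_def using constants_nonneg by (intro mult_left_mono penalty_x_le) auto
    moreover have "\<mu> * P = M\<^sub>\<sigma> * (a\<^sub>1 * P) + C\<^sub>f * (a\<^sub>2 * P)" for P
      by (simp add: \<mu>_def algebra_simps)
    ultimately show "diffusion_op \<sigma> t x (penalty_xx \<mu> m t x) + C\<^sub>f * (1 + norm x) * norm (penalty_x \<mu> m t x)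
        \<le> \<mu> * penalty \<mu> m t x"
      by (simp add: mult.assoc)
  qed
qed

end

section \<open>Comparison\<close>

lemma C12_add:
  assumes "C12 T \<phi> \<phi>t \<phi>x \<phi>xx" "C12 T \<psi> \<psi>t \<psi>x \<psi>xx"
  shows "C12 T (\<lambda>t x. \<phi> t x + \<psi> t x) (\<lambda>t x. \<phi>t t x + \<psi>t t x) (\<lambda>t x. \<phi>x t x + \<psi>x t x) (\<lambda>t x. \<phi>xx t x + \<psi>xx t x)"
  using assms unfolding C12_def split_beta
  by (auto intro!: GDERIV_add continuous_on_add derivative_eq_intros simp: matrix_vector_mult_add_rdistrib)

lemma C12_cmult:
  assumes "C12 T \<phi> \<phi>t \<phi>x \<phi>xx"
  shows "C12 T (\<lambda>t x. c * \<phi> t x) (\<lambda>t x. c * \<phi>t t x) (\<lambda>t x. c *\<^sub>R \<phi>x t x) (\<lambda>t x. c *\<^sub>R \<phi>xx t x)"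
  using assms unfolding C12_def split_beta gderiv_def
  by (auto intro!: continuous_on_mult_left continuous_on_scaleR continuous_on_const derivative_eq_intros
      simp: scaleR_matrix_vector_assoc)

text \<open>The doubling penalties seen from one point with the other one frozen.\<close>

lemma C12_distance:
  fixes c :: "real ^ 'n"
  shows "C12 T (\<lambda>t x. N / 2 * ((x - c) \<bullet> (x - c)) + K / 2 * (t - s)\<^sup>2) (\<lambda>t x. K * (t - s)) (\<lambda>t x. N *\<^sub>R (x - c))
    (\<lambda>t x. N *\<^sub>R mat 1)"
  unfolding C12_def split_beta gderiv_def
proof (intro conjI ballI allI)
  fix t and x :: "real ^ 'n"
  show "((\<lambda>t. N / 2 * ((x - c) \<bullet> (x - c)) + K / 2 * (t - s)\<^sup>2) has_real_derivative K * (t - s)) (at t within {0..T})"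
    by (auto intro!: derivative_eq_intros)
  show "((\<lambda>x. N / 2 * ((x - c) \<bullet> (x - c)) + K / 2 * (t - s)\<^sup>2) has_derivative (\<lambda>h. h \<bullet> N *\<^sub>R (x - c))) (at x)"
    by (rule derivative_eq_intros refl)+ (auto simp: inner_commute algebra_simps)
  show "((\<lambda>x. N *\<^sub>R (x - c)) has_derivative (\<lambda>v. (N *\<^sub>R mat 1) *v v)) (at x)"
    by (rule derivative_eq_intros refl)+ (auto simp: scaleR_matrix_vector_assoc[symmetric])
qed (intro continuous_intros)+

text \<open>Outside the unit ball the powers of |x| increase with the exponent, so \<gamma> may be
  raised to a natural number. Inside, where a negative \<gamma> gives no uniform bound, compactness
  provides one.\<close>

lemma poly_growth_power_bound:
  fixes \<phi> :: "real \<Rightarrow> real ^ 'n \<Rightarrow> real"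
  assumes cont: "continuous_on ({0..T} \<times> UNIV) (\<lambda>(t, x). \<phi> t x)" and "poly_growth T \<phi>"
  obtains C and m :: nat where "C \<ge> 0" "\<And>t x. t \<in> {0..T} \<Longrightarrow> \<bar>\<phi> t x\<bar> \<le> C * (1 + x \<bullet> x) ^ m"
proof -
  obtain C \<gamma> where C: "\<And>t x. t \<in> {0..T} \<Longrightarrow> \<bar>\<phi> t x\<bar> \<le> C * (1 + norm x powr \<gamma>)"
    using assms(2) unfolding poly_growth_def by blast
  have "compact ((\<lambda>(t, x). \<phi> t x) ` ({0..T} \<times> cball 0 1))"
    by (intro compact_continuous_image compact_Times continuous_on_subset[OF cont]) auto
  then obtain D where D: "D > 0" "\<forall>y\<in>(\<lambda>(t, x). \<phi> t x) ` ({0..T} \<times> cball 0 1). norm y \<le> D"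
    using compact_imp_bounded bounded_pos by metis
  define m where "m = nat \<lceil>\<gamma>\<rceil>"
  show ?thesis
  proof (rule that[of "2 * \<bar>C\<bar> + D" m])
    show "2 * \<bar>C\<bar> + D \<ge> 0" using D by simp
    fix t and x :: "real ^ 'n" assume t: "t \<in> {0..T}"
    have Y: "1 \<le> (1 + x \<bullet> x) ^ m" by (rule one_le_power) simp
    show "\<bar>\<phi> t x\<bar> \<le> (2 * \<bar>C\<bar> + D) * (1 + x \<bullet> x) ^ m"
    proof (cases "norm x \<le> 1")
      case True
      then have "\<bar>\<phi> t x\<bar> \<le> D" using D(2) t by force
      also have "\<dots> \<le> (2 * \<bar>C\<bar> + D) * (1 + x \<bullet> x) ^ m"
        using mult_mono[of D "2 * \<bar>C\<bar> + D" 1 "(1 + x \<bullet> x) ^ m"] Y D(1) by simp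
      finally show ?thesis .
    next
      case False
      then have "norm x powr \<gamma> \<le> norm x powr real m"
        by (intro powr_mono) (auto simp: m_def, linarith)
      also have "\<dots> = norm x ^ m"
        using False by (intro powr_realpow) auto
      also have "\<dots> \<le> (1 + x \<bullet> x) ^ m"
      proof (rule power_mono)
        have "norm x \<le> (norm x)\<^sup>2" using False mult_left_mono[of 1 "norm x" "norm x"] by (simp add: power2_eq_square)
        then show "norm x \<le> 1 + x \<bullet> x" by (simp add: dot_square_norm)
      qed simp
      finally have 1: "1 + norm x powr \<gamma> \<le> 2 * (1 + x \<bullet> x) ^ m" using Y by linarith
      have "\<bar>\<phi> t x\<bar> \<le> \<bar>C\<bar> * (1 + norm x powr \<gamma>)"
        by (rule order_trans[OF C[OF t] mult_right_mono]) auto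
      also have "\<dots> \<le> \<bar>C\<bar> * (2 * (1 + x \<bullet> x) ^ m)"
        using 1 by (rule mult_left_mono) simp
      also have "\<dots> \<le> (2 * \<bar>C\<bar> + D) * (1 + x \<bullet> x) ^ m"
        using D(1) Y by (simp add: distrib_right)
      finally show ?thesis .
    qed
  qed
qed

text \<open>With Y = 1 + |x|^2, either b Y is at least C + 1 and the penalty wins, or Y is at most
  (C + 1) / b and the constant suffices. The term |x| is included so that the penalized functions
  become coercive.\<close>

lemma power_penalty_dominates:
  fixes C b :: real
  assumes "C \<ge> 0" "b > 0"
  obtains C\<^sub>1 where "C\<^sub>1 \<ge> 0" "\<And>x :: real ^ 'n. C * (1 + x \<bullet> x) ^ m + norm x \<le> C\<^sub>1 + b * (1 + x \<bullet> x) ^ Suc (Suc m)"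
proof (rule that[of "(C + 1) * ((C + 1) / b) ^ Suc m"])
  show "(C + 1) * ((C + 1) / b) ^ Suc m \<ge> 0" using assms by simp
  fix x :: "real ^ 'n"
  define Y where "Y = 1 + x \<bullet> x"
  have Y: "Y \<ge> 1" by (simp add: Y_def)
  have "2 * norm x \<le> 1 + (norm x)\<^sup>2"
    using sum_squares_bound[of 1 "norm x"] by simp
  then have "norm x \<le> Y"
    using zero_le_power2[of "norm x"] unfolding Y_def dot_square_norm by linarith
  also have "Y \<le> Y ^ Suc m"
    using power_increasing[of 1 "Suc m" Y] Y by simp
  finally have "norm x \<le> Y ^ Suc m" .
  moreover have "C * Y ^ m \<le> C * Y ^ Suc m"
    using assms Y by (intro mult_left_mono power_increasing) auto
  ultimately have 1: "C * Y ^ m + norm x \<le> (C + 1) * Y ^ Suc m"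
    by (simp add: distrib_right)
  have "(C + 1) * Y ^ Suc m \<le> (C + 1) * ((C + 1) / b) ^ Suc m + b * Y ^ Suc (Suc m)"
  proof (cases "C + 1 \<le> b * Y")
    case True
    then have "(C + 1) * Y ^ Suc m \<le> (b * Y) * Y ^ Suc m"
      using Y by (intro mult_right_mono) auto
    moreover have "(C + 1) * ((C + 1) / b) ^ Suc m \<ge> 0" using assms by simp
    ultimately show ?thesis by (simp add: mult_ac)
  next
    case False
    then have "Y \<le> (C + 1) / b"
      using assms by (simp add: pos_le_divide_eq mult.commute)
    then have "(C + 1) * Y ^ Suc m \<le> (C + 1) * ((C + 1) / b) ^ Suc m"
      using assms Y by (intro mult_left_mono power_mono) auto
    moreover have "b * Y ^ Suc (Suc m) \<ge> 0" using assms Y by simp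
    ultimately show ?thesis by linarith
  qed
  with 1 show "C * (1 + x \<bullet> x) ^ m + norm x \<le> (C + 1) * ((C + 1) / b) ^ Suc m + b * (1 + x \<bullet> x) ^ Suc (Suc m)"
    unfolding Y_def by linarith
qed

context qvi_problem
begin

text \<open>Above the lower obstacle the minimum can be nonpositive only through the maximum, and
  then both entries of the maximum are nonpositive.\<close>

lemma subsolutionD:
  assumes "viscosity_subsolution T A B \<sigma> f \<Gamma> h h' g u" "C12 T \<phi> \<phi>t \<phi>x \<phi>xx" "t \<in> {0..<T}"
    "local_max_on ({0..T} \<times> UNIV) (\<lambda>(s, y). u s y - \<phi> s y) (t, x)" "exp t * h t x < u t x"
  shows "u t x \<le> exp t * h' t x"
    "- \<phi>t t x + u t x - diffusion_op \<sigma> t x (\<phi>xx t x) - Ham t x (\<phi>x t x) \<le> 0"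
proof -
  have "qvi_op A B \<sigma> f \<Gamma> h h' t x (u t x) (\<phi>t t x) (\<phi>x t x) (\<phi>xx t x) \<le> 0"
    using assms(1-4) unfolding viscosity_subsolution_def by blast
  then have "max (- \<phi>t t x + u t x - diffusion_op \<sigma> t x (\<phi>xx t x) - Ham t x (\<phi>x t x)) (u t x - exp t * h' t x) \<le> 0"
    using assms(5) unfolding qvi_op_def Ham_def min_le_iff_disj by linarith
  then show "u t x \<le> exp t * h' t x"
    "- \<phi>t t x + u t x - diffusion_op \<sigma> t x (\<phi>xx t x) - Ham t x (\<phi>x t x) \<le> 0"
    by simp_all
qed

lemma supersolutionD:
  assumes "viscosity_supersolution T A B \<sigma> f \<Gamma> h h' g v" "C12 T \<phi> \<phi>t \<phi>x \<phi>xx" "t \<in> {0..<T}"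
    "local_min_on ({0..T} \<times> UNIV) (\<lambda>(s, y). v s y - \<phi> s y) (t, x)"
  shows "exp t * h t x \<le> v t x"
    "v t x < exp t * h' t x \<Longrightarrow> 0 \<le> - \<phi>t t x + v t x - diffusion_op \<sigma> t x (\<phi>xx t x) - Ham t x (\<phi>x t x)"
proof -
  have *: "0 \<le> qvi_op A B \<sigma> f \<Gamma> h h' t x (v t x) (\<phi>t t x) (\<phi>x t x) (\<phi>xx t x)"
    using assms unfolding viscosity_supersolution_def by blast
  then show "exp t * h t x \<le> v t x"
    unfolding qvi_op_def by simp
  have "0 \<le> max (- \<phi>t t x + v t x - diffusion_op \<sigma> t x (\<phi>xx t x) - Ham t x (\<phi>x t x)) (v t x - exp t * h' t x)"
    using * unfolding qvi_op_def Ham_def by simp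
  then show "v t x < exp t * h' t x \<Longrightarrow> 0 \<le> - \<phi>t t x + v t x - diffusion_op \<sigma> t x (\<phi>xx t x) - Ham t x (\<phi>x t x)"
    unfolding le_max_iff_disj by linarith
qed

lemma diffusion_op_add: "diffusion_op \<sigma> t x (X + c *\<^sub>R Y) = diffusion_op \<sigma> t x X + c * diffusion_op \<sigma> t x Y"
  by (simp add: diffusion_op_inner inner_add_right algebra_simps)

lemma diffusion_op_minus: "diffusion_op \<sigma> t x (- X) = - diffusion_op \<sigma> t x X"
  by (simp add: diffusion_op_inner)

lemma continuous_on_diffusion_op:
  assumes "continuous_on ({0..T} \<times> UNIV) (\<lambda>(t, x). X t x)"
  shows "continuous_on ({0..T} \<times> UNIV) (\<lambda>(t, x). diffusion_op \<sigma> t x (X t x))"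
  using assms \<sigma>_continuous
  unfolding diffusion_op_def matrix_matrix_mult_def transpose_def split_beta
  by (simp, intro continuous_intros) auto

text \<open>Time and space increments of f are separated since \<pi> will be N (x - y): the
  Lipschitz part then yields N |x - y|^2, whereas the part in time is made small once N is
  known.\<close>

lemma J_difference:
  assumes ts: "t \<in> {0..T}" "s \<in> {0..T}" and ab: "a \<in> A" "b \<in> B"
    and f: "norm (f t x a b - f s x a b) \<le> \<eta>" and \<Gamma>: "\<bar>exp t * \<Gamma> t x a b - exp s * \<Gamma> s y a b\<bar> \<le> e"
  shows "J t x \<pi> a b \<le> J s y \<pi> a b + (norm \<pi> * (\<eta> + L\<^sub>f * norm (x - y)) + e)"
proof -
  have "norm (f t x a b - f s y a b) \<le> norm (f t x a b - f s x a b) + norm (f s x a b - f s y a b)"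
    using norm_triangle_ineq[of "f t x a b - f s x a b" "f s x a b - f s y a b"] by simp
  also have "\<dots> \<le> \<eta> + L\<^sub>f * norm (x - y)"
    using f f_lipschitz[OF ts(2) ab, of x y] by linarith
  finally have "norm \<pi> * norm (f t x a b - f s y a b) \<le> norm \<pi> * (\<eta> + L\<^sub>f * norm (x - y))"
    by (rule mult_left_mono) simp
  then have "\<pi> \<bullet> (f t x a b - f s y a b) \<le> norm \<pi> * (\<eta> + L\<^sub>f * norm (x - y))"
    using norm_cauchy_schwarz[of \<pi> "f t x a b - f s y a b"] by linarith
  then show ?thesis
    using \<Gamma> by (simp add: J_def inner_diff_right)
qed

text \<open>At the doubled maximum the zero-order terms contribute u - v, which is at least
  \<theta>, while all remaining terms together amount to at most 5/8 of \<theta>.\<close>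

lemma comparison:
  assumes sub: "viscosity_subsolution T A B \<sigma> f \<Gamma> h h' g u" and u_growth: "poly_growth T u"
    and super: "viscosity_supersolution T A B \<sigma> f \<Gamma> h h' g v" and v_growth: "poly_growth T v"
    and tH: "t\<^sub>H \<in> {0..T}"
  shows "u t\<^sub>H x\<^sub>H \<le> v t\<^sub>H x\<^sub>H"
proof (rule ccontr)
  assume "\<not> u t\<^sub>H x\<^sub>H \<le> v t\<^sub>H x\<^sub>H"
  \<comment> \<open>Half of the gap; \<beta> below is such that the two penalties at this point
    consume the other half.\<close>
  define \<theta> where "\<theta> = (u t\<^sub>H x\<^sub>H - v t\<^sub>H x\<^sub>H) / 2"
  have "\<theta> > 0" using \<open>\<not> u t\<^sub>H x\<^sub>H \<le> v t\<^sub>H x\<^sub>H\<close> by (simp add: \<theta>_def)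
  have u_cont: "continuous_on ({0..T} \<times> UNIV) (\<lambda>(t, x). u t x)" and u_T: "\<And>x. u T x \<le> exp T * g x"
    using sub by (auto simp: viscosity_subsolution_def)
  have v_cont: "continuous_on ({0..T} \<times> UNIV) (\<lambda>(t, x). v t x)" and v_T: "\<And>x. exp T * g x \<le> v T x"
    using super by (auto simp: viscosity_supersolution_def)
  obtain C\<^sub>u m\<^sub>u where Cu: "C\<^sub>u \<ge> 0" "\<And>t x. t \<in> {0..T} \<Longrightarrow> \<bar>u t x\<bar> \<le> C\<^sub>u * (1 + x \<bullet> x) ^ m\<^sub>u"
    using poly_growth_power_bound[OF u_cont u_growth] by metis
  obtain C\<^sub>v m\<^sub>v where Cv: "C\<^sub>v \<ge> 0" "\<And>t x. t \<in> {0..T} \<Longrightarrow> \<bar>v t x\<bar> \<le> C\<^sub>v * (1 + x \<bullet> x) ^ m\<^sub>v"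
    using poly_growth_power_bound[OF v_cont v_growth] by metis
  define C where "C = max C\<^sub>u C\<^sub>v"
  define m where "m = max m\<^sub>u m\<^sub>v"
  have C: "C \<ge> 0" using Cu(1) by (simp add: C_def)
  have u_le: "\<bar>u t x\<bar> \<le> C * (1 + x \<bullet> x) ^ m" if "t \<in> {0..T}" for t x
  proof -
    have "C\<^sub>u * (1 + x \<bullet> x) ^ m\<^sub>u \<le> C * (1 + x \<bullet> x) ^ m"
      using C by (intro mult_mono power_increasing) (auto simp: C_def m_def)
    then show ?thesis using Cu(2)[OF that, of x] by linarith
  qed
  have v_le: "\<bar>v t x\<bar> \<le> C * (1 + x \<bullet> x) ^ m" if "t \<in> {0..T}" for t x
  proof -
    have "C\<^sub>v * (1 + x \<bullet> x) ^ m\<^sub>v \<le> C * (1 + x \<bullet> x) ^ m"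
      using C by (intro mult_mono power_increasing) (auto simp: C_def m_def)
    then show ?thesis using Cv(2)[OF that, of x] by linarith
  qed
  obtain \<mu> where \<mu>: "\<mu> \<ge> 0" "\<And>t x. t \<in> {0..T} \<Longrightarrow>
      diffusion_op \<sigma> t x (penalty_xx \<mu> m t x) + C\<^sub>f * (1 + norm x) * norm (penalty_x \<mu> m t x) \<le> \<mu> * penalty \<mu> m t x"
    using penalty_supersolution[of m] by metis
  define \<omega> where "\<omega> = (penalty \<mu> m :: real \<Rightarrow> real ^ 'n \<Rightarrow> real)"
  define \<omega>x where "\<omega>x = (penalty_x \<mu> m :: real \<Rightarrow> real ^ 'n \<Rightarrow> real ^ 'n)"
  define \<omega>xx where "\<omega>xx = (penalty_xx \<mu> m :: real \<Rightarrow> real ^ 'n \<Rightarrow> real ^ 'n ^ 'n)"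
  have \<omega>_C12: "C12 T \<omega> (\<lambda>t x. - \<mu> * \<omega> t x) \<omega>x \<omega>xx"
    unfolding \<omega>_def \<omega>x_def \<omega>xx_def by (rule penalty_C12)
  then have \<omega>_cont: "continuous_on ({0..T} \<times> UNIV) (\<lambda>(t, x). \<omega> t x)"
    and \<omega>x_cont: "continuous_on ({0..T} \<times> UNIV) (\<lambda>(t, x). \<omega>x t x)"
    and \<omega>xx_cont: "continuous_on ({0..T} \<times> UNIV) (\<lambda>(t, x). \<omega>xx t x)"
    unfolding C12_def by blast+
  have \<omega>_pos: "\<omega> t x > 0" for t x unfolding \<omega>_def by (rule penalty_pos)
  have \<omega>_super: "diffusion_op \<sigma> t x (\<omega>xx t x) + C\<^sub>f * (1 + norm x) * norm (\<omega>x t x) \<le> \<mu> * \<omega> t x" if "t \<in> {0..T}" for t x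
    using \<mu>(2)[OF that, of x] by (simp add: \<omega>_def \<omega>x_def \<omega>xx_def)
  define \<beta> where "\<beta> = \<theta> / (2 * \<omega> t\<^sub>H x\<^sub>H)"
  have "\<beta> > 0" using \<open>\<theta> > 0\<close> \<omega>_pos by (simp add: \<beta>_def)
  define w\<^sub>1 where "w\<^sub>1 = (\<lambda>t x. u t x - \<beta> * \<omega> t x)"
  define w\<^sub>2 where "w\<^sub>2 = (\<lambda>t x. - v t x - \<beta> * \<omega> t x)"
  have w1_cont: "continuous_on ({0..T} \<times> UNIV) (\<lambda>(t, x). w\<^sub>1 t x)"
    using u_cont \<omega>_cont unfolding w\<^sub>1_def split_beta by (intro continuous_intros)
  have w2_cont: "continuous_on ({0..T} \<times> UNIV) (\<lambda>(t, x). w\<^sub>2 t x)"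
    using v_cont \<omega>_cont unfolding w\<^sub>2_def split_beta by (intro continuous_intros)
  have w_H: "w\<^sub>1 t\<^sub>H x\<^sub>H + w\<^sub>2 t\<^sub>H x\<^sub>H = \<theta>"
    using \<omega>_pos[of t\<^sub>H x\<^sub>H] by (simp add: w\<^sub>1_def w\<^sub>2_def \<beta>_def) (simp add: \<theta>_def field_simps)
  \<comment> \<open>The coefficient of the penalty at time T, where exp (- \<mu> t) is
    least.\<close>
  define b where "b = \<beta> * exp (- \<mu> * T)"
  have "b > 0" using \<open>\<beta> > 0\<close> by (simp add: b_def)
  obtain C\<^sub>1 where C1: "C\<^sub>1 \<ge> 0"
    "\<And>x :: real ^ 'n. C * (1 + x \<bullet> x) ^ m + norm x \<le> C\<^sub>1 + b * (1 + x \<bullet> x) ^ Suc (Suc m)"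
    using power_penalty_dominates[OF C \<open>b > 0\<close>] by metis
  have pen_ge: "b * (1 + x \<bullet> x) ^ Suc (Suc m) \<le> \<beta> * \<omega> t x" if "t \<in> {0..T}" for t x
  proof -
    have "exp (- \<mu> * T) \<le> exp (- \<mu> * t)" using \<mu>(1) that by (simp add: mult_left_mono)
    then have "exp (- \<mu> * T) * (1 + x \<bullet> x) ^ Suc (Suc m) \<le> \<omega> t x"
      unfolding \<omega>_def penalty_def by (intro mult_right_mono) auto
    then show ?thesis
      using \<open>\<beta> > 0\<close> by (simp add: b_def mult.assoc del: power_Suc)
  qed
  have w1_le: "w\<^sub>1 t x \<le> C\<^sub>1 - norm x" if "t \<in> {0..T}" for t x
    using pen_ge[OF that, of x] C1(2)[of x] u_le[OF that, of x] unfolding w\<^sub>1_def by linarith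
  have w2_le: "w\<^sub>2 t x \<le> C\<^sub>1 - norm x" if "t \<in> {0..T}" for t x
    using pen_ge[OF that, of x] C1(2)[of x] v_le[OF that, of x] unfolding w\<^sub>2_def by linarith
  \<comment> \<open>Each penalized function is at most \<open>C\<^sub>1\<close> minus the norm of
    its point, so the doubled functional is negative as soon as one of the points leaves this
    ball.\<close>
  define R where "R = 2 * C\<^sub>1"
  have "R \<ge> 0" using C1(1) by (simp add: R_def)
  \<comment> \<open>The final estimate allots \<theta>/8 to \<epsilon>, \<theta>/4 to the terms with
    \<epsilon>' and \<theta>/4 to those with \<eta>.\<close>
  define \<epsilon> where "\<epsilon> = \<theta> / 8"
  have "\<epsilon> > 0" using \<open>\<theta> > 0\<close> by (simp add: \<epsilon>_def)
  \<comment> \<open>The total factor of \<epsilon>' in the final estimate, plus 1 to keep it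
    positive.\<close>
  define \<kappa> where "\<kappa> = 4 * L\<^sub>\<sigma>\<^sup>2 + 2 * L\<^sub>f + 1"
  have "\<kappa> > 0" using constants_nonneg by (simp add: \<kappa>_def add_nonneg_pos)
  define \<epsilon>' where "\<epsilon>' = \<theta> / (4 * \<kappa>)"
  have "\<epsilon>' > 0" using \<open>\<theta> > 0\<close> \<open>\<kappa> > 0\<close> by (simp add: \<epsilon>'_def)
  have eh_cont: "continuous_on ({0..T} \<times> UNIV) (\<lambda>(t, x). exp t * h t x)"
    using h_continuous unfolding split_beta by (intro continuous_intros)
  have eh'_cont: "continuous_on ({0..T} \<times> UNIV) (\<lambda>(t, x). exp t * h' t x)"
    using h'_continuous unfolding split_beta by (intro continuous_intros)
  have e\<Gamma>_cont: "continuous_on ({0..T} \<times> cball 0 R \<times> A \<times> B) (\<lambda>(t, x, a, b). exp t * \<Gamma> t x a b)"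
    using continuous_on_subset[OF \<Gamma>_continuous, of "{0..T} \<times> cball 0 R \<times> A \<times> B"]
    unfolding split_beta by (intro continuous_intros) auto
  have fR_cont: "continuous_on ({0..T} \<times> cball 0 R \<times> A \<times> B) (\<lambda>(t, x, a, b). f t x a b)"
    by (rule continuous_on_subset[OF f_continuous]) auto
  obtain \<delta>\<^sub>u where \<delta>u: "\<delta>\<^sub>u > 0" "\<And>t s x y. t \<in> {0..T} \<Longrightarrow> s \<in> {0..T} \<Longrightarrow> x \<in> cball 0 R \<Longrightarrow> y \<in> cball 0 R \<Longrightarrow>
      \<bar>t - s\<bar> < \<delta>\<^sub>u \<Longrightarrow> dist x y < \<delta>\<^sub>u \<Longrightarrow> dist (u t x) (u s y) < \<epsilon>"
    by (rule uniform_on_cball[where R = R, OF u_cont \<open>\<epsilon> > 0\<close>]) (use that in blast)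
  obtain \<delta>\<^sub>v where \<delta>v: "\<delta>\<^sub>v > 0" "\<And>t s x y. t \<in> {0..T} \<Longrightarrow> s \<in> {0..T} \<Longrightarrow> x \<in> cball 0 R \<Longrightarrow> y \<in> cball 0 R \<Longrightarrow>
      \<bar>t - s\<bar> < \<delta>\<^sub>v \<Longrightarrow> dist x y < \<delta>\<^sub>v \<Longrightarrow> dist (v t x) (v s y) < \<epsilon>"
    by (rule uniform_on_cball[where R = R, OF v_cont \<open>\<epsilon> > 0\<close>]) (use that in blast)
  obtain \<delta>\<^sub>w where \<delta>w: "\<delta>\<^sub>w > 0" "\<And>t s x y. t \<in> {0..T} \<Longrightarrow> s \<in> {0..T} \<Longrightarrow> x \<in> cball 0 R \<Longrightarrow> y \<in> cball 0 R \<Longrightarrow>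
      \<bar>t - s\<bar> < \<delta>\<^sub>w \<Longrightarrow> dist x y < \<delta>\<^sub>w \<Longrightarrow> dist (w\<^sub>2 t x) (w\<^sub>2 s y) < \<epsilon>'"
    by (rule uniform_on_cball[where R = R, OF w2_cont \<open>\<epsilon>' > 0\<close>]) (use that in blast)
  obtain \<delta>\<^sub>h where \<delta>h: "\<delta>\<^sub>h > 0" "\<And>t s x y. t \<in> {0..T} \<Longrightarrow> s \<in> {0..T} \<Longrightarrow> x \<in> cball 0 R \<Longrightarrow> y \<in> cball 0 R \<Longrightarrow>
      \<bar>t - s\<bar> < \<delta>\<^sub>h \<Longrightarrow> dist x y < \<delta>\<^sub>h \<Longrightarrow> dist (exp t * h t x) (exp s * h s y) < \<epsilon>"
    by (rule uniform_on_cball[where R = R, OF eh_cont \<open>\<epsilon> > 0\<close>]) (use that in blast)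
  obtain \<delta>\<^sub>h' where \<delta>h': "\<delta>\<^sub>h' > 0" "\<And>t s x y. t \<in> {0..T} \<Longrightarrow> s \<in> {0..T} \<Longrightarrow> x \<in> cball 0 R \<Longrightarrow> y \<in> cball 0 R \<Longrightarrow>
      \<bar>t - s\<bar> < \<delta>\<^sub>h' \<Longrightarrow> dist x y < \<delta>\<^sub>h' \<Longrightarrow> dist (exp t * h' t x) (exp s * h' s y) < \<epsilon>"
    by (rule uniform_on_cball[where R = R, OF eh'_cont \<open>\<epsilon> > 0\<close>]) (use that in blast)
  obtain \<delta>\<^sub>\<Gamma> where \<delta>\<Gamma>: "\<delta>\<^sub>\<Gamma> > 0" "\<And>t s x y a b. t \<in> {0..T} \<Longrightarrow> s \<in> {0..T} \<Longrightarrow> x \<in> cball 0 R \<Longrightarrow> y \<in> cball 0 R \<Longrightarrow> a \<in> A \<Longrightarrow> b \<in> B \<Longrightarrow>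
      \<bar>t - s\<bar> < \<delta>\<^sub>\<Gamma> \<Longrightarrow> dist x y < \<delta>\<^sub>\<Gamma> \<Longrightarrow> dist (exp t * \<Gamma> t x a b) (exp s * \<Gamma> s y a b) < \<epsilon>"
    by (rule uniform_on_controls[OF e\<Gamma>_cont compact_cball A(1) B(1) \<open>\<epsilon> > 0\<close>]) (use that in blast)
  define \<delta>\<^sub>1 where "\<delta>\<^sub>1 = Min {\<delta>\<^sub>u, \<delta>\<^sub>v, \<delta>\<^sub>w, \<delta>\<^sub>h, \<delta>\<^sub>h', \<delta>\<^sub>\<Gamma>}"
  have \<delta>1: "\<delta>\<^sub>1 > 0" "\<delta>\<^sub>1 \<le> \<delta>\<^sub>u" "\<delta>\<^sub>1 \<le> \<delta>\<^sub>v" "\<delta>\<^sub>1 \<le> \<delta>\<^sub>w" "\<delta>\<^sub>1 \<le> \<delta>\<^sub>h" "\<delta>\<^sub>1 \<le> \<delta>\<^sub>h'" "\<delta>\<^sub>1 \<le> \<delta>\<^sub>\<Gamma>"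
    unfolding \<delta>\<^sub>1_def using \<delta>u(1) \<delta>v(1) \<delta>w(1) \<delta>h(1) \<delta>h'(1) \<delta>\<Gamma>(1) by auto
  \<comment> \<open>At the maximum the penalty in space is at most 2 \<open>C\<^sub>1\<close>; this
    N converts that into a distance below \<open>\<delta>\<^sub>1\<close>. K is built from
    \<open>\<delta>\<^sub>2\<close> in the same way.\<close>
  define N where "N = (4 * C\<^sub>1 + 1) / \<delta>\<^sub>1\<^sup>2"
  have "N > 0" using C1(1) \<delta>1(1) by (simp add: N_def)
  \<comment> \<open>The factor of \<eta> in the final estimate, plus 1.\<close>
  define E where "E = 2 * N + 2 * N * R + 1"
  have E: "E > 0" "2 * N + 2 * N * R \<le> E"
    using \<open>N > 0\<close> \<open>R \<ge> 0\<close> by (auto simp: E_def add_pos_nonneg)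
  define \<eta> where "\<eta> = min 1 (\<theta> / (4 * E))"
  have \<eta>: "\<eta> > 0" "\<eta> \<le> 1" "\<eta> * (2 * N + 2 * N * R) \<le> \<theta> / 4"
  proof -
    show "\<eta> > 0" "\<eta> \<le> 1" using \<open>\<theta> > 0\<close> E by (auto simp: \<eta>_def)
    have "\<eta> * (2 * N + 2 * N * R) \<le> \<eta> * E"
      using \<open>\<eta> > 0\<close> E by simp
    also have "\<dots> \<le> \<theta> / (4 * E) * E"
      using E by (intro mult_right_mono) (auto simp: \<eta>_def)
    also have "\<dots> = \<theta> / 4" using E by simp
    finally show "\<eta> * (2 * N + 2 * N * R) \<le> \<theta> / 4" .
  qed
  obtain \<delta>\<^sub>\<sigma> where \<delta>\<sigma>: "\<delta>\<^sub>\<sigma> > 0" "\<And>t s x y. t \<in> {0..T} \<Longrightarrow> s \<in> {0..T} \<Longrightarrow> x \<in> cball 0 R \<Longrightarrow> y \<in> cball 0 R \<Longrightarrow>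
      \<bar>t - s\<bar> < \<delta>\<^sub>\<sigma> \<Longrightarrow> dist x y < \<delta>\<^sub>\<sigma> \<Longrightarrow> dist (\<sigma> t x) (\<sigma> s y) < \<eta>"
    by (rule uniform_on_cball[where R = R, OF \<sigma>_continuous \<eta>(1)]) (use that in blast)
  obtain \<delta>\<^sub>f where \<delta>f: "\<delta>\<^sub>f > 0" "\<And>t s x y a b. t \<in> {0..T} \<Longrightarrow> s \<in> {0..T} \<Longrightarrow> x \<in> cball 0 R \<Longrightarrow> y \<in> cball 0 R \<Longrightarrow> a \<in> A \<Longrightarrow> b \<in> B \<Longrightarrow>
      \<bar>t - s\<bar> < \<delta>\<^sub>f \<Longrightarrow> dist x y < \<delta>\<^sub>f \<Longrightarrow> dist (f t x a b) (f s y a b) < \<eta>"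
    by (rule uniform_on_controls[OF fR_cont compact_cball A(1) B(1) \<eta>(1)]) (use that in blast)
  txt \<open>\<open>K\<close> is chosen after \<open>N\<close>, since \<open>N\<close> multiplies the moduli of continuity of \<open>\<sigma>\<close> and \<open>f\<close> in time.\<close>
  define \<delta>\<^sub>2 where "\<delta>\<^sub>2 = Min {\<delta>\<^sub>1, \<delta>\<^sub>\<sigma>, \<delta>\<^sub>f}"
  have \<delta>2: "\<delta>\<^sub>2 > 0" "\<delta>\<^sub>2 \<le> \<delta>\<^sub>1" "\<delta>\<^sub>2 \<le> \<delta>\<^sub>\<sigma>" "\<delta>\<^sub>2 \<le> \<delta>\<^sub>f"
    unfolding \<delta>\<^sub>2_def using \<delta>1(1) \<delta>\<sigma>(1) \<delta>f(1) by auto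
  define K where "K = (4 * C\<^sub>1 + 1) / \<delta>\<^sub>2\<^sup>2"
  have "K > 0" using C1(1) \<delta>2(1) by (simp add: K_def)

  \<comment> \<open>The maximum of the doubled functional\<close>
  define \<Theta> where "\<Theta> = (\<lambda>t x s y. w\<^sub>1 t x + w\<^sub>2 s y - N / 2 * ((x - y) \<bullet> (x - y)) - K / 2 * (t - s)\<^sup>2)"
  have \<Theta>_le: "\<Theta> t x s y \<le> R - norm x - norm y" if "t \<in> {0..T}" "s \<in> {0..T}" for t x s y
  proof -
    have "0 \<le> N / 2 * ((x - y) \<bullet> (x - y))" "0 \<le> K / 2 * (t - s)\<^sup>2"
      using \<open>N > 0\<close> \<open>K > 0\<close> by simp_all
    then show ?thesis
      using w1_le[OF that(1), of x] w2_le[OF that(2), of y] unfolding \<Theta>_def R_def by linarith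
  qed
  define D where "D = ({0..T} \<times> cball (0 :: real ^ 'n) R) \<times> ({0..T} \<times> cball (0 :: real ^ 'n) R)"
  have D: "compact D" "D \<noteq> {}"
    unfolding D_def using \<open>R \<ge> 0\<close> T_pos by (auto intro!: compact_Times)
  have "continuous_on D (\<lambda>z. (\<lambda>(t, x). w\<^sub>1 t x) (fst z))"
    by (rule continuous_on_compose2[OF w1_cont]) (auto simp: D_def intro!: continuous_intros)
  moreover have "continuous_on D (\<lambda>z. (\<lambda>(t, x). w\<^sub>2 t x) (snd z))"
    by (rule continuous_on_compose2[OF w2_cont]) (auto simp: D_def intro!: continuous_intros)
  ultimately have "continuous_on D (\<lambda>z. \<Theta> (fst (fst z)) (snd (fst z)) (fst (snd z)) (snd (snd z)))"
    unfolding \<Theta>_def split_beta by (intro continuous_intros)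
  from continuous_attains_sup[OF D this]
  obtain z where z: "z \<in> D" "\<And>z'. z' \<in> D \<Longrightarrow> \<Theta> (fst (fst z')) (snd (fst z')) (fst (snd z')) (snd (snd z'))
      \<le> \<Theta> (fst (fst z)) (snd (fst z)) (fst (snd z)) (snd (snd z))"
    by blast
  obtain t\<^sub>1 x\<^sub>1 t\<^sub>2 x\<^sub>2 where z_eq: "z = ((t\<^sub>1, x\<^sub>1), (t\<^sub>2, x\<^sub>2))"
    by (metis prod.collapse)
  have in_D: "t\<^sub>1 \<in> {0..T}" "t\<^sub>2 \<in> {0..T}" "x\<^sub>1 \<in> cball 0 R" "x\<^sub>2 \<in> cball 0 R"
    using z(1) by (auto simp: z_eq D_def)
  have \<Theta>_D: "\<Theta> t x s y \<le> \<Theta> t\<^sub>1 x\<^sub>1 t\<^sub>2 x\<^sub>2" if "t \<in> {0..T}" "s \<in> {0..T}" "x \<in> cball 0 R" "y \<in> cball 0 R" for t x s y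
    using z(2)[of "((t, x), (s, y))"] that by (auto simp: z_eq D_def)
  have \<Theta>_H: "\<Theta> t\<^sub>H x\<^sub>H t\<^sub>H x\<^sub>H = \<theta>"
    by (simp add: \<Theta>_def w_H)
  have "x\<^sub>H \<in> cball 0 R"
    using \<Theta>_le[OF tH tH, of x\<^sub>H x\<^sub>H] \<Theta>_H \<open>\<theta> > 0\<close> norm_ge_zero[of x\<^sub>H] unfolding mem_cball_0 by linarith
  then have \<Theta>_max_ge: "\<theta> \<le> \<Theta> t\<^sub>1 x\<^sub>1 t\<^sub>2 x\<^sub>2"
    using \<Theta>_D[OF tH tH] \<Theta>_H by metis
  \<comment> \<open>The maximum over the compact set is global: if a point lies outside the ball the
    functional is nonpositive, while the maximum is at least \<theta>.\<close>
  have \<Theta>_max: "\<Theta> t x s y \<le> \<Theta> t\<^sub>1 x\<^sub>1 t\<^sub>2 x\<^sub>2" if "t \<in> {0..T}" "s \<in> {0..T}" for t x s y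
  proof (cases "x \<in> cball 0 R \<and> y \<in> cball 0 R")
    case True
    then show ?thesis using \<Theta>_D[OF that] by blast
  next
    case False
    then have "R < norm x \<or> R < norm y" by auto
    then have "\<Theta> t x s y \<le> 0"
      using \<Theta>_le[OF that, of x y] norm_ge_zero[of x] norm_ge_zero[of y] by linarith
    then show ?thesis using \<Theta>_max_ge \<open>\<theta> > 0\<close> by linarith
  qed
  have pen_nonneg: "0 \<le> N / 2 * ((x\<^sub>1 - x\<^sub>2) \<bullet> (x\<^sub>1 - x\<^sub>2))" "0 \<le> K / 2 * (t\<^sub>1 - t\<^sub>2)\<^sup>2"
    using \<open>N > 0\<close> \<open>K > 0\<close> by simp_all
  have pen_le: "N / 2 * ((x\<^sub>1 - x\<^sub>2) \<bullet> (x\<^sub>1 - x\<^sub>2)) + K / 2 * (t\<^sub>1 - t\<^sub>2)\<^sup>2 \<le> 2 * C\<^sub>1"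
    using \<Theta>_max_ge w1_le[OF in_D(1), of x\<^sub>1] w2_le[OF in_D(2), of x\<^sub>2] \<open>\<theta> > 0\<close>
      norm_ge_zero[of x\<^sub>1] norm_ge_zero[of x\<^sub>2] unfolding \<Theta>_def by linarith
  have small: "s < d\<^sup>2" if "(4 * C\<^sub>1 + 1) / d\<^sup>2 / 2 * s \<le> 2 * C\<^sub>1" "d > 0" for s d :: real
  proof -
    have "(4 * C\<^sub>1 + 1) * s \<le> 4 * C\<^sub>1 * d\<^sup>2"
      using that by (simp add: field_simps)
    also have "\<dots> < (4 * C\<^sub>1 + 1) * d\<^sup>2"
      using that(2) by simp
    finally show ?thesis
      using C1(1) by (simp add: mult_less_cancel_left_pos)
  qed
  have "(norm (x\<^sub>1 - x\<^sub>2))\<^sup>2 < \<delta>\<^sub>1\<^sup>2"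
    using small[of \<delta>\<^sub>1 "(x\<^sub>1 - x\<^sub>2) \<bullet> (x\<^sub>1 - x\<^sub>2)"] pen_le pen_nonneg(2) \<delta>1(1) unfolding N_def[symmetric] dot_square_norm by linarith
  then have dx: "dist x\<^sub>1 x\<^sub>2 < \<delta>\<^sub>1"
    using \<delta>1(1) by (simp add: dist_norm power2_less_imp_less)
  have "\<bar>t\<^sub>1 - t\<^sub>2\<bar>\<^sup>2 < \<delta>\<^sub>2\<^sup>2"
    using small[of \<delta>\<^sub>2 "(t\<^sub>1 - t\<^sub>2)\<^sup>2"] pen_le pen_nonneg(1) \<delta>2(1) unfolding K_def[symmetric] power2_abs by linarith
  then have dt: "\<bar>t\<^sub>1 - t\<^sub>2\<bar> < \<delta>\<^sub>2"
    using \<delta>2(1) power2_less_imp_less less_imp_le by blast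
  have dt1: "\<bar>t\<^sub>1 - t\<^sub>2\<bar> < \<delta>\<^sub>1" using dt \<delta>2(2) by linarith

  have "dist (w\<^sub>2 t\<^sub>1 x\<^sub>1) (w\<^sub>2 t\<^sub>2 x\<^sub>2) < \<epsilon>'"
    using \<delta>w(2)[OF in_D] dt1 dx \<delta>1 by linarith
  \<comment> \<open>Moving the second point onto the first removes both penalties at the price of
    one oscillation of \<open>w\<^sub>2\<close>. Hence N |x - y|^2 is small, and not merely |x -
    y|.\<close>
  moreover have "\<Theta> t\<^sub>1 x\<^sub>1 t\<^sub>1 x\<^sub>1 \<le> \<Theta> t\<^sub>1 x\<^sub>1 t\<^sub>2 x\<^sub>2"
    by (rule \<Theta>_max[OF in_D(1,1)])
  ultimately have Nsmall: "N * (norm (x\<^sub>1 - x\<^sub>2))\<^sup>2 \<le> 2 * \<epsilon>'"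
    using pen_nonneg(2) unfolding \<Theta>_def dot_square_norm dist_real_def by simp
  \<comment> \<open>Dropping all penalties leaves a gap between u and v at two different but close
    points. This gap excludes terminal times and then active obstacles.\<close>
  have uv: "\<theta> \<le> u t\<^sub>1 x\<^sub>1 - v t\<^sub>2 x\<^sub>2"
  proof -
    have "0 \<le> \<beta> * \<omega> t\<^sub>1 x\<^sub>1" "0 \<le> \<beta> * \<omega> t\<^sub>2 x\<^sub>2"
      using \<open>\<beta> > 0\<close> \<omega>_pos by (auto intro!: mult_nonneg_nonneg less_imp_le)
    then show ?thesis
      using \<Theta>_max_ge pen_nonneg unfolding \<Theta>_def w\<^sub>1_def w\<^sub>2_def by linarith
  qed
  have "t\<^sub>1 \<noteq> T"
  proof
    assume T: "t\<^sub>1 = T"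
    have "dist (v t\<^sub>1 x\<^sub>1) (v t\<^sub>2 x\<^sub>2) < \<epsilon>"
      using \<delta>v(2)[OF in_D] dt1 dx \<delta>1 by linarith
    then show False
      using u_T[of x\<^sub>1] v_T[of x\<^sub>1] uv \<open>\<theta> > 0\<close> unfolding \<epsilon>_def dist_real_def T by linarith
  qed
  have "t\<^sub>2 \<noteq> T"
  proof
    assume T: "t\<^sub>2 = T"
    have "dist (u t\<^sub>1 x\<^sub>1) (u t\<^sub>2 x\<^sub>2) < \<epsilon>"
      using \<delta>u(2)[OF in_D] dt1 dx \<delta>1 by linarith
    then show False
      using u_T[of x\<^sub>2] v_T[of x\<^sub>2] uv \<open>\<theta> > 0\<close> unfolding \<epsilon>_def dist_real_def T by linarith
  qed
  have t12: "t\<^sub>1 \<in> {0..<T}" "t\<^sub>2 \<in> {0..<T}"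
    using in_D \<open>t\<^sub>1 \<noteq> T\<close> \<open>t\<^sub>2 \<noteq> T\<close> by auto

  \<comment> \<open>Test functions for the penalized problem and inactivity of the obstacles\<close>
  have sub_test: "C12 T (\<lambda>t x. \<phi> t x + \<beta> * \<omega> t x) (\<lambda>t x. \<phi>t t x + \<beta> * (- \<mu> * \<omega> t x))
      (\<lambda>t x. \<phi>x t x + \<beta> *\<^sub>R \<omega>x t x) (\<lambda>t x. \<phi>xx t x + \<beta> *\<^sub>R \<omega>xx t x)"
    if "C12 T \<phi> \<phi>t \<phi>x \<phi>xx" for \<phi> \<phi>t \<phi>x \<phi>xx
    by (rule C12_add[OF that C12_cmult[OF \<omega>_C12]])
  have sub_max: "local_max_on ({0..T} \<times> UNIV) (\<lambda>(s, y). u s y - (\<phi> s y + \<beta> * \<omega> s y)) (t, x)"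
    if "local_max_on ({0..T} \<times> UNIV) (\<lambda>(s, y). w\<^sub>1 s y - \<phi> s y) (t, x)" for \<phi> t x
    using that by (simp add: w\<^sub>1_def diff_diff_eq add.commute)
  \<comment> \<open>A maximum for - v becomes a minimum for v with the negated test function; the
    factor - 1 has the shape that \<open>C12_cmult\<close> produces.\<close>
  have super_min: "local_min_on ({0..T} \<times> UNIV) (\<lambda>(s, y). v s y - - 1 * (\<phi> s y + \<beta> * \<omega> s y)) (t, x)"
    if "local_max_on ({0..T} \<times> UNIV) (\<lambda>(s, y). w\<^sub>2 s y - \<phi> s y) (t, x)" for \<phi> t x
    using that unfolding local_max_on_def local_min_on_def
    by (auto simp: w\<^sub>2_def split_beta elim!: eventually_mono)

  have flip: "(a - b) \<bullet> (a - b) = (b - a) \<bullet> (b - a)" for a b :: "real ^ 'n"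
    by (simp add: dot_square_norm norm_minus_commute)
  \<comment> \<open>The supersolution obeys its obstacle inequality where some test function touches
    it; the doubling penalty with the first point frozen is such a function.\<close>
  have h_v: "exp t\<^sub>2 * h t\<^sub>2 x\<^sub>2 \<le> v t\<^sub>2 x\<^sub>2"
  proof -
    have "w\<^sub>2 s y - (N / 2 * ((y - x\<^sub>1) \<bullet> (y - x\<^sub>1)) + K / 2 * (s - t\<^sub>1)\<^sup>2)
        \<le> w\<^sub>2 t\<^sub>2 x\<^sub>2 - (N / 2 * ((x\<^sub>2 - x\<^sub>1) \<bullet> (x\<^sub>2 - x\<^sub>1)) + K / 2 * (t\<^sub>2 - t\<^sub>1)\<^sup>2)" if "s \<in> {0..T}" for s y
      using \<Theta>_max[OF in_D(1) that, of x\<^sub>1 y]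
      unfolding \<Theta>_def power2_commute[of t\<^sub>1] flip[of x\<^sub>1] by linarith
    then have "local_max_on ({0..T} \<times> UNIV) (\<lambda>(s, y). w\<^sub>2 s y - (N / 2 * ((y - x\<^sub>1) \<bullet> (y - x\<^sub>1)) + K / 2 * (s - t\<^sub>1)\<^sup>2)) (t\<^sub>2, x\<^sub>2)"
      using in_D(2) unfolding local_max_on_def by (auto simp: eventually_at_filter intro!: always_eventually)
    from supersolutionD(1)[OF super C12_cmult[OF sub_test[OF C12_distance]] t12(2) super_min[OF this]]
    show ?thesis .
  qed
  \<comment> \<open>The gap carries the obstacle inequality across: u exceeds v at the other point
    by \<theta>, v lies above the obstacle there, and the obstacle oscillates by less than \<theta>.
    The mirrored argument keeps v below the upper obstacle.\<close>
  have "exp t\<^sub>1 * h t\<^sub>1 x\<^sub>1 < u t\<^sub>1 x\<^sub>1"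
  proof -
    have "dist (exp t\<^sub>1 * h t\<^sub>1 x\<^sub>1) (exp t\<^sub>2 * h t\<^sub>2 x\<^sub>2) < \<epsilon>"
      using \<delta>h(2)[OF in_D] dt1 dx \<delta>1 by linarith
    then show ?thesis
      using h_v uv \<open>\<theta> > 0\<close> unfolding \<epsilon>_def dist_real_def by linarith
  qed
  have "u t\<^sub>1 x\<^sub>1 \<le> exp t\<^sub>1 * h' t\<^sub>1 x\<^sub>1"
  proof -
    have "w\<^sub>1 s y - (N / 2 * ((y - x\<^sub>2) \<bullet> (y - x\<^sub>2)) + K / 2 * (s - t\<^sub>2)\<^sup>2)
        \<le> w\<^sub>1 t\<^sub>1 x\<^sub>1 - (N / 2 * ((x\<^sub>1 - x\<^sub>2) \<bullet> (x\<^sub>1 - x\<^sub>2)) + K / 2 * (t\<^sub>1 - t\<^sub>2)\<^sup>2)" if "s \<in> {0..T}" for s y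
      using \<Theta>_max[OF that in_D(2), of y x\<^sub>2] by (simp add: \<Theta>_def)
    then have "local_max_on ({0..T} \<times> UNIV) (\<lambda>(s, y). w\<^sub>1 s y - (N / 2 * ((y - x\<^sub>2) \<bullet> (y - x\<^sub>2)) + K / 2 * (s - t\<^sub>2)\<^sup>2)) (t\<^sub>1, x\<^sub>1)"
      using in_D(1) unfolding local_max_on_def by (auto simp: eventually_at_filter intro!: always_eventually)
    from subsolutionD(1)[OF sub sub_test[OF C12_distance] t12(1) sub_max[OF this] \<open>exp t\<^sub>1 * h t\<^sub>1 x\<^sub>1 < u t\<^sub>1 x\<^sub>1\<close>]
    show ?thesis .
  qed
  have "v t\<^sub>2 x\<^sub>2 < exp t\<^sub>2 * h' t\<^sub>2 x\<^sub>2"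
  proof -
    have "dist (exp t\<^sub>1 * h' t\<^sub>1 x\<^sub>1) (exp t\<^sub>2 * h' t\<^sub>2 x\<^sub>2) < \<epsilon>"
      using \<delta>h'(2)[OF in_D] dt1 dx \<delta>1 by linarith
    then show ?thesis
      using \<open>u t\<^sub>1 x\<^sub>1 \<le> _\<close> uv \<open>\<theta> > 0\<close> unfolding \<epsilon>_def dist_real_def by linarith
  qed
  \<comment> \<open>By continuity the obstacles stay inactive near both points, where the test
    functions of \<open>theorem_on_sums\<close> touch.\<close>
  have "continuous_on ({0..T} \<times> UNIV) (\<lambda>(t, x). u t x - exp t * h t x)"
    using u_cont eh_cont unfolding split_beta by (intro continuous_on_diff)
  then obtain d\<^sub>1 where d1: "d\<^sub>1 > 0" "\<And>t x. (t, x) \<in> {0..T} \<times> UNIV \<Longrightarrow> dist (t, x) (t\<^sub>1, x\<^sub>1) < d\<^sub>1 \<Longrightarrow> u t x - exp t * h t x > 0"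
    by (rule continuous_on_pos_near[where t\<^sub>0 = t\<^sub>1 and x\<^sub>0 = x\<^sub>1]) (use in_D(1) \<open>exp t\<^sub>1 * h t\<^sub>1 x\<^sub>1 < u t\<^sub>1 x\<^sub>1\<close> in auto)
  have "continuous_on ({0..T} \<times> UNIV) (\<lambda>(t, x). exp t * h' t x - v t x)"
    using v_cont eh'_cont unfolding split_beta by (intro continuous_on_diff)
  then obtain d\<^sub>2 where d2: "d\<^sub>2 > 0" "\<And>t x. (t, x) \<in> {0..T} \<times> UNIV \<Longrightarrow> dist (t, x) (t\<^sub>2, x\<^sub>2) < d\<^sub>2 \<Longrightarrow> exp t * h' t x - v t x > 0"
    by (rule continuous_on_pos_near[where t\<^sub>0 = t\<^sub>2 and x\<^sub>0 = x\<^sub>2]) (use in_D(2) \<open>v t\<^sub>2 x\<^sub>2 < exp t\<^sub>2 * h' t\<^sub>2 x\<^sub>2\<close> in auto)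

  \<comment> \<open>The time derivative plus the diffusion of \<omega>. Test functions for u and - v
    are those for the penalized functions plus \<beta> \<omega>, so \<open>G\<^sub>1\<close> and
    \<open>G\<^sub>2\<close> carry \<beta> F and a shifted gradient.\<close>
  define F where "F = (\<lambda>t x. - \<mu> * \<omega> t x + diffusion_op \<sigma> t x (\<omega>xx t x))"
  define G\<^sub>1 where "G\<^sub>1 = (\<lambda>t x \<pi>. u t x - \<beta> * F t x - Ham t x (\<pi> + \<beta> *\<^sub>R \<omega>x t x))"
  define G\<^sub>2 where "G\<^sub>2 = (\<lambda>t x \<pi>. - v t x - \<beta> * F t x + Ham t x (- (\<pi> + \<beta> *\<^sub>R \<omega>x t x)))"
  have F_cont: "continuous_on ({0..T} \<times> UNIV) (\<lambda>(t, x). F t x)"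
    using \<omega>_cont continuous_on_diffusion_op[OF \<omega>xx_cont] unfolding F_def split_beta by (intro continuous_intros)
  have lift: "continuous_on ({0..T} \<times> UNIV \<times> UNIV) (\<lambda>z :: real \<times> (real ^ 'n) \<times> (real ^ 'n). H (fst z) (fst (snd z)))"
    if "continuous_on ({0..T} \<times> UNIV) (\<lambda>(t, x). H t x)" for H :: "real \<Rightarrow> real ^ 'n \<Rightarrow> 'z::topological_space"
  proof -
    have "continuous_on ({0..T} \<times> UNIV \<times> UNIV) (\<lambda>z :: real \<times> (real ^ 'n) \<times> (real ^ 'n). (fst z, fst (snd z)))"
      by (intro continuous_intros)
    from continuous_on_compose2[OF that this] show ?thesis
      by (simp add: image_subset_iff split_beta mem_Times_iff)
  qed
  have Ham1: "continuous_on ({0..T} \<times> UNIV \<times> UNIV) (\<lambda>z. Ham (fst z) (fst (snd z)) (snd (snd z) + \<beta> *\<^sub>R \<omega>x (fst z) (fst (snd z))))"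
  proof -
    have "continuous_on ({0..T} \<times> UNIV \<times> UNIV) (\<lambda>z. (fst z, fst (snd z), snd (snd z) + \<beta> *\<^sub>R \<omega>x (fst z) (fst (snd z))))"
      by (intro continuous_intros lift[OF \<omega>x_cont])
    from continuous_on_compose2[OF Ham_continuous this] show ?thesis
      by (simp add: image_subset_iff split_beta mem_Times_iff)
  qed
  have Ham2: "continuous_on ({0..T} \<times> UNIV \<times> UNIV) (\<lambda>z. Ham (fst z) (fst (snd z)) (- (snd (snd z) + \<beta> *\<^sub>R \<omega>x (fst z) (fst (snd z)))))"
  proof -
    have "continuous_on ({0..T} \<times> UNIV \<times> UNIV) (\<lambda>z. (fst z, fst (snd z), - (snd (snd z) + \<beta> *\<^sub>R \<omega>x (fst z) (fst (snd z)))))"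
      by (intro continuous_intros lift[OF \<omega>x_cont])
    from continuous_on_compose2[OF Ham_continuous this] show ?thesis
      by (simp add: image_subset_iff split_beta mem_Times_iff)
  qed
  have G1_cont: "continuous_on ({0..T} \<times> UNIV \<times> UNIV) (\<lambda>(t, x, \<pi>). G\<^sub>1 t x \<pi>)"
    unfolding G\<^sub>1_def split_beta by (intro continuous_intros lift[OF u_cont] lift[OF F_cont] Ham1)
  have G2_cont: "continuous_on ({0..T} \<times> UNIV \<times> UNIV) (\<lambda>(t, x, \<pi>). G\<^sub>2 t x \<pi>)"
    unfolding G\<^sub>2_def split_beta by (intro continuous_intros lift[OF v_cont] lift[OF F_cont] Ham2)
  define p where "p = N *\<^sub>R (x\<^sub>1 - x\<^sub>2)"
  have key: "G\<^sub>1 t\<^sub>1 x\<^sub>1 p + G\<^sub>2 t\<^sub>2 x\<^sub>2 (- p) \<le> N * (norm (\<sigma> t\<^sub>1 x\<^sub>1 - \<sigma> t\<^sub>2 x\<^sub>2))\<^sup>2"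
  proof (rule theorem_on_sums[OF w1_cont w2_cont \<open>N > 0\<close> \<open>K > 0\<close> t12 _ p_def _ \<sigma>_continuous \<sigma>_invertible])
    show "min d\<^sub>1 d\<^sub>2 > 0" using d1 d2 by simp
    show "w\<^sub>1 t x + w\<^sub>2 s y - N / 2 * ((x - y) \<bullet> (x - y)) - K / 2 * (t - s)\<^sup>2
      \<le> w\<^sub>1 t\<^sub>1 x\<^sub>1 + w\<^sub>2 t\<^sub>2 x\<^sub>2 - N / 2 * ((x\<^sub>1 - x\<^sub>2) \<bullet> (x\<^sub>1 - x\<^sub>2)) - K / 2 * (t\<^sub>1 - t\<^sub>2)\<^sup>2"
      if "t \<in> {0..T}" "s \<in> {0..T}" for t x s y
      using \<Theta>_max[OF that, of x y] by (simp only: \<Theta>_def)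
    show "continuous (at (t\<^sub>1, x\<^sub>1, p) within {0..T} \<times> UNIV \<times> UNIV) (\<lambda>(t, x, \<pi>). G\<^sub>1 t x \<pi>)"
      using G1_cont in_D(1) unfolding continuous_on_eq_continuous_within by auto
    show "continuous (at (t\<^sub>2, x\<^sub>2, - p) within {0..T} \<times> UNIV \<times> UNIV) (\<lambda>(t, x, \<pi>). G\<^sub>2 t x \<pi>)"
      using G2_cont in_D(2) unfolding continuous_on_eq_continuous_within by auto
  next
    fix \<phi> \<phi>t \<phi>x \<phi>xx t x
    assume *: "C12 T \<phi> \<phi>t \<phi>x \<phi>xx" "t \<in> {0..<T}" "dist (t, x) (t\<^sub>1, x\<^sub>1) < min d\<^sub>1 d\<^sub>2"
      "local_max_on ({0..T} \<times> UNIV) (\<lambda>(s, y). w\<^sub>1 s y - \<phi> s y) (t, x)"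
    have "exp t * h t x < u t x"
      using d1(2)[of t x] *(2,3) by simp
    from subsolutionD(2)[OF sub sub_test[OF *(1)] *(2) sub_max[OF *(4)] this]
    show "G\<^sub>1 t x (\<phi>x t x) - \<phi>t t x \<le> diffusion_op \<sigma> t x (\<phi>xx t x)"
      by (simp add: G\<^sub>1_def F_def diffusion_op_add algebra_simps)
  next
    fix \<phi> \<phi>t \<phi>x \<phi>xx t x
    assume *: "C12 T \<phi> \<phi>t \<phi>x \<phi>xx" "t \<in> {0..<T}" "dist (t, x) (t\<^sub>2, x\<^sub>2) < min d\<^sub>1 d\<^sub>2"
      "local_max_on ({0..T} \<times> UNIV) (\<lambda>(s, y). w\<^sub>2 s y - \<phi> s y) (t, x)"
    have "v t x < exp t * h' t x"
      using d2(2)[of t x] *(2,3) by simp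
    from supersolutionD(2)[OF super C12_cmult[OF sub_test[OF *(1)]] *(2) super_min[OF *(4)] this]
    have "0 \<le> - (- 1 * (\<phi>t t x + \<beta> * (- \<mu> * \<omega> t x))) + v t x
        + (diffusion_op \<sigma> t x (\<phi>xx t x) + \<beta> * diffusion_op \<sigma> t x (\<omega>xx t x)) - Ham t x (- (\<phi>x t x + \<beta> *\<^sub>R \<omega>x t x))"
      by (simp only: scaleR_minus1_left diffusion_op_minus diffusion_op_add)
    then show "G\<^sub>2 t x (\<phi>x t x) - \<phi>t t x \<le> diffusion_op \<sigma> t x (\<phi>xx t x)"
      by (simp add: G\<^sub>2_def F_def algebra_simps)
  qed auto

  \<comment> \<open>The estimates that contradict the gap\<close>
  have F_le: "\<beta> * F t x + C\<^sub>f * (1 + norm x) * norm (\<beta> *\<^sub>R \<omega>x t x) \<le> 0" if "t \<in> {0..T}" for t x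
  proof -
    have "\<beta> * (F t x + C\<^sub>f * (1 + norm x) * norm (\<omega>x t x)) \<le> \<beta> * 0"
      using \<omega>_super[OF that, of x] \<open>\<beta> > 0\<close> by (intro mult_left_mono) (auto simp: F_def)
    then show ?thesis using \<open>\<beta> > 0\<close> by (simp add: algebra_simps)
  qed
  \<comment> \<open>The shift of the gradient by \<omega> costs no more than - \<beta> F provides.
    The penalty at infinity thus leaves the inequality without a remainder.\<close>
  have "Ham t\<^sub>1 x\<^sub>1 (p + \<beta> *\<^sub>R \<omega>x t\<^sub>1 x\<^sub>1) \<le> Ham t\<^sub>1 x\<^sub>1 p - \<beta> * F t\<^sub>1 x\<^sub>1"
    using Ham_gradient[OF in_D(1), of x\<^sub>1 "p + \<beta> *\<^sub>R \<omega>x t\<^sub>1 x\<^sub>1" p] F_le[OF in_D(1), of x\<^sub>1] by simp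
  moreover have "Ham t\<^sub>2 x\<^sub>2 p + \<beta> * F t\<^sub>2 x\<^sub>2 \<le> Ham t\<^sub>2 x\<^sub>2 (- (- p + \<beta> *\<^sub>R \<omega>x t\<^sub>2 x\<^sub>2))"
    using Ham_gradient[OF in_D(2), of x\<^sub>2 p "p - \<beta> *\<^sub>R \<omega>x t\<^sub>2 x\<^sub>2"] F_le[OF in_D(2), of x\<^sub>2] by simp
  ultimately have "u t\<^sub>1 x\<^sub>1 - v t\<^sub>2 x\<^sub>2 \<le> N * (norm (\<sigma> t\<^sub>1 x\<^sub>1 - \<sigma> t\<^sub>2 x\<^sub>2))\<^sup>2 + (Ham t\<^sub>1 x\<^sub>1 p - Ham t\<^sub>2 x\<^sub>2 p)"
    using key unfolding G\<^sub>1_def G\<^sub>2_def by linarith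
  also have "Ham t\<^sub>1 x\<^sub>1 p - Ham t\<^sub>2 x\<^sub>2 p \<le> norm p * (\<eta> + L\<^sub>f * norm (x\<^sub>1 - x\<^sub>2)) + \<epsilon>"
  proof -
    have "Ham t\<^sub>1 x\<^sub>1 p \<le> Ham t\<^sub>2 x\<^sub>2 p + (norm p * (\<eta> + L\<^sub>f * norm (x\<^sub>1 - x\<^sub>2)) + \<epsilon>)"
    proof (rule Ham_le[OF in_D(1,2)], rule J_difference[OF in_D(1,2)])
      fix a b assume ab: "a \<in> A" "b \<in> B"
      show "norm (f t\<^sub>1 x\<^sub>1 a b - f t\<^sub>2 x\<^sub>1 a b) \<le> \<eta>"
        using \<delta>f(2)[OF in_D(1,2,3,3) ab] dt \<delta>2 \<delta>f(1) by (simp add: dist_norm)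
      have "dist (exp t\<^sub>1 * \<Gamma> t\<^sub>1 x\<^sub>1 a b) (exp t\<^sub>2 * \<Gamma> t\<^sub>2 x\<^sub>2 a b) < \<epsilon>"
        using \<delta>\<Gamma>(2)[OF in_D ab] dt1 dx \<delta>1 by linarith
      then show "\<bar>exp t\<^sub>1 * \<Gamma> t\<^sub>1 x\<^sub>1 a b - exp t\<^sub>2 * \<Gamma> t\<^sub>2 x\<^sub>2 a b\<bar> \<le> \<epsilon>"
        by (simp add: dist_real_def)
    qed
    then show ?thesis by linarith
  qed
  also have "norm p * (\<eta> + L\<^sub>f * norm (x\<^sub>1 - x\<^sub>2)) \<le> 2 * N * R * \<eta> + 2 * L\<^sub>f * \<epsilon>'"
  proof -
    have np: "norm p = N * norm (x\<^sub>1 - x\<^sub>2)" using \<open>N > 0\<close> by (simp add: p_def)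
    have "norm (x\<^sub>1 - x\<^sub>2) \<le> 2 * R"
      using norm_triangle_ineq4[of x\<^sub>1 x\<^sub>2] in_D(3,4) by simp
    then have "N * norm (x\<^sub>1 - x\<^sub>2) * \<eta> \<le> N * (2 * R) * \<eta>"
      using \<open>N > 0\<close> \<eta>(1) by (intro mult_right_mono mult_left_mono) auto
    moreover have "L\<^sub>f * (N * (norm (x\<^sub>1 - x\<^sub>2))\<^sup>2) \<le> L\<^sub>f * (2 * \<epsilon>')"
      using Nsmall constants_nonneg by (intro mult_left_mono)
    ultimately show ?thesis
      by (simp add: np power2_eq_square algebra_simps)
  qed
  also have "N * (norm (\<sigma> t\<^sub>1 x\<^sub>1 - \<sigma> t\<^sub>2 x\<^sub>2))\<^sup>2 \<le> 2 * N * \<eta> + 4 * L\<^sub>\<sigma>\<^sup>2 * \<epsilon>'"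
  proof -
    have "norm (\<sigma> t\<^sub>1 x\<^sub>1 - \<sigma> t\<^sub>2 x\<^sub>1) \<le> \<eta>"
      using \<delta>\<sigma>(2)[OF in_D(1,2,3,3)] dt \<delta>2 \<delta>\<sigma>(1) by (simp add: dist_norm)
    then have "norm (\<sigma> t\<^sub>1 x\<^sub>1 - \<sigma> t\<^sub>2 x\<^sub>2) \<le> \<eta> + L\<^sub>\<sigma> * norm (x\<^sub>1 - x\<^sub>2)"
      using norm_triangle_ineq[of "\<sigma> t\<^sub>1 x\<^sub>1 - \<sigma> t\<^sub>2 x\<^sub>1" "\<sigma> t\<^sub>2 x\<^sub>1 - \<sigma> t\<^sub>2 x\<^sub>2"] \<sigma>_lipschitz[OF in_D(2), of x\<^sub>1 x\<^sub>2] by simp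
    then have "(norm (\<sigma> t\<^sub>1 x\<^sub>1 - \<sigma> t\<^sub>2 x\<^sub>2))\<^sup>2 \<le> (\<eta> + L\<^sub>\<sigma> * norm (x\<^sub>1 - x\<^sub>2))\<^sup>2"
      by (rule power_mono) simp
    also have "\<dots> \<le> 2 * \<eta>\<^sup>2 + 2 * (L\<^sub>\<sigma> * norm (x\<^sub>1 - x\<^sub>2))\<^sup>2"
      using sum_squares_bound[of \<eta> "L\<^sub>\<sigma> * norm (x\<^sub>1 - x\<^sub>2)"] by (simp add: power2_sum)
    also have "\<eta>\<^sup>2 \<le> \<eta>"
      using \<eta>(1,2) by (simp add: power2_eq_square mult_left_le)
    finally have "N * (norm (\<sigma> t\<^sub>1 x\<^sub>1 - \<sigma> t\<^sub>2 x\<^sub>2))\<^sup>2 \<le> N * (2 * \<eta> + 2 * (L\<^sub>\<sigma> * norm (x\<^sub>1 - x\<^sub>2))\<^sup>2)"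
      using \<open>N > 0\<close> by (intro mult_left_mono) auto
    also have "\<dots> = 2 * N * \<eta> + 2 * L\<^sub>\<sigma>\<^sup>2 * (N * (norm (x\<^sub>1 - x\<^sub>2))\<^sup>2)"
      by (simp add: power_mult_distrib algebra_simps)
    also have "\<dots> \<le> 2 * N * \<eta> + 2 * L\<^sub>\<sigma>\<^sup>2 * (2 * \<epsilon>')"
      using Nsmall by (intro add_left_mono mult_left_mono) auto
    finally show ?thesis by simp
  qed
  finally have "\<theta> \<le> \<eta> * (2 * N + 2 * N * R) + (4 * L\<^sub>\<sigma>\<^sup>2 + 2 * L\<^sub>f) * \<epsilon>' + \<epsilon>"
    using uv by (simp add: algebra_simps)
  moreover have "(4 * L\<^sub>\<sigma>\<^sup>2 + 2 * L\<^sub>f) * \<epsilon>' \<le> \<kappa> * \<epsilon>'"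
    using \<open>\<epsilon>' > 0\<close> by (intro mult_right_mono) (auto simp: \<kappa>_def)
  moreover have "\<kappa> * \<epsilon>' = \<theta> / 4"
    using \<open>\<kappa> > 0\<close> by (simp add: \<epsilon>'_def)
  ultimately show False
    using \<eta>(3) \<open>\<theta> > 0\<close> unfolding \<epsilon>_def by linarith
qed

end

theorem theorem5p1:
  fixes T :: real
    and A :: "'a::metric_space set"
    and B :: "'b::metric_space set"
    and \<sigma> :: "real \<Rightarrow> real ^ 'n \<Rightarrow> real ^ 'n ^ 'n"
    and f :: "real \<Rightarrow> real ^ 'n \<Rightarrow> 'a \<Rightarrow> 'b \<Rightarrow> real ^ 'n"
    and \<Gamma> :: "real \<Rightarrow> real ^ 'n \<Rightarrow> 'a \<Rightarrow> 'b \<Rightarrow> real"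
    and h h' :: "real \<Rightarrow> real ^ 'n \<Rightarrow> real"
    and g :: "real ^ 'n \<Rightarrow> real"
    and v\<^sub>1 v\<^sub>2 :: "real \<Rightarrow> real ^ 'n \<Rightarrow> real"
  assumes T_pos: "0 < T"
    and A: "compact A" "A \<noteq> {}"
    and B: "compact B" "B \<noteq> {}"
    and \<sigma>_bounded: "bounded ((\<lambda>(t, x). \<sigma> t x) ` ({0..T} \<times> UNIV))"
    and \<sigma>_continuous: "continuous_on ({0..T} \<times> UNIV) (\<lambda>(t, x). \<sigma> t x)"
    and \<sigma>_lipschitz: "\<exists>L. \<forall>t\<in>{0..T}. L-lipschitz_on UNIV (\<sigma> t)"
    and \<sigma>_invertible: "\<And>t x. t \<in> {0..T} \<Longrightarrow> invertible (\<sigma> t x)"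
    and \<sigma>_inv_bounded: "bounded ((\<lambda>(t, x). matrix_inv (\<sigma> t x)) ` ({0..T} \<times> UNIV))"
    and \<sigma>_inv_continuous: "continuous_on ({0..T} \<times> UNIV) (\<lambda>(t, x). matrix_inv (\<sigma> t x))"
    and h_continuous: "continuous_on ({0..T} \<times> UNIV) (\<lambda>(t, x). h t x)"
    and h'_continuous: "continuous_on ({0..T} \<times> UNIV) (\<lambda>(t, x). h' t x)"
    and g_continuous: "continuous_on UNIV g"
    and ghh'_growth: "\<exists>C>0. \<exists>p>0. \<forall>t\<in>{0..T}. \<forall>x.
      \<bar>g x\<bar> + \<bar>h t x\<bar> + \<bar>h' t x\<bar> \<le> C * (1 + norm x powr p)"
    and h_less_h': "\<And>t x. t \<in> {0..T} \<Longrightarrow> h t x < h' t x"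
    and h_le_g: "\<And>x. h T x \<le> g x"
    and g_le_h': "\<And>x. g x \<le> h' T x"
    and \<Gamma>_nonneg: "\<And>t x a b. t \<in> {0..T} \<Longrightarrow> a \<in> A \<Longrightarrow> b \<in> B \<Longrightarrow> 0 \<le> \<Gamma> t x a b"
    and \<Gamma>_continuous: "continuous_on ({0..T} \<times> UNIV \<times> A \<times> B) (\<lambda>(t, x, a, b). \<Gamma> t x a b)"
    and \<Gamma>_uniformly_continuous: "\<forall>\<epsilon>>0. \<exists>\<delta>>0. \<forall>t\<in>{0..T}. \<forall>x. \<forall>a\<in>A. \<forall>b\<in>B. \<forall>a'\<in>A. \<forall>b'\<in>B.
      dist (a', b') (a, b) < \<delta> \<longrightarrow> dist (\<Gamma> t x a' b') (\<Gamma> t x a b) < \<epsilon>"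
    and \<Gamma>_growth: "\<exists>C>0. \<exists>p>0. \<forall>t\<in>{0..T}. \<forall>x. \<forall>a\<in>A. \<forall>b\<in>B.
      \<bar>\<Gamma> t x a b\<bar> \<le> C * (1 + norm x powr p)"
    and f_continuous: "continuous_on ({0..T} \<times> UNIV \<times> A \<times> B) (\<lambda>(t, x, a, b). f t x a b)"
    and f_continuous_uniformly_t: "\<forall>x. \<forall>a\<in>A. \<forall>b\<in>B. \<forall>\<epsilon>>0. \<exists>\<delta>>0. \<forall>t\<in>{0..T}. \<forall>a'\<in>A. \<forall>b'\<in>B.
      dist (a', b') (a, b) < \<delta> \<longrightarrow> dist (f t x a' b') (f t x a b) < \<epsilon>"
    and f_lipschitz: "\<exists>L. \<forall>t\<in>{0..T}. \<forall>a\<in>A. \<forall>b\<in>B. L-lipschitz_on UNIV (\<lambda>x. f t x a b)"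
    and f_growth: "\<exists>C. \<forall>t\<in>{0..T}. \<forall>x. \<forall>a\<in>A. \<forall>b\<in>B. norm (f t x a b) \<le> C * (1 + norm x)"
    and isaacs: "\<And>t x z. t \<in> {0..T} \<Longrightarrow>
      upper_hamiltonian A B \<sigma> f \<Gamma> t x z = lower_hamiltonian A B \<sigma> f \<Gamma> t x z"
    and v\<^sub>1: "viscosity_solution T A B \<sigma> f \<Gamma> h h' g v\<^sub>1" "poly_growth T v\<^sub>1"
    and v\<^sub>2: "viscosity_solution T A B \<sigma> f \<Gamma> h h' g v\<^sub>2" "poly_growth T v\<^sub>2"
  shows "\<forall>t\<in>{0..T}. \<forall>x. v\<^sub>1 t x = v\<^sub>2 t x"
proof -
  \<comment> \<open>Boundedness passes from \<sigma> to \<sigma> \<sigma>^T through the compact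
    closure of the range.\<close>
  have "continuous_on UNIV (\<lambda>M :: real ^ 'n ^ 'n. M ** transpose M)"
    unfolding matrix_matrix_mult_def transpose_def by (intro continuous_intros)
  then have "continuous_on (closure ((\<lambda>(t, x). \<sigma> t x) ` ({0..T} \<times> UNIV))) (\<lambda>M. M ** transpose M)"
    by (rule continuous_on_subset) simp
  then have "compact ((\<lambda>M. M ** transpose M) ` closure ((\<lambda>(t, x). \<sigma> t x) ` ({0..T} \<times> UNIV)))"
    by (rule compact_continuous_image) (simp add: \<sigma>_bounded)
  from bounded_pos[THEN iffD1, OF compact_imp_bounded[OF this]] obtain M\<^sub>\<sigma> where M: "M\<^sub>\<sigma> > 0"
    "\<forall>X\<in>(\<lambda>M. M ** transpose M) ` closure ((\<lambda>(t, x). \<sigma> t x) ` ({0..T} \<times> UNIV)). norm X \<le> M\<^sub>\<sigma>"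
    by blast
  have M_bound: "norm (\<sigma> t x ** transpose (\<sigma> t x)) \<le> M\<^sub>\<sigma>" if "t \<in> {0..T}" for t x
  proof -
    have "\<sigma> t x \<in> (\<lambda>(t, x). \<sigma> t x) ` ({0..T} \<times> UNIV)"
      by (rule image_eqI[of _ _ "(t, x)"]) (use that in auto)
    then show ?thesis
      by (intro M(2)[rule_format] imageI subsetD[OF closure_subset])
  qed
  obtain L\<^sub>\<sigma> where L: "\<And>t. t \<in> {0..T} \<Longrightarrow> L\<^sub>\<sigma>-lipschitz_on UNIV (\<sigma> t)"
    using \<sigma>_lipschitz by blast
  obtain L\<^sub>f where Lf: "\<And>t a b. t \<in> {0..T} \<Longrightarrow> a \<in> A \<Longrightarrow> b \<in> B \<Longrightarrow> L\<^sub>f-lipschitz_on UNIV (\<lambda>x. f t x a b)"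
    using f_lipschitz by blast
  obtain C\<^sub>f where Cf: "\<And>t x a b. t \<in> {0..T} \<Longrightarrow> a \<in> A \<Longrightarrow> b \<in> B \<Longrightarrow> norm (f t x a b) \<le> C\<^sub>f * (1 + norm x)"
    using f_growth by blast
  \<comment> \<open>Sample points at which the Lipschitz and growth bounds reveal their constants to
    be nonnegative.\<close>
  have T: "0 \<in> {0..T}" using T_pos by simp
  obtain a\<^sub>0 b\<^sub>0 where ab: "a\<^sub>0 \<in> A" "b\<^sub>0 \<in> B" using A(2) B(2) by blast
  interpret qvi_problem T A B \<sigma> f \<Gamma> h h' g M\<^sub>\<sigma> L\<^sub>\<sigma> L\<^sub>f C\<^sub>f
  proof
    show "norm (\<sigma> t x - \<sigma> t y) \<le> L\<^sub>\<sigma> * norm (x - y)" if "t \<in> {0..T}" for t x y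
      using lipschitz_onD[OF L[OF that], of x y] by (simp add: dist_norm)
    show "norm (f t x a b - f t y a b) \<le> L\<^sub>f * norm (x - y)" if "t \<in> {0..T}" "a \<in> A" "b \<in> B" for t x y a b
      using lipschitz_onD[OF Lf[OF that], of x y] by (simp add: dist_norm)
    show "0 \<le> C\<^sub>f"
      using order_trans[OF norm_ge_zero Cf[OF T ab, of 0]] by simp
  qed (use T_pos A B \<sigma>_continuous \<sigma>_invertible h_continuous h'_continuous \<Gamma>_continuous f_continuous
      M(1) M_bound Cf lipschitz_on_nonneg[OF L[OF T]] lipschitz_on_nonneg[OF Lf[OF T ab]] in auto)
  show ?thesis
    using v\<^sub>1 v\<^sub>2 unfolding viscosity_solution_def
    by (intro ballI allI order_antisym) (blast intro: comparison)+
qed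

end
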